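(* Let $(M,g)$ be a smooth, non-compact, complete, boundaryless, connected Riemannian manifold. Then $M(\natural)$ is a Peano space, and consequently $M(\natural)$ is a remainder of $M$. Moreover, any compactification of $M$ with $M(\natural)$ as remainder is strictly smaller than the Stone–Čech compactification of $M$.
   Context: $d$ is the Riemannian distance on $M$. $dl$-function: a function $h:M\to\mathbb{R}$ for which there exist a point $y\in M$ and a sequence of non-empty closed subsets $K_n\subseteq M$ with $d(y,K_n)\to\infty$ such that $h(x)=\lim_{n\to\infty}[d(x,K_n)-d(y,K_n)]$, the limit being in the compact-open topology. Here $d(x,K)=\inf_{z\in K}d(x,z)$. $M(\natural):=\{dl\text{-functions}\}/\{\text{constant functions}\}$: two functions are identified if they differ by a constant; it carries the quotient compact-open topology. Peano space: a compact, connected, locally connected, metrizable (metric) space. A compactification of $M$ is a compact Hausdorff space $\bar M$ together with a topological embedding $i:M\to\bar M$ with $i(M)$ dense in $\bar M$; its remainder (also called boundary) is $\bar M\setminus i(M)$. A topological space $R$ is said to be a remainder of $M$ if there is a compactification of $M$ whose remainder is homeomorphic to $R$; such a compactification is said to have $R$ as remainder. Partial order: for compactifications $(C_1,i_1)$, $(C_2,i_2)$ of $M$, $C_1\le C_2$ means that there is a continuous map $\pi:C_2\to C_1$ with $\pi\circ i_2=i_1$. $C_1$ is strictly smaller than $C_2$ if $C_1\le C_2$ but $C_2\nleq C_1$. *)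

theory Defs
  imports "HOL-Analysis.Analysis"
begin

section \<open>Riemannian manifolds\<close>

text \<open>
  The condition is meant for open \<open>S\<close>. Continuity of all iterated directional derivatives up
  to order \<open>k\<close> along fixed vectors is the usual class \<open>C\<^sup>k\<close> in finite dimension.
\<close>

primrec Ck_on :: "nat \<Rightarrow> ('e::euclidean_space \<Rightarrow> 'f::real_normed_vector) \<Rightarrow> 'e set \<Rightarrow> bool" where
  "Ck_on 0 f S \<longleftrightarrow> continuous_on S f"
| "Ck_on (Suc k) f S \<longleftrightarrow>
     (\<forall>x\<in>S. f differentiable (at x)) \<and> (\<forall>v. Ck_on k (\<lambda>x. frechet_derivative f (at x) v) S)"

definition smooth_on :: "'e::euclidean_space set \<Rightarrow> ('e \<Rightarrow> 'f::real_normed_vector) \<Rightarrow> bool" where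
  "smooth_on S f \<longleftrightarrow> (\<forall>k. Ck_on k f S)"

text \<open>
  A chart \<open>(U, \<phi>)\<close> is a homeomorphism \<open>\<phi>\<close> of an open set \<open>U\<close> onto an open subset of the
  model space \<open>'e\<close>; the values of \<open>\<phi>\<close> outside \<open>U\<close> are irrelevant. As the images are open in
  \<open>'e\<close> itself, there is no boundary. The manifold is the whole type \<open>'a\<close>, and the atlas need
  not be maximal.
\<close>

type_synonym ('a, 'e) chart = "'a set \<times> ('a \<Rightarrow> 'e)"

locale smooth_manifold =
  fixes charts :: "('a::{t2_space, second_countable_topology}, 'e::euclidean_space) chart set"
  assumes covers: "\<exists>(U, \<phi>)\<in>charts. p \<in> U"
    and open_domain: "(U, \<phi>) \<in> charts \<Longrightarrow> open U"
    and open_image: "(U, \<phi>) \<in> charts \<Longrightarrow> open (\<phi> ` U)"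
    and homeo: "(U, \<phi>) \<in> charts \<Longrightarrow> homeomorphism U (\<phi> ` U) \<phi> (inv_into U \<phi>)"
    and compatible: "(U, \<phi>) \<in> charts \<Longrightarrow> (V, \<psi>) \<in> charts \<Longrightarrow>
      smooth_on (\<phi> ` (U \<inter> V)) (\<psi> \<circ> inv_into U \<phi>)"

text \<open>
  The metric tensor is given by its coordinate expressions: \<open>g (U, \<phi>) p u v\<close> is the inner
  product at \<open>p \<in> U\<close> of the two tangent vectors whose coordinate representations in the chart
  \<open>(U, \<phi>)\<close> are \<open>u\<close> and \<open>v\<close>. The axiom \<open>transform\<close> is the transformation law of a covariant
  2-tensor.
\<close>

locale riemannian_manifold = smooth_manifold charts
  for charts :: "('a::{t2_space, second_countable_topology}, 'e::euclidean_space) chart set" +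
  fixes g :: "('a, 'e) chart \<Rightarrow> 'a \<Rightarrow> 'e \<Rightarrow> 'e \<Rightarrow> real"
  assumes bilinear: "(U, \<phi>) \<in> charts \<Longrightarrow> p \<in> U \<Longrightarrow> bilinear (g (U, \<phi>) p)"
    and symmetric: "(U, \<phi>) \<in> charts \<Longrightarrow> p \<in> U \<Longrightarrow> g (U, \<phi>) p u v = g (U, \<phi>) p v u"
    and positive: "(U, \<phi>) \<in> charts \<Longrightarrow> p \<in> U \<Longrightarrow> u \<noteq> 0 \<Longrightarrow> g (U, \<phi>) p u u > 0"
    and smooth: "(U, \<phi>) \<in> charts \<Longrightarrow>
      smooth_on (\<phi> ` U) (\<lambda>x. g (U, \<phi>) (inv_into U \<phi> x) u v)"
    and transform: "(U, \<phi>) \<in> charts \<Longrightarrow> (V, \<psi>) \<in> charts \<Longrightarrow> p \<in> U \<inter> V \<Longrightarrow>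
      D = frechet_derivative (\<psi> \<circ> inv_into U \<phi>) (at (\<phi> p)) \<Longrightarrow>
      g (U, \<phi>) p u v = g (V, \<psi>) p (D u) (D v)"

text \<open>
  A curve is \<open>C\<^sup>1\<close> on \<open>{a..b}\<close> if its coordinate representations have continuous derivatives,
  one-sided ones at the end points included. Requiring this on the closed intervals between
  break points makes the speed of a piecewise \<open>C\<^sup>1\<close> path bounded, hence integrable;
  \<open>piecewise_C1_differentiable_on\<close> would allow unbounded derivatives at break points.
\<close>

definition C1_curve_on ::
  "('a::topological_space, 'e::euclidean_space) chart set \<Rightarrow> real \<Rightarrow> real \<Rightarrow> (real \<Rightarrow> 'a) \<Rightarrow> bool" where
  "C1_curve_on charts a b c \<longleftrightarrow>
     continuous_on {a..b} c \<and>
     (\<forall>(U, \<phi>)\<in>charts. let J = {t \<in> {a..b}. c t \<in> U} in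
        \<exists>v. continuous_on J v \<and> (\<forall>t\<in>J. ((\<phi> \<circ> c) has_vector_derivative v t) (at t within J)))"

definition piecewise_C1_path ::
  "('a::topological_space, 'e::euclidean_space) chart set \<Rightarrow> (real \<Rightarrow> 'a) \<Rightarrow> bool" where
  "piecewise_C1_path charts c \<longleftrightarrow>
     path c \<and>
     (\<exists>T. finite T \<and>
        (\<forall>a b. 0 \<le> a \<and> a < b \<and> b \<le> 1 \<and> {a<..<b} \<inter> T = {} \<longrightarrow> C1_curve_on charts a b c))"

text \<open>
  By the transformation law, the speed does not depend on the chart chosen, except possibly at
  the end points and the finitely many break points, which do not affect the length.
\<close>

definition speed ::
  "('a, 'e::euclidean_space) chart set \<Rightarrow> (('a, 'e) chart \<Rightarrow> 'a \<Rightarrow> 'e \<Rightarrow> 'e \<Rightarrow> real) \<Rightarrow>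
   (real \<Rightarrow> 'a) \<Rightarrow> real \<Rightarrow> real" where
  "speed charts g c t =
     (let k = (SOME k. k \<in> charts \<and> c t \<in> fst k);
          v = vector_derivative (snd k \<circ> c) (at t)
      in sqrt (g k (c t) v v))"

definition curve_length ::
  "('a, 'e::euclidean_space) chart set \<Rightarrow> (('a, 'e) chart \<Rightarrow> 'a \<Rightarrow> 'e \<Rightarrow> 'e \<Rightarrow> real) \<Rightarrow>
   (real \<Rightarrow> 'a) \<Rightarrow> real" where
  "curve_length charts g c = integral {0..1} (speed charts g c)"

definition riemannian_dist ::
  "('a::topological_space, 'e::euclidean_space) chart set \<Rightarrow>
   (('a, 'e) chart \<Rightarrow> 'a \<Rightarrow> 'e \<Rightarrow> 'e \<Rightarrow> real) \<Rightarrow> 'a \<Rightarrow> 'a \<Rightarrow> real" where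
  "riemannian_dist charts g x y =
     (INF c\<in>{c. piecewise_C1_path charts c \<and> pathstart c = x \<and> pathfinish c = y}.
        curve_length charts g c)"

section \<open>The space of dl-functions modulo constants\<close>

text \<open>The underlying set is the set of all continuous functions (take \<open>K = {}\<close>).\<close>

definition compact_open_topology ::
  "('a::topological_space \<Rightarrow> 'b::topological_space) topology" where
  "compact_open_topology =
     topology_generated_by {{f. continuous_on UNIV f \<and> f ` K \<subseteq> U} | K U. compact K \<and> open U}"

definition quotient_topology :: "'a topology \<Rightarrow> ('a \<Rightarrow> 'b) \<Rightarrow> 'b topology" where
  "quotient_topology X q =
     topology (\<lambda>U. U \<subseteq> q ` topspace X \<and> openin X {x \<in> topspace X. q x \<in> U})"

lemma openin_quotient_topology:
  "openin (quotient_topology X q) U \<longleftrightarrow>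
     U \<subseteq> q ` topspace X \<and> openin X {x \<in> topspace X. q x \<in> U}"
proof -
  have "istopology (\<lambda>U. U \<subseteq> q ` topspace X \<and> openin X {x \<in> topspace X. q x \<in> U})"
    unfolding istopology_def
  proof (intro conjI allI impI)
    fix S T
    assume S: "S \<subseteq> q ` topspace X \<and> openin X {x \<in> topspace X. q x \<in> S}"
      and T: "T \<subseteq> q ` topspace X \<and> openin X {x \<in> topspace X. q x \<in> T}"
    then show "S \<inter> T \<subseteq> q ` topspace X" by blast
    have "{x \<in> topspace X. q x \<in> S \<inter> T} =
        {x \<in> topspace X. q x \<in> S} \<inter> {x \<in> topspace X. q x \<in> T}" by blast
    then show "openin X {x \<in> topspace X. q x \<in> S \<inter> T}" using S T by auto
  next
    fix \<K>
    assume K: "\<forall>S\<in>\<K>. S \<subseteq> q ` topspace X \<and> openin X {x \<in> topspace X. q x \<in> S}"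
    then show "\<Union>\<K> \<subseteq> q ` topspace X" by blast
    have "{x \<in> topspace X. q x \<in> \<Union>\<K>} = (\<Union>S\<in>\<K>. {x \<in> topspace X. q x \<in> S})" by blast
    then show "openin X {x \<in> topspace X. q x \<in> \<Union>\<K>}" using K by auto
  qed
  then show ?thesis
    by (simp add: quotient_topology_def topology_inverse')
qed

lemma topspace_quotient_topology: "topspace (quotient_topology X q) = q ` topspace X"
proof
  show "topspace (quotient_topology X q) \<subseteq> q ` topspace X"
    using openin_quotient_topology[of X q "topspace (quotient_topology X q)"] by simp
  have "{x \<in> topspace X. q x \<in> q ` topspace X} = topspace X" by blast
  then have "openin (quotient_topology X q) (q ` topspace X)"
    by (simp add: openin_quotient_topology)
  then show "q ` topspace X \<subseteq> topspace (quotient_topology X q)"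
    by (rule openin_subset)
qed

lemma quotient_map_quotient_topology: "quotient_map X (quotient_topology X q) q"
  by (auto simp: quotient_map_def topspace_quotient_topology openin_quotient_topology)

text \<open>
  In this section \<open>d\<close> is the distance function of the space under consideration, which is in
  general not the one of the type class \<open>metric_space\<close>.
\<close>

definition dist_to_set :: "('a \<Rightarrow> 'a \<Rightarrow> real) \<Rightarrow> 'a \<Rightarrow> 'a set \<Rightarrow> real" where
  "dist_to_set d x K = (INF z\<in>K. d x z)"

definition dl_function :: "('a::topological_space \<Rightarrow> 'a \<Rightarrow> real) \<Rightarrow> ('a \<Rightarrow> real) \<Rightarrow> bool" where
  "dl_function d h \<longleftrightarrow>
     (\<exists>y K. (\<forall>n. closed (K n) \<and> K n \<noteq> {}) \<and>
        filterlim (\<lambda>n. dist_to_set d y (K n)) at_top sequentially \<and>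
        limitin compact_open_topology
          (\<lambda>n x. dist_to_set d x (K n) - dist_to_set d y (K n)) h sequentially)"

definition mod_constants :: "('a::topological_space \<Rightarrow> 'a \<Rightarrow> real) \<Rightarrow> (('a \<Rightarrow> real) \<times> ('a \<Rightarrow> real)) set" where
  "mod_constants d =
     {(h, h'). dl_function d h \<and> dl_function d h' \<and> (\<exists>r. \<forall>x. h' x = h x + r)}"

definition M_natural :: "('a::topological_space \<Rightarrow> 'a \<Rightarrow> real) \<Rightarrow> ('a \<Rightarrow> real) set topology" where
  "M_natural d =
     quotient_topology (subtopology compact_open_topology {h. dl_function d h})
       (\<lambda>h. mod_constants d `` {h})"

definition peano_space :: "'a topology \<Rightarrow> bool" where
  "peano_space X \<longleftrightarrow>
     compact_space X \<and> connected_space X \<and> locally_connected_space X \<and> metrizable_space X"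

section \<open>Compactifications and remainders\<close>

definition compactification :: "'a topology \<Rightarrow> 'c topology \<Rightarrow> ('a \<Rightarrow> 'c) \<Rightarrow> bool" where
  "compactification X C i \<longleftrightarrow>
     compact_space C \<and> Hausdorff_space C \<and> embedding_map X C i \<and>
     C closure_of (i ` topspace X) = topspace C"

definition remainder :: "'a topology \<Rightarrow> 'c topology \<Rightarrow> ('a \<Rightarrow> 'c) \<Rightarrow> 'c topology" where
  "remainder X C i = subtopology C (topspace C - i ` topspace X)"

definition compactification_with_remainder ::
  "'a topology \<Rightarrow> 'c topology \<Rightarrow> ('a \<Rightarrow> 'c) \<Rightarrow> 'r topology \<Rightarrow> bool" where
  "compactification_with_remainder X C i R \<longleftrightarrow>
     compactification X C i \<and> remainder X C i homeomorphic_space R"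

text \<open>
  The existential quantifier over compactifications has to range over one type. There is no loss
  in taking \<open>'a + 'r\<close>, since a compactification of \<open>X\<close> with remainder \<open>R\<close> is, as a set, a
  disjoint union of copies of \<open>X\<close> and \<open>R\<close>; see \<open>is_remainderI\<close> below.
\<close>

definition is_remainder :: "'a topology \<Rightarrow> 'r topology \<Rightarrow> bool" where
  "is_remainder X R \<longleftrightarrow>
     (\<exists>(C :: ('a + 'r) topology) i. compactification_with_remainder X C i R)"

definition compactification_le ::
  "'a topology \<Rightarrow> 'c topology \<Rightarrow> ('a \<Rightarrow> 'c) \<Rightarrow> 'd topology \<Rightarrow> ('a \<Rightarrow> 'd) \<Rightarrow> bool" where
  "compactification_le X C\<^sub>1 i\<^sub>1 C\<^sub>2 i\<^sub>2 \<longleftrightarrow>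
     (\<exists>\<pi>. continuous_map C\<^sub>2 C\<^sub>1 \<pi> \<and> (\<forall>x\<in>topspace X. \<pi> (i\<^sub>2 x) = i\<^sub>1 x))"

definition compactification_less ::
  "'a topology \<Rightarrow> 'c topology \<Rightarrow> ('a \<Rightarrow> 'c) \<Rightarrow> 'd topology \<Rightarrow> ('a \<Rightarrow> 'd) \<Rightarrow> bool" where
  "compactification_less X C\<^sub>1 i\<^sub>1 C\<^sub>2 i\<^sub>2 \<longleftrightarrow>
     compactification_le X C\<^sub>1 i\<^sub>1 C\<^sub>2 i\<^sub>2 \<and> \<not> compactification_le X C\<^sub>2 i\<^sub>2 C\<^sub>1 i\<^sub>1"

text \<open>
  The Stone-Cech compactification of a completely regular Hausdorff space: the closure of the
  image of the evaluation map in the cube \<open>[0,1]\<^bsup>C(X,[0,1])\<^esup>\<close>.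
\<close>

definition unit_functions :: "'a topology \<Rightarrow> ('a \<Rightarrow> real) set" where
  "unit_functions X =
     {f \<in> extensional (topspace X). continuous_map X (top_of_set {0..1}) f}"

definition stone_cech_map :: "'a topology \<Rightarrow> 'a \<Rightarrow> ('a \<Rightarrow> real) \<Rightarrow> real" where
  "stone_cech_map X x = (\<lambda>f\<in>unit_functions X. f x)"

definition stone_cech :: "'a topology \<Rightarrow> (('a \<Rightarrow> real) \<Rightarrow> real) topology" where
  "stone_cech X =
     (let P = product_topology (\<lambda>_. top_of_set {0..1}) (unit_functions X)
      in subtopology P (P closure_of (stone_cech_map X ` topspace X)))"

lemma compactification_with_remainder_homeomorphic:
  assumes C: "compactification_with_remainder X C i R" and f: "homeomorphic_map C C' f"
  shows "compactification_with_remainder X C' (f \<circ> i) R"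
proof -
  have i: "compact_space C" "Hausdorff_space C" "embedding_map X C i"
      "C closure_of (i ` topspace X) = topspace C" "remainder X C i homeomorphic_space R"
    using C by (auto simp: compactification_with_remainder_def compactification_def)
  have CC': "C homeomorphic_space C'"
    using f homeomorphic_map_imp_homeomorphic_space by blast
  have sub: "i ` topspace X \<subseteq> topspace C"
    using i(3) unfolding embedding_map_def
    by (auto dest!: homeomorphic_imp_surjective_map)
  have fC: "f ` topspace C = topspace C'" and inj: "inj_on f (topspace C)"
    using f by (auto simp: homeomorphic_imp_surjective_map homeomorphic_imp_injective_map)
  have "embedding_map X C' (f \<circ> i)"
    using i(3) f fC by (intro embedding_map_compose) (auto simp: embedding_map_def)
  moreover have "C' closure_of ((f \<circ> i) ` topspace X) = topspace C'"
    using homeomorphic_map_closure_of[OF f sub] i(4) fC by (simp add: image_comp)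
  moreover have "f ` (topspace C - i ` topspace X) = topspace C' - (f \<circ> i) ` topspace X"
    using fC inj sub by (simp add: inj_on_image_set_diff image_comp)
  then have "homeomorphic_map (remainder X C i) (remainder X C' (f \<circ> i)) f"
    unfolding remainder_def using f sub fC
    by (intro homeomorphic_map_subtopologies) (auto simp: Int_absorb1)
  then have "remainder X C' (f \<circ> i) homeomorphic_space R"
    using i(5) homeomorphic_map_imp_homeomorphic_space homeomorphic_space_sym
      homeomorphic_space_trans by blast
  ultimately show ?thesis
    using i homeomorphic_compact_space[OF CC'] homeomorphic_Hausdorff_space[OF CC']
    by (simp add: compactification_with_remainder_def compactification_def)
qed

lemma is_remainderI:
  fixes X :: "'a topology" and R :: "'r topology" and C :: "'c topology"
  assumes "compactification_with_remainder X C i R"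
  shows "is_remainder X R"
proof -
  have "embedding_map X C i" "remainder X C i homeomorphic_space R"
    using assms by (auto simp: compactification_with_remainder_def compactification_def)
  then have i: "inj_on i (topspace X)"
    by (simp add: embedding_map_def homeomorphic_imp_injective_map)
  obtain r where "homeomorphic_map (remainder X C i) R r"
    using \<open>remainder X C i homeomorphic_space R\<close> homeomorphic_space by blast
  then have r: "inj_on r (topspace C - i ` topspace X)"
    by (auto dest!: homeomorphic_imp_injective_map simp: remainder_def Int_absorb1)
  define f :: "'c \<Rightarrow> 'a + 'r" where
    "f = (\<lambda>z. if z \<in> i ` topspace X then Inl (inv_into (topspace X) i z) else Inr (r z))"
  have "inj_on f (topspace C)"
    unfolding f_def by (rule inj_onI) (use r in \<open>auto simp: i split: if_splits dest: inj_onD\<close>)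
  then have "homeomorphic_map C (quotient_topology C f) f"
    using quotient_map_quotient_topology by (simp add: homeomorphic_map_def)
  then show ?thesis
    using compactification_with_remainder_homeomorphic[OF assms] is_remainder_def by blast
qed

end

theory Submission
  imports Defs
begin

text \<open>
  The distance \<open>d\<close> of a connected Riemannian manifold is a length metric inducing the manifold
  topology: lengths of curves give the triangle inequality and points nearly between two given
  points, and in a chart \<open>d\<close> is comparable to the Euclidean distance. For a complete length
  metric closed balls are compact (Hopf--Rinow, \<open>compact_mcball\<close>). Everything else happens in
  such a proper, noncompact length space.

  Normalized to vanish at \<open>p\<close>, the dl-functions are the pointwise limits of
  \<open>x \<mapsto> d(x,K) - s\<close> with \<open>s \<rightarrow> \<infinity>\<close> (\<open>dl_function_iff\<close>), and \<open>M_natural\<close> is homeomorphic to the set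
  \<open>dl_normalized p\<close> of these with the topology of pointwise convergence, because all functions
  involved are 1-Lipschitz (\<open>M_natural_homeomorphic\<close>). That set is a closed subset of a product of
  compact intervals, hence compact, and it is metrizable because a 1-Lipschitz function is
  determined by its values on a countable dense set.

  The key to connectedness is that limit functions are closed under adding constants and under
  taking minima: replacing \<open>K\<close> by its closed \<open>r\<close>-neighbourhood lowers \<open>d(\<cdot>,K)\<close> by \<open>r\<close>, and the
  distance to a union is the minimum of the distances. Hence limit functions are also closed
  under infima. As \<open>t\<close> runs from \<open>-\<infinity>\<close> to \<open>\<infinity>\<close>, the function \<open>min h\<^sub>1 (h\<^sub>2 + t)\<close> moves, modulo
  constants, from \<open>h\<^sub>2\<close> to \<open>h\<^sub>1\<close>, and it stays near \<open>h\<^sub>2\<close> on a finite set if \<open>h\<^sub>1\<close> is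
  near \<open>h\<^sub>2\<close> there; this gives local connectedness (\<open>locally_connected_dl_normalized\<close>).
  Moreover, for a sequence \<open>q\<^sub>m\<close> the infimum over \<open>m\<close> of \<open>q\<^sub>m + \<bar>t - m\<^sup>2\<bar>\<close> is a curve passing near
  every \<open>q\<^sub>m\<close> with large \<open>m\<close>, so there is a curve \<open>\<gamma>\<close> in \<open>dl_normalized p\<close> all of whose tails are
  dense (\<open>dl_normalized_dense_curve\<close>). Its existence implies connectedness.

  It also makes \<open>M_natural\<close> a remainder: \<open>x \<mapsto> \<gamma> (d p x)\<close> maps the complement of each compact set
  onto a dense set, so closing up the graph of this map in the product with the one-point
  compactification adds exactly one copy of the target (\<open>is_remainder_of_dense_map\<close>).

  Every compactification is a quotient of the Stone-Cech compactification. If conversely a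
  compactification with metrizable remainder dominated it, all continuous functions with values
  in \<open>[0,1]\<close> would extend. Extending \<open>1 / (1 + d p x)\<close> and, by Tietze, the distance in the remainder
  to a point \<open>z\<close>, one gets a continuous \<open>\<psi>\<close> vanishing only at \<open>z\<close>. By connectedness \<open>\<psi>\<close> takes all
  small positive values on the space, so \<open>cos (\<pi> / \<psi>)\<close> has no limit at \<open>z\<close> and does not extend
  (\<open>not_stone_cech_le\<close>).
\<close>

section \<open>Complete length spaces\<close>

text \<open>
  Only nearly intermediate points are required, so that the definition of the Riemannian distance
  as an infimum yields them directly; the point is at the exact distance \<open>s\<close> from \<open>x\<close>.
\<close>

locale length_space =
  fixes d :: "'a::{t2_space, second_countable_topology} \<Rightarrow> 'a \<Rightarrow> real"
  assumes metric: "Metric_space UNIV d"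
    and mtopology_eq: "Metric_space.mtopology UNIV d = euclidean"
    and between: "0 \<le> s \<Longrightarrow> s \<le> d x y \<Longrightarrow> 0 < e \<Longrightarrow> \<exists>z. d x z = s \<and> d z y \<le> d x y - s + e"

sublocale length_space \<subseteq> Metric_space UNIV d
  by (rule metric)

context length_space
begin

lemma closed_mcball: "closed (mcball p r)"
  using closedin_mcball[of p r] by (simp add: mtopology_eq)

lemma open_mball: "open (mball p r)"
  using openin_mball[of p r] by (simp add: mtopology_eq)

text \<open>
  The theorem of Hopf, Rinow and Cohn-Vossen. The radii of compact balls around \<open>p\<close> form an
  interval. It is closed: a point of the limiting ball is close to a slightly smaller ball, so
  the limiting ball is totally bounded. It is open: finitely many compact neighbourhoods cover a
  compact ball and hence, by a Lebesgue number, a slightly larger ball.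
\<close>

lemma compact_mcball:
  assumes complete: "mcomplete"
    and loc: "\<And>q :: 'a. \<exists>W K. open W \<and> compact K \<and> q \<in> W \<and> W \<subseteq> K"
  shows "compact (mcball p r)"
proof (rule ccontr)
  assume not: "\<not> compact (mcball p r)"
  define S where "S = {s. 0 \<le> s \<and> compact (mcball p s)}"
  have mono: "compact (mcball p s)" if "compact (mcball p t)" "s \<le> t" for s t
    using closed_mcball[of p s] that compact_Int_closed[OF that(1) closed_mcball[of p s]]
      mcball_subset_concentric[OF that(2), of p] by (simp add: Int_absorb1)
  have "s \<le> r" if "s \<in> S" for s
    using mono[of s r] not that unfolding S_def by fastforce
  then have bdd: "bdd_above S" by (meson bdd_above.I)
  have "x = p" if "d p x \<le> 0" for x using that nonneg[of p x] zero[of p x] by simp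
  then have "mcball p 0 = {p}" by auto
  then have S0: "0 \<in> S" unfolding S_def by simp
  define s where "s = Sup S"
  have s0: "0 \<le> s" unfolding s_def by (rule cSup_upper[OF S0 bdd])
  \<comment> \<open>the supremum is attained\<close>
  have "mtotally_bounded (mcball p s)"
    unfolding mtotally_bounded_def
  proof (intro allI impI)
    fix e :: real assume "0 < e"
    have "s - e / 4 < Sup S" using \<open>0 < e\<close> by (simp add: s_def)
    then obtain t where t: "t \<in> S" "s - e / 4 < t" using less_cSupE[of "s - e/4" S] S0 by blast
    have ts: "t \<le> s" unfolding s_def by (rule cSup_upper[OF t(1) bdd])
    have "compactin mtopology (mcball p t)" using t(1) by (simp add: S_def mtopology_eq)
    then have tb: "mtotally_bounded (mcball p t)" by (rule compactin_imp_mtotally_bounded)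
    have "0 < e / 2" using \<open>0 < e\<close> by simp
    from tb[unfolded mtotally_bounded_def, rule_format, OF this]
    obtain K where K: "finite K" "K \<subseteq> mcball p t" "mcball p t \<subseteq> (\<Union>x\<in>K. mball x (e / 2))"
      by blast
    have "\<exists>k\<in>K. d k x < e" if x: "x \<in> mcball p s" for x
    proof -
      have "\<exists>z. z \<in> mcball p t \<and> d z x < e / 2"
      proof (cases "d p x \<le> t")
        case True
        then show ?thesis using \<open>0 < e\<close> by (intro exI[of _ x]) simp
      next
        case False
        then obtain z where "d p z = t" "d z x \<le> d p x - t + e / 4"
          using between[of t p x "e / 4"] t(1) \<open>0 < e\<close> unfolding S_def by auto
        then show ?thesis using x t(2) by (intro exI[of _ z]) auto
      qed
      then obtain z where z: "z \<in> mcball p t" "d z x < e / 2" by blast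
      then obtain k where k: "k \<in> K" "d k z < e / 2" using K(3) by fastforce
      have "d k x < e" using triangle[of k z x] k z by simp
      with k(1) show ?thesis by blast
    qed
    moreover have "K \<subseteq> mcball p s" using K(2) mcball_subset_concentric[OF ts, of p] by blast
    ultimately show "\<exists>K. finite K \<and> K \<subseteq> mcball p s \<and> mcball p s \<subseteq> (\<Union>x\<in>K. mball x e)"
      using K(1) by (intro exI[of _ K]) fastforce
  qed
  then have "compactin mtopology (mtopology closure_of (mcball p s))"
    using mtotally_bounded_eq_compact_closure_of[OF complete] by blast
  then have comp: "compact (mcball p s)"
    using closed_mcball[of p s] by (simp add: mtopology_eq)
  have "\<forall>q :: 'a. \<exists>W K. open W \<and> compact K \<and> q \<in> W \<and> W \<subseteq> K" using loc by simp
  from choice[OF this] obtain W :: "'a \<Rightarrow> 'a set" where "\<forall>q. \<exists>K. open (W q) \<and> compact K \<and> q \<in> W q \<and> W q \<subseteq> K" ..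
  from choice[OF this] obtain K :: "'a \<Rightarrow> 'a set" where
    WK: "\<forall>q. open (W q) \<and> compact (K q) \<and> q \<in> W q \<and> W q \<subseteq> K q" ..
  then have W: "\<And>q. open (W q)" "\<And>q. q \<in> W q" and K: "\<And>q. compact (K q)" "\<And>q. W q \<subseteq> K q"
    by simp_all
  obtain Q where Q: "Q \<subseteq> mcball p s" "finite Q" "mcball p s \<subseteq> (\<Union>q\<in>Q. W q)"
    using compactE_image[OF comp, of "mcball p s" W] W by blast
  define C where "C = (\<Union>q\<in>Q. K q)"
  have "compact C" unfolding C_def by (intro compact_UN Q K)
  obtain \<delta> where \<delta>: "\<delta> > 0" "\<And>x. x \<in> mcball p s \<Longrightarrow> \<exists>U \<in> W ` Q. mball x \<delta> \<subseteq> U"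
  proof -
    have "\<exists>\<epsilon>>0. \<forall>x\<in>mcball p s. \<exists>U \<in> W ` Q. mball x \<epsilon> \<subseteq> U"
      by (rule lebesgue_number) (use comp Q(3) W(1) in \<open>auto simp: mtopology_eq\<close>)
    then show ?thesis using that by blast
  qed
  \<comment> \<open>the supremum can be exceeded\<close>
  have "mcball p (s + \<delta> / 2) \<subseteq> C"
  proof
    fix x assume x: "x \<in> mcball p (s + \<delta> / 2)"
    have "\<exists>z. z \<in> mcball p s \<and> d z x < \<delta>"
    proof (cases "d p x \<le> s")
      case True
      then show ?thesis using \<delta>(1) by (intro exI[of _ x]) simp
    next
      case False
      then obtain z where "d p z = s" "d z x \<le> d p x - s + \<delta> / 4"
        using between[of s p x "\<delta> / 4"] s0 \<delta>(1) by auto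
      then show ?thesis using x \<delta>(1) by (intro exI[of _ z]) auto
    qed
    then obtain z where "z \<in> mcball p s" "x \<in> mball z \<delta>" by auto
    with \<delta>(2) obtain q where "q \<in> Q" "x \<in> W q" by blast
    then show "x \<in> C" using K(2) unfolding C_def by blast
  qed
  then have "compact (mcball p (s + \<delta> / 2))"
    using compact_Int_closed[OF \<open>compact C\<close> closed_mcball[of p "s + \<delta> / 2"]] by (simp add: Int_absorb1)
  then have "s + \<delta> / 2 \<in> S" using s0 \<delta>(1) unfolding S_def by simp
  then have "s + \<delta> / 2 \<le> s" unfolding s_def by (rule cSup_upper[OF _ bdd])
  then show False using \<delta>(1) by simp
qed

lemma dist_to_set_le: "z \<in> K \<Longrightarrow> dist_to_set d x K \<le> d x z"
  unfolding dist_to_set_def by (rule cINF_lower) (auto intro!: bdd_belowI[of _ 0])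

lemma dist_to_set_greatest: "K \<noteq> {} \<Longrightarrow> (\<And>z. z \<in> K \<Longrightarrow> r \<le> d x z) \<Longrightarrow> r \<le> dist_to_set d x K"
  unfolding dist_to_set_def by (rule cINF_greatest)

lemma dist_to_set_nonneg: "K \<noteq> {} \<Longrightarrow> 0 \<le> dist_to_set d x K"
  by (rule dist_to_set_greatest) auto

lemma dist_to_set_lessD:
  assumes "K \<noteq> {}" "dist_to_set d x K < r"
  obtains z where "z \<in> K" "d x z < r"
  using assms dist_to_set_greatest[of K r x] by fastforce

lemma dist_to_set_lipschitz:
  assumes "K \<noteq> {}"
  shows "dist_to_set d x K \<le> d x y + dist_to_set d y K"
proof -
  have "dist_to_set d x K - d x y \<le> dist_to_set d y K"
  proof (rule dist_to_set_greatest[OF assms])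
    fix z assume "z \<in> K"
    then have "dist_to_set d x K \<le> d x z" by (rule dist_to_set_le)
    then show "dist_to_set d x K - d x y \<le> d y z" using triangle[of x y z] by simp
  qed
  then show ?thesis by simp
qed

lemma dist_to_set_Un:
  assumes "K \<noteq> {}" "L \<noteq> {}"
  shows "dist_to_set d x (K \<union> L) = min (dist_to_set d x K) (dist_to_set d x L)"
  unfolding dist_to_set_def image_Un inf_min[symmetric]
  by (rule cInf_union_distrib) (use assms in \<open>auto intro!: bdd_belowI[of _ 0]\<close>)

definition neighbourhood :: "real \<Rightarrow> 'a set \<Rightarrow> 'a set" where
  "neighbourhood r K = {x. dist_to_set d x K \<le> r}"

lemma closed_neighbourhood:
  assumes "K \<noteq> {}"
  shows "closed (neighbourhood r K)"
proof -
  have "open (- neighbourhood r K)"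
  proof (rule topological_space_class.openI)
    fix x assume "x \<in> - neighbourhood r K"
    then have x: "r < dist_to_set d x K" by (simp add: neighbourhood_def)
    show "\<exists>T. open T \<and> x \<in> T \<and> T \<subseteq> - neighbourhood r K"
    proof (intro exI conjI)
      show "open (mball x (dist_to_set d x K - r))" by (rule open_mball)
      show "x \<in> mball x (dist_to_set d x K - r)" using x by simp
      show "mball x (dist_to_set d x K - r) \<subseteq> - neighbourhood r K"
      proof
        fix y assume "y \<in> mball x (dist_to_set d x K - r)"
        then show "y \<in> - neighbourhood r K"
          using dist_to_set_lipschitz[OF assms, of x y] by (simp add: neighbourhood_def)
      qed
    qed
  qed
  then show ?thesis by (simp add: closed_def)
qed

lemma neighbourhood_superset:
  assumes "0 \<le> r"
  shows "K \<subseteq> neighbourhood r K"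
proof
  fix x assume "x \<in> K"
  then have "dist_to_set d x K \<le> d x x" by (rule dist_to_set_le)
  then show "x \<in> neighbourhood r K" using assms by (simp add: neighbourhood_def)
qed

text \<open>
  This is where the metric has to be a length metric: on the way from \<open>x\<close> to a nearest point
  of \<open>K\<close> one enters the neighbourhood after \<open>dist_to_set d x K - r\<close>.
\<close>

lemma dist_to_neighbourhood:
  assumes K: "K \<noteq> {}" and r: "0 \<le> r"
  shows "dist_to_set d x (neighbourhood r K) = max 0 (dist_to_set d x K - r)"
proof -
  let ?N = "neighbourhood r K" and ?D = "dist_to_set d x K"
  have N: "?N \<noteq> {}" using neighbourhood_superset[OF r, of K] K by blast
  show ?thesis
  proof (cases "?D \<le> r")
    case True
    then have "x \<in> ?N" by (simp add: neighbourhood_def)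
    then have "dist_to_set d x ?N \<le> d x x" by (rule dist_to_set_le)
    then have "dist_to_set d x ?N = 0" using dist_to_set_nonneg[OF N, of x] by simp
    then show ?thesis using True by simp
  next
    case False
    have "?D - r \<le> dist_to_set d x ?N"
    proof (rule dist_to_set_greatest[OF N])
      fix z assume "z \<in> ?N"
      then show "?D - r \<le> d x z" using dist_to_set_lipschitz[OF K, of x z] by (simp add: neighbourhood_def)
    qed
    moreover have "dist_to_set d x ?N \<le> ?D - r"
    proof (rule field_le_epsilon)
      fix e :: real assume e: "0 < e"
      then have "?D < ?D + e / 2" by simp
      then obtain k where k: "k \<in> K" "d x k < ?D + e / 2" using dist_to_set_lessD[OF K] by blast
      have "?D \<le> d x k" using k(1) by (rule dist_to_set_le)
      then obtain z where z: "d k z = r" "d z x \<le> d k x - r + e / 2"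
        using between[of r k x "e / 2"] False r e by (auto simp: commute)
      have "dist_to_set d z K \<le> d z k" using k(1) by (rule dist_to_set_le)
      then have "z \<in> ?N" using z(1) by (simp add: neighbourhood_def commute)
      then have "dist_to_set d x ?N \<le> d x z" by (rule dist_to_set_le)
      then show "dist_to_set d x ?N \<le> ?D - r + e" using z(2) k(2) by (simp add: commute)
    qed
    ultimately show ?thesis using False by simp
  qed
qed

section \<open>Limits of shifted distance functions\<close>

text \<open>
  The dl-functions up to additive constants, described without a base point and without sequences:
  each basic neighbourhood of \<open>h\<close> for pointwise convergence contains some \<open>d(\<cdot>,K) - s\<close> with
  arbitrarily large \<open>s\<close>.
\<close>

definition dl_limits :: "('a \<Rightarrow> real) set" where
  "dl_limits = {h. \<forall>F e N. finite F \<longrightarrow> 0 < e \<longrightarrow>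
     (\<exists>K s. closed K \<and> K \<noteq> {} \<and> N \<le> s \<and> (\<forall>x\<in>F. \<bar>dist_to_set d x K - s - h x\<bar> < e))}"

lemma dl_limits_E:
  assumes "h \<in> dl_limits" "finite F" "0 < e"
  obtains K s where "closed K" "K \<noteq> {}" "N \<le> s" "\<And>x. x \<in> F \<Longrightarrow> \<bar>dist_to_set d x K - s - h x\<bar> < e"
proof -
  have "\<exists>K s. closed K \<and> K \<noteq> {} \<and> N \<le> s \<and> (\<forall>x\<in>F. \<bar>dist_to_set d x K - s - h x\<bar> < e)"
    using assms unfolding dl_limits_def by simp
  with that show ?thesis by blast
qed

lemma dl_limits_I:
  assumes "\<And>F e N. finite F \<Longrightarrow> 0 < e \<Longrightarrow>
     (\<exists>K s. closed K \<and> K \<noteq> {} \<and> N \<le> s \<and> (\<forall>x\<in>F. \<bar>dist_to_set d x K - s - h x\<bar> < e))"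
  shows "h \<in> dl_limits"
  using assms unfolding dl_limits_def by simp

lemma dl_limits_shift:
  assumes "h \<in> dl_limits"
  shows "(\<lambda>x. h x + c) \<in> dl_limits"
proof (rule dl_limits_I)
  fix F :: "'a set" and e N :: real assume F: "finite F" "0 < e"
  obtain K s where "closed K" "K \<noteq> {}" "N + c \<le> s" "\<And>x. x \<in> F \<Longrightarrow> \<bar>dist_to_set d x K - s - h x\<bar> < e"
    by (rule dl_limits_E[OF assms F, of "N + c"]) blast
  then show "\<exists>K s. closed K \<and> K \<noteq> {} \<and> N \<le> s \<and> (\<forall>x\<in>F. \<bar>dist_to_set d x K - s - (h x + c)\<bar> < e)"
    by (intro exI[of _ K] exI[of _ "s - c"]) (auto simp: algebra_simps)
qed

lemma dl_limits_approx:
  assumes "\<And>F e. finite F \<Longrightarrow> 0 < e \<Longrightarrow> \<exists>g\<in>dl_limits. \<forall>x\<in>F. \<bar>g x - h x\<bar> < e"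
  shows "h \<in> dl_limits"
proof (rule dl_limits_I)
  fix F :: "'a set" and e N :: real assume F: "finite F" "0 < e"
  then have e2: "0 < e / 2" by simp
  obtain g where g: "g \<in> dl_limits" "\<And>x. x \<in> F \<Longrightarrow> \<bar>g x - h x\<bar> < e / 2" using assms[OF F(1) e2] by blast
  obtain K s where K: "closed K" "K \<noteq> {}" "N \<le> s" "\<And>x. x \<in> F \<Longrightarrow> \<bar>dist_to_set d x K - s - g x\<bar> < e / 2"
    by (rule dl_limits_E[OF g(1) F(1) e2, of N]) blast
  have "\<bar>dist_to_set d x K - s - h x\<bar> < e" if "x \<in> F" for x
    using g(2)[OF that] K(4)[OF that] by linarith
  with K show "\<exists>K s. closed K \<and> K \<noteq> {} \<and> N \<le> s \<and> (\<forall>x\<in>F. \<bar>dist_to_set d x K - s - h x\<bar> < e)"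
    by blast
qed

lemma dl_limits_lipschitz:
  assumes "h \<in> dl_limits"
  shows "\<bar>h x - h y\<bar> \<le> d x y"
proof (rule field_le_epsilon)
  fix e :: real assume "0 < e"
  then have e2: "0 < e / 2" by simp
  obtain K s where K: "closed K" "K \<noteq> {}" "0 \<le> s"
    "\<And>z. z \<in> {x, y} \<Longrightarrow> \<bar>dist_to_set d z K - s - h z\<bar> < e / 2"
    by (rule dl_limits_E[OF assms _ e2, of "{x, y}" 0]) auto
  have close: "dist_to_set d z K - s - h z < e / 2" "- (e / 2) < dist_to_set d z K - s - h z"
    if "z \<in> {x, y}" for z
    using K(4)[OF that] by linarith+
  have "h x - h y \<le> d x y + e"
    using close[of x] close[of y] dist_to_set_lipschitz[OF K(2), of x y] by simp
  moreover have "h y - h x \<le> d x y + e"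
    using close[of x] close[of y] dist_to_set_lipschitz[OF K(2), of y x] commute[of x y] by simp
  ultimately show "\<bar>h x - h y\<bar> \<le> d x y + e" by linarith
qed

text \<open>
  Both sets are thickened until the shifts \<open>s1\<close> and \<open>s2\<close> agree; their union then has the minimum of
  the two functions as its shifted distance. The shifts exceed the values on \<open>F\<close>, so the
  points of \<open>F\<close> stay outside the thickened sets.
\<close>

lemma dl_limits_min:
  assumes "h1 \<in> dl_limits" "h2 \<in> dl_limits"
  shows "(\<lambda>x. min (h1 x) (h2 x)) \<in> dl_limits"
proof (rule dl_limits_I)
  fix F :: "'a set" and e N :: real assume F: "finite F" "0 < e"
  define R where "R = Max (insert 0 ((\<lambda>x. \<bar>h1 x\<bar>) ` F \<union> (\<lambda>x. \<bar>h2 x\<bar>) ` F))"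
  have R: "\<bar>h1 x\<bar> \<le> R" "\<bar>h2 x\<bar> \<le> R" if "x \<in> F" for x
    unfolding R_def using F(1) that by (auto intro!: Max_ge)
  obtain K1 s1 where K1: "closed K1" "K1 \<noteq> {}" "max N (R + e) \<le> s1"
    "\<And>x. x \<in> F \<Longrightarrow> \<bar>dist_to_set d x K1 - s1 - h1 x\<bar> < e"
    by (rule dl_limits_E[OF assms(1) F, of "max N (R + e)"]) blast
  obtain K2 s2 where K2: "closed K2" "K2 \<noteq> {}" "max N (R + e) \<le> s2"
    "\<And>x. x \<in> F \<Longrightarrow> \<bar>dist_to_set d x K2 - s2 - h2 x\<bar> < e"
    by (rule dl_limits_E[OF assms(2) F, of "max N (R + e)"]) blast
  define s where "s = min s1 s2"
  let ?N1 = "neighbourhood (s1 - s) K1" and ?N2 = "neighbourhood (s2 - s) K2"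
  have r: "0 \<le> s1 - s" "0 \<le> s2 - s" by (simp_all add: s_def)
  have ne: "?N1 \<noteq> {}" "?N2 \<noteq> {}" using K1(2) K2(2) neighbourhood_superset r by blast+
  have "\<bar>dist_to_set d x (?N1 \<union> ?N2) - s - min (h1 x) (h2 x)\<bar> < e" if x: "x \<in> F" for x
  proof -
    have s: "R + e \<le> s" using K1(3) K2(3) unfolding s_def by simp
    have "dist_to_set d x K1 - (s1 - s) \<ge> 0" "dist_to_set d x K2 - (s2 - s) \<ge> 0"
      using K1(4)[OF x] K2(4)[OF x] R[OF x] s by linarith+
    then have "dist_to_set d x (?N1 \<union> ?N2) =
        min (dist_to_set d x K1 - s1) (dist_to_set d x K2 - s2) + s"
      unfolding dist_to_set_Un[OF ne] dist_to_neighbourhood[OF K1(2) r(1)]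
        dist_to_neighbourhood[OF K2(2) r(2)] by linarith
    then show ?thesis using K1(4)[OF x] K2(4)[OF x] by linarith
  qed
  moreover have "closed (?N1 \<union> ?N2)" by (intro closed_Un closed_neighbourhood K1 K2)
  moreover have "N \<le> s" using K1(3) K2(3) unfolding s_def by simp
  ultimately show "\<exists>K s. closed K \<and> K \<noteq> {} \<and> N \<le> s \<and>
      (\<forall>x\<in>F. \<bar>dist_to_set d x K - s - min (h1 x) (h2 x)\<bar> < e)"
    using ne by (intro exI[of _ "?N1 \<union> ?N2"] exI[of _ s]) auto
qed

lemma dl_limits_Min:
  assumes "finite J" "J \<noteq> {}" "\<And>j. j \<in> J \<Longrightarrow> f j \<in> dl_limits"
  shows "(\<lambda>x. Min ((\<lambda>j. f j x) ` J)) \<in> dl_limits"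
  using assms
proof (induction J rule: finite_ne_induct)
  case (insert j J)
  then have "(\<lambda>x. min (f j x) (Min ((\<lambda>j. f j x) ` J))) \<in> dl_limits" by (intro dl_limits_min) auto
  then show ?case using insert by simp
qed simp

text \<open>
  On a finite set an infimum is nearly attained by finitely many members, hence by their minimum.
\<close>

lemma dl_limits_INF:
  assumes I: "I \<noteq> {}" "\<And>i. i \<in> I \<Longrightarrow> f i \<in> dl_limits" and bdd: "\<And>x. bdd_below ((\<lambda>i. f i x) ` I)"
  shows "(\<lambda>x. INF i\<in>I. f i x) \<in> dl_limits"
proof (rule dl_limits_approx)
  fix F :: "'a set" and e :: real assume F: "finite F" "0 < e"
  have "\<exists>i\<in>I. f i x < (INF i\<in>I. f i x) + e" for x
  proof -
    have "(INF i\<in>I. f i x) < (INF i\<in>I. f i x) + e" using F by simp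
    then show ?thesis using I(1) bdd[of x] by (subst (asm) cINF_less_iff) auto
  qed
  then obtain i where i: "\<And>x. i x \<in> I" "\<And>x. f (i x) x < (INF i\<in>I. f i x) + e" by metis
  obtain i0 where i0: "i0 \<in> I" using I(1) by blast
  let ?J = "insert i0 (i ` F)"
  have "(\<lambda>x. Min ((\<lambda>j. f j x) ` ?J)) \<in> dl_limits" by (rule dl_limits_Min) (use F i i0 I in auto)
  moreover have "\<bar>Min ((\<lambda>j. f j x) ` ?J) - (INF i\<in>I. f i x)\<bar> < e" if "x \<in> F" for x
  proof -
    have "Min ((\<lambda>j. f j x) ` ?J) \<le> f (i x) x" using F that by (intro Min_le) auto
    moreover have "(INF i\<in>I. f i x) \<le> Min ((\<lambda>j. f j x) ` ?J)"
      using F i i0 by (intro Min.boundedI) (auto intro!: cINF_lower[OF bdd])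
    ultimately show ?thesis using i(2)[of x] F(2) by linarith
  qed
  ultimately show "\<exists>g\<in>dl_limits. \<forall>x\<in>F. \<bar>g x - (INF i\<in>I. f i x)\<bar> < e"
    by (intro bexI[of _ "\<lambda>x. Min ((\<lambda>j. f j x) ` ?J)"] ballI)
qed

end

section \<open>The Peano space of normalized limit functions\<close>

lemma abs_diff_squares_ge:
  fixes m k :: nat
  assumes "k \<noteq> m"
  shows "real m \<le> \<bar>(real m)\<^sup>2 - (real k)\<^sup>2\<bar>"
proof -
  have "1 \<le> \<bar>real m - real k\<bar>" using assms by linarith
  then have "1 * (real m + real k) \<le> \<bar>real m - real k\<bar> * (real m + real k)"
    by (intro mult_right_mono) auto
  moreover have "\<bar>(real m)\<^sup>2 - (real k)\<^sup>2\<bar> = \<bar>real m - real k\<bar> * (real m + real k)"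
    by (simp add: square_diff_square_factored power2_eq_square abs_mult)
  ultimately show ?thesis by simp
qed

text \<open>
  Sets cut out by finitely many coordinates are a neighbourhood base of the pointwise topology.
\<close>

lemma open_fun_contains_basic:
  fixes U :: "('i \<Rightarrow> real) set"
  assumes "open U" "h \<in> U"
  obtains F e where "finite F" "0 < e" "\<And>g. (\<And>x. x \<in> F \<Longrightarrow> \<bar>g x - h x\<bar> < e) \<Longrightarrow> g \<in> U"
proof -
  have "openin (product_topology (\<lambda>_. euclideanreal) UNIV) U"
    using assms(1) by (simp add: euclidean_product_topology)
  from product_topology_open_contains_basis[OF this assms(2)]
  obtain X where X: "h \<in> PiE UNIV X" "\<And>i. open (X i)" "finite {i. X i \<noteq> UNIV}" "PiE UNIV X \<subseteq> U"
    by auto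
  define F where "F = {i. X i \<noteq> UNIV}"
  have "\<exists>e>0. \<forall>y. \<bar>y - h i\<bar> < e \<longrightarrow> y \<in> X i" for i
    using X(1,2) open_dist[of "X i"] by (auto simp: dist_real_def)
  then obtain e where e: "\<And>i. 0 < e i" "\<And>i y. \<bar>y - h i\<bar> < e i \<Longrightarrow> y \<in> X i" by metis
  define e0 where "e0 = Min (insert 1 (e ` F))"
  have F: "finite F" using X(3) by (simp add: F_def)
  have "0 < e0" unfolding e0_def using F e(1) by simp
  moreover have "g \<in> U" if g: "\<And>x. x \<in> F \<Longrightarrow> \<bar>g x - h x\<bar> < e0" for g
  proof -
    have "g i \<in> X i" for i
    proof (cases "i \<in> F")
      case True
      then have "e0 \<le> e i" unfolding e0_def using F by (intro Min_le) auto
      then show ?thesis using g[OF True] e(2)[of "g i" i] by linarith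
    qed (simp add: F_def)
    then show ?thesis using X(4) by auto
  qed
  ultimately show ?thesis using that F by blast
qed

lemma open_fun_basic:
  fixes h :: "'i \<Rightarrow> real"
  assumes "finite F"
  shows "open {g. \<forall>x\<in>F. \<bar>g x - h x\<bar> < e}"
proof -
  have "open {g :: 'i \<Rightarrow> real. \<bar>g x - h x\<bar> < e}" for x
    by (intro open_Collect_less continuous_intros continuous_on_product_coordinates)
  then have "open (\<Inter>x\<in>F. {g :: 'i \<Rightarrow> real. \<bar>g x - h x\<bar> < e})" using assms by (intro open_INT) auto
  moreover have "(\<Inter>x\<in>F. {g :: 'i \<Rightarrow> real. \<bar>g x - h x\<bar> < e}) = {g. \<forall>x\<in>F. \<bar>g x - h x\<bar> < e}" by auto
  ultimately show ?thesis by simp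
qed

lemma in_closure_fun:
  fixes h :: "'i \<Rightarrow> real"
  shows "h \<in> closure S \<longleftrightarrow> (\<forall>F e. finite F \<longrightarrow> 0 < e \<longrightarrow> (\<exists>g\<in>S. \<forall>x\<in>F. \<bar>g x - h x\<bar> < e))"
proof (intro iffI allI impI)
  fix F :: "'i set" and e :: real assume h: "h \<in> closure S" and F: "finite F" "0 < e"
  let ?U = "{g. \<forall>x\<in>F. \<bar>g x - h x\<bar> < e}"
  have "open ?U" "h \<in> ?U" using open_fun_basic[OF F(1)] F(2) by auto
  then have "?U \<inter> closure S \<noteq> {}" using h by blast
  then have "?U \<inter> S \<noteq> {}" using open_Int_closure_eq_empty[OF \<open>open ?U\<close>, of S] by blast
  then show "\<exists>g\<in>S. \<forall>x\<in>F. \<bar>g x - h x\<bar> < e" by blast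
next
  assume *: "\<forall>F e. finite F \<longrightarrow> 0 < e \<longrightarrow> (\<exists>g\<in>S. \<forall>x\<in>F. \<bar>g x - h x\<bar> < e)"
  show "h \<in> closure S"
  proof (rule ccontr)
    assume "h \<notin> closure S"
    then have "open (- closure S)" "h \<in> - closure S" by auto
    then obtain F e where F: "finite F" "0 < e" "\<And>g. (\<And>x. x \<in> F \<Longrightarrow> \<bar>g x - h x\<bar> < e) \<Longrightarrow> g \<in> - closure S"
      by (rule open_fun_contains_basic) blast
    obtain g where g: "g \<in> S" "\<forall>x\<in>F. \<bar>g x - h x\<bar> < e" using * F(1,2) by blast
    then have "g \<in> - closure S" using F(3) by blast
    then show False using g(1) closure_subset[of S] by blast
  qed
qed

locale proper_length_space = length_space +
  assumes proper: "compact (mcball p r)"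
    and noncompact: "\<not> compact (UNIV :: 'a set)"
begin

text \<open>
  The space is unbounded, and the distance from \<open>p\<close> has no gaps.
\<close>

lemma ex_dist_eq:
  assumes "0 \<le> s"
  shows "\<exists>x. d p x = s"
proof -
  have "mcball p s \<noteq> UNIV" using proper[of p s] noncompact by metis
  then obtain x where "x \<notin> mcball p s" by blast
  then have "s \<le> d p x" by simp
  from between[OF assms this, of 1] show ?thesis by auto
qed

definition dl_normalized :: "'a \<Rightarrow> ('a \<Rightarrow> real) set" where
  "dl_normalized p = {h \<in> dl_limits. h p = 0}"

lemma dl_normalized_D: "h \<in> dl_normalized p \<Longrightarrow> h \<in> dl_limits" "h \<in> dl_normalized p \<Longrightarrow> h p = 0"
  by (simp_all add: dl_normalized_def)

lemma dl_limits_normalize: "h \<in> dl_limits \<Longrightarrow> (\<lambda>x. h x - h p) \<in> dl_normalized p"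
  using dl_limits_shift[of h "- h p"] by (simp add: dl_normalized_def)

lemma dl_normalized_bound: "h \<in> dl_normalized p \<Longrightarrow> \<bar>h x\<bar> \<le> d x p"
  using dl_limits_lipschitz[of h x p] by (simp add: dl_normalized_def)

lemma closed_dl_limits: "closed dl_limits"
proof -
  have "closure dl_limits \<subseteq> dl_limits"
  proof
    fix h assume "h \<in> closure dl_limits"
    then show "h \<in> dl_limits" unfolding in_closure_fun by (intro dl_limits_approx) blast
  qed
  then show ?thesis by (simp add: closure_subset_eq)
qed

lemma closed_dl_normalized: "closed (dl_normalized p)"
proof -
  have "closed {h :: 'a \<Rightarrow> real. h p = 0}"
    by (intro closed_Collect_eq continuous_on_product_coordinates continuous_on_const)
  moreover have "dl_normalized p = dl_limits \<inter> {h. h p = 0}" by (auto simp: dl_normalized_def)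
  ultimately show ?thesis using closed_dl_limits by (metis closed_Int)
qed

lemma compact_box: "compact {h. \<forall>x. \<bar>h x\<bar> \<le> d x p}"
proof -
  have "compactin (product_topology (\<lambda>_. euclideanreal) UNIV) (PiE UNIV (\<lambda>x. {- d x p..d x p}))"
    by (auto simp: compactin_PiE)
  moreover have "PiE UNIV (\<lambda>x. {- d x p..d x p}) = {h. \<forall>x. \<bar>h x\<bar> \<le> d x p}"
    by (auto simp: abs_le_iff minus_le_iff)
  ultimately show ?thesis by (simp add: euclidean_product_topology)
qed

lemma compact_dl_normalized: "compact (dl_normalized p)"
proof -
  have "dl_normalized p = {h. \<forall>x. \<bar>h x\<bar> \<le> d x p} \<inter> dl_normalized p" using dl_normalized_bound by auto
  then show ?thesis using compact_Int_closed[OF compact_box closed_dl_normalized] by metis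
qed

text \<open>
  A cluster point of the functions \<open>d(\<cdot>,z\<^sub>n) - d(p,z\<^sub>n)\<close> for points \<open>z\<^sub>n\<close> tending to infinity.
\<close>

lemma dl_normalized_nonempty: "dl_normalized p \<noteq> {}"
proof -
  obtain z where z: "\<And>n. d p (z n) = real n" using choice[of "\<lambda>n x. d p x = real n"] ex_dist_eq by auto
  define k where "k n = (\<lambda>x. d x (z n) - real n)" for n
  let ?B = "{h. \<forall>x. \<bar>h x\<bar> \<le> d x p}"
  have kB: "k n \<in> ?B" for n
  proof -
    have "\<bar>d x (z n) - real n\<bar> \<le> d x p" for x
      using triangle[of p x "z n"] triangle[of x p "z n"] commute[of p x] z[of n] by simp
    then show ?thesis by (simp add: k_def)
  qed
  have "?B \<inter> (\<Inter>n\<in>UNIV. closure (k ` {n..})) \<noteq> {}"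
  proof (rule compact_imp_fip_image[OF compact_box])
    fix I :: "nat set" assume "finite I"
    then have "k (Max (insert 0 I)) \<in> closure (k ` {n..})" if "n \<in> I" for n
      using that by (intro subsetD[OF closure_subset]) auto
    then show "?B \<inter> (\<Inter>n\<in>I. closure (k ` {n..})) \<noteq> {}" using kB by blast
  qed simp
  then obtain h where h: "\<And>n. h \<in> closure (k ` {n..})" by blast
  have "h \<in> dl_limits"
  proof (rule dl_limits_I)
    fix F :: "'a set" and e N :: real assume F: "finite F" "0 < e"
    obtain n where n: "N \<le> real n" using real_arch_simple by blast
    obtain g where g: "g \<in> k ` {n..}" "\<forall>x\<in>F. \<bar>g x - h x\<bar> < e" using h[of n] F unfolding in_closure_fun by blast
    then obtain m where m: "m \<ge> n" "g = k m" by auto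
    have "dist_to_set d x {z m} = d x (z m)" for x by (simp add: dist_to_set_def)
    then show "\<exists>K s. closed K \<and> K \<noteq> {} \<and> N \<le> s \<and> (\<forall>x\<in>F. \<bar>dist_to_set d x K - s - h x\<bar> < e)"
      using g(2) m n by (intro exI[of _ "{z m}"] exI[of _ "real m"]) (auto simp: k_def)
  qed
  from dl_limits_normalize[OF this, of p] show ?thesis by blast
qed

text \<open>
  A nonexpanding function is determined by its values on a countable dense set, so restricting
  to that set embeds the compact set \<open>dl_normalized p\<close> into the metric space of real sequences.
\<close>

lemma dl_normalized_embedding:
  obtains \<rho> :: "('a \<Rightarrow> real) \<Rightarrow> nat \<Rightarrow> real" and \<sigma> where "homeomorphism (dl_normalized p) (\<rho> ` dl_normalized p) \<rho> \<sigma>"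
proof -
  obtain D :: "'a set" where D: "countable D" "\<And>X. open X \<Longrightarrow> X \<noteq> {} \<Longrightarrow> \<exists>x\<in>D. x \<in> X"
    using countable_dense_setE by blast
  have "D \<noteq> {}" using D(2)[of UNIV] by auto
  define \<rho> where "\<rho> h n = h (from_nat_into D n)" for h :: "'a \<Rightarrow> real" and n
  have "continuous_on (dl_normalized p) \<rho>"
    unfolding \<rho>_def
    by (intro continuous_on_coordinatewise_then_product)
       (rule continuous_on_subset[OF continuous_on_product_coordinates], simp)
  moreover have "inj_on \<rho> (dl_normalized p)"
  proof (rule inj_onI, rule ext)
    fix h h' x assume h: "h \<in> dl_normalized p" "h' \<in> dl_normalized p" and eq: "\<rho> h = \<rho> h'"
    have eqD: "h y = h' y" if "y \<in> D" for y
      using fun_cong[OF eq, of "to_nat_on D y"] D(1) that by (simp add: \<rho>_def)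
    show "h x = h' x"
    proof (rule ccontr)
      assume "h x \<noteq> h' x"
      define e where "e = \<bar>h x - h' x\<bar> / 2"
      have "0 < e" using \<open>h x \<noteq> h' x\<close> by (simp add: e_def)
      then obtain y where y: "y \<in> D" "d x y < e"
        using D(2)[OF open_mball, of x e] by auto
      have "\<bar>h x - h' x\<bar> < 2 * e"
        using dl_limits_lipschitz[OF dl_normalized_D(1)[OF h(1)], of x y] dl_limits_lipschitz[OF dl_normalized_D(1)[OF h(2)], of x y]
          eqD[OF y(1)] y(2) by linarith
      then show False by (simp add: e_def)
    qed
  qed
  ultimately show ?thesis using homeomorphism_compact[OF compact_dl_normalized] that by blast
qed

lemma metrizable_dl_normalized: "metrizable_space (top_of_set (dl_normalized p))"
proof -
  obtain \<rho> :: "('a \<Rightarrow> real) \<Rightarrow> nat \<Rightarrow> real" and \<sigma> where "homeomorphism (dl_normalized p) (\<rho> ` dl_normalized p) \<rho> \<sigma>"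
    by (rule dl_normalized_embedding)
  then have "homeomorphic_maps (top_of_set (dl_normalized p)) (top_of_set (\<rho> ` dl_normalized p)) \<rho> \<sigma>"
    unfolding homeomorphism_def homeomorphic_maps_def by auto
  then have "top_of_set (dl_normalized p) homeomorphic_space top_of_set (\<rho> ` dl_normalized p)"
    unfolding homeomorphic_space_def by blast
  then show ?thesis
    using homeomorphic_metrizable_space metrizable_space_subtopology[OF metrizable_space_euclidean] by blast
qed

text \<open>
  A dense sequence that repeats each of its members infinitely often.
\<close>

lemma dl_normalized_dense_sequence:
  obtains q :: "nat \<Rightarrow> 'a \<Rightarrow> real" where "\<And>n. q n \<in> dl_normalized p"
    "\<And>U n. open U \<Longrightarrow> U \<inter> dl_normalized p \<noteq> {} \<Longrightarrow> \<exists>m\<ge>n. q m \<in> U"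
proof -
  obtain \<rho> :: "('a \<Rightarrow> real) \<Rightarrow> nat \<Rightarrow> real" and \<sigma> where hom: "homeomorphism (dl_normalized p) (\<rho> ` dl_normalized p) \<rho> \<sigma>"
    by (rule dl_normalized_embedding)
  obtain T where T: "countable T" "T \<subseteq> \<rho> ` dl_normalized p" "\<rho> ` dl_normalized p \<subseteq> closure T"
    by (rule separable)
  have cl: "closed (\<rho> ` dl_normalized p)"
    using hom compact_dl_normalized by (metis compact_continuous_image compact_imp_closed homeomorphism_def)
  then have "closure T \<subseteq> \<rho> ` dl_normalized p" using T(2) by (simp add: closure_minimal)
  then have "continuous_on (closure T) \<sigma>" using hom unfolding homeomorphism_def by (metis continuous_on_subset)
  then have "\<sigma> ` closure T \<subseteq> closure (\<sigma> ` T)" by (rule image_closure_subset) (auto simp: closure_subset)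
  then have dense: "dl_normalized p \<subseteq> closure (\<sigma> ` T)" using hom T(3) unfolding homeomorphism_def by blast
  have "\<sigma> ` (\<rho> ` dl_normalized p) = dl_normalized p" using hom unfolding homeomorphism_def by blast
  then have sub: "\<sigma> ` T \<subseteq> dl_normalized p" using image_mono[OF T(2), of \<sigma>] by simp
  have ne: "\<sigma> ` T \<noteq> {}" using dense dl_normalized_nonempty[of p] by auto
  define q where "q m = from_nat_into (\<sigma> ` T) (fst (prod_decode m))" for m
  have "q n \<in> dl_normalized p" for n unfolding q_def using from_nat_into[OF ne] sub by blast
  moreover have "\<exists>m\<ge>n. q m \<in> U" if U: "open U" "U \<inter> dl_normalized p \<noteq> {}" for U n
  proof -
    have "U \<inter> \<sigma> ` T \<noteq> {}" using U dense open_Int_closure_eq_empty[OF U(1), of "\<sigma> ` T"] by blast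
    then obtain k where k: "k \<in> U" "k \<in> \<sigma> ` T" by blast
    \<comment> \<open>the second component of the code makes the index as large as desired\<close>
    let ?m = "prod_encode (to_nat_on (\<sigma> ` T) k, n)"
    have "q ?m = k" using k(2) T(1) by (simp add: q_def)
    then show ?thesis using k(1) le_prod_encode_2[of n] by (intro exI[of _ ?m]) auto
  qed
  ultimately show ?thesis by (rule that)
qed

text \<open>
  The curve is \<open>G t = (INF m. q m + \<bar>t - m\<^sup>2\<bar>)\<close>, normalized at \<open>p\<close>, for a sequence \<open>q\<close> with dense tails.
  Each \<open>G t x\<close> is an infimum of 1-Lipschitz functions of \<open>t\<close>, which gives continuity. At
  \<open>t = m\<^sup>2\<close> all other terms are penalized by at least \<open>m\<close>, which is at least any difference of
  values at \<open>x\<close> once \<open>m \<ge> 2 * d x p\<close>; so \<open>G (m\<^sup>2)\<close> agrees with \<open>q m\<close> on larger and larger balls.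
\<close>

lemma dl_normalized_dense_curve:
  obtains \<gamma> :: "real \<Rightarrow> 'a \<Rightarrow> real" where
    "continuous_on UNIV \<gamma>" "\<And>t. \<gamma> t \<in> dl_normalized p"
    "\<And>U T. open U \<Longrightarrow> U \<inter> dl_normalized p \<noteq> {} \<Longrightarrow> \<exists>t\<ge>T. \<gamma> t \<in> U"
proof -
  obtain q :: "nat \<Rightarrow> 'a \<Rightarrow> real" where q: "\<And>n. q n \<in> dl_normalized p"
    "\<And>U n. open U \<Longrightarrow> U \<inter> dl_normalized p \<noteq> {} \<Longrightarrow> \<exists>m\<ge>n. q m \<in> U"
    by (rule dl_normalized_dense_sequence) blast
  define G where "G t x = (INF m. q m x + \<bar>t - (real m)\<^sup>2\<bar>)" for t x
  have lb: "- d x p \<le> q m x + \<bar>t - (real m)\<^sup>2\<bar>" for t x m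
    using dl_normalized_bound[OF q(1), of m x] by linarith
  have bdd: "bdd_below (range (\<lambda>m. q m x + \<bar>t - (real m)\<^sup>2\<bar>))" for t x
    using lb by (intro bdd_belowI2)
  have GDL: "G t \<in> dl_limits" for t
    unfolding G_def by (rule dl_limits_INF) (use bdd dl_limits_shift[OF dl_normalized_D(1)[OF q(1)]] in auto)
  have Glip: "G t x \<le> G u x + \<bar>t - u\<bar>" for t u x
  proof -
    have "G t x - \<bar>t - u\<bar> \<le> G u x"
      unfolding G_def[of u]
    proof (rule cINF_greatest)
      fix m
      have "G t x \<le> q m x + \<bar>t - (real m)\<^sup>2\<bar>" unfolding G_def by (rule cINF_lower[OF bdd]) simp
      then show "G t x - \<bar>t - u\<bar> \<le> q m x + \<bar>u - (real m)\<^sup>2\<bar>" by linarith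
    qed simp
    then show ?thesis by simp
  qed
  \<comment> \<open>the other terms exceed the \<open>m\<close>-th one by \<open>m - 2 * d x p\<close> at least\<close>
  have Gsq: "G ((real m)\<^sup>2) x = q m x" if m: "2 * d x p \<le> real m" for m x
  proof (rule antisym)
    have "G ((real m)\<^sup>2) x \<le> q m x + \<bar>(real m)\<^sup>2 - (real m)\<^sup>2\<bar>"
      unfolding G_def by (rule cINF_lower[OF bdd]) simp
    then show "G ((real m)\<^sup>2) x \<le> q m x" by simp
    show "q m x \<le> G ((real m)\<^sup>2) x"
      unfolding G_def
    proof (rule cINF_greatest)
      fix k
      show "q m x \<le> q k x + \<bar>(real m)\<^sup>2 - (real k)\<^sup>2\<bar>"
        using abs_diff_squares_ge[of k m] dl_normalized_bound[OF q(1), of m x] dl_normalized_bound[OF q(1), of k x] m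
        by (cases "k = m") auto
    qed simp
  qed
  define \<gamma> where "\<gamma> t = (\<lambda>x. G t x - G t p)" for t
  have "continuous_on UNIV (\<lambda>t. G t x)" for x
    unfolding continuous_on_iff dist_real_def
  proof (intro ballI allI impI)
    fix t e :: real assume "0 < e"
    moreover have "\<bar>G u x - G t x\<bar> \<le> \<bar>u - t\<bar>" for u
      using Glip[of u x t] Glip[of t x u] by linarith
    ultimately show "\<exists>\<delta>>0. \<forall>u\<in>UNIV. \<bar>u - t\<bar> < \<delta> \<longrightarrow> \<bar>G u x - G t x\<bar> < e"
      by (intro exI[of _ e] conjI ballI impI) (auto intro: le_less_trans)
  qed
  then have "continuous_on UNIV \<gamma>"
    unfolding \<gamma>_def by (intro continuous_on_coordinatewise_then_product continuous_intros)
  moreover have "\<gamma> t \<in> dl_normalized p" for t unfolding \<gamma>_def by (rule dl_limits_normalize[OF GDL])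
  moreover have "\<exists>t\<ge>T. \<gamma> t \<in> U" if U: "open U" "U \<inter> dl_normalized p \<noteq> {}" for U T
  proof -
    obtain h where h: "h \<in> U" "h \<in> dl_normalized p" using U(2) by blast
    obtain F e where F: "finite F" "0 < e" "\<And>g. (\<And>x. x \<in> F \<Longrightarrow> \<bar>g x - h x\<bar> < e) \<Longrightarrow> g \<in> U"
      using open_fun_contains_basic[OF U(1) h(1)] by metis
    define R where "R = Max (insert \<bar>T\<bar> ((\<lambda>x. 2 * d x p) ` F))"
    obtain n where n: "R + 1 \<le> real n" using real_arch_simple by blast
    have "h \<in> {g. \<forall>x\<in>F. \<bar>g x - h x\<bar> < e} \<inter> dl_normalized p" using h(2) F(2) by simp
    then have "{g. \<forall>x\<in>F. \<bar>g x - h x\<bar> < e} \<inter> dl_normalized p \<noteq> {}" by blast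
    from q(2)[OF open_fun_basic[OF F(1)] this, of n]
    obtain m where m: "m \<ge> n" "\<And>x. x \<in> F \<Longrightarrow> \<bar>q m x - h x\<bar> < e" by auto
    have R: "\<bar>T\<bar> \<le> R" "\<And>x. x \<in> F \<Longrightarrow> 2 * d x p \<le> R"
      unfolding R_def using F(1) by (auto intro: Max_ge)
    have mR: "R + 1 \<le> real m" using n m(1) by linarith
    have "real m * 1 \<le> real m * real m" using mR R(1) by (intro mult_left_mono) linarith+
    then have "T \<le> (real m)\<^sup>2" using mR R(1) by (simp add: power2_eq_square)
    moreover have "\<gamma> ((real m)\<^sup>2) \<in> U"
    proof (rule F(3))
      fix x assume x: "x \<in> F"
      have "G ((real m)\<^sup>2) p = q m p" by (rule Gsq) (use mR R(1) in \<open>simp add: mdist_zero\<close>)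
      then have "G ((real m)\<^sup>2) p = 0" using dl_normalized_D(2)[OF q(1)] by simp
      moreover have "G ((real m)\<^sup>2) x = q m x" by (rule Gsq) (use mR R(2)[OF x] in linarith)
      ultimately show "\<bar>\<gamma> ((real m)\<^sup>2) x - h x\<bar> < e" using m(2)[OF x] by (simp add: \<gamma>_def)
    qed
    ultimately show ?thesis by blast
  qed
  ultimately show ?thesis by (rule that)
qed

lemma connected_dl_normalized: "connected (dl_normalized p)"
proof -
  obtain \<gamma> :: "real \<Rightarrow> 'a \<Rightarrow> real" where \<gamma>: "continuous_on UNIV \<gamma>" "\<And>t. \<gamma> t \<in> dl_normalized p"
    "\<And>U T. open U \<Longrightarrow> U \<inter> dl_normalized p \<noteq> {} \<Longrightarrow> \<exists>t\<ge>T. \<gamma> t \<in> U"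
    by (rule dl_normalized_dense_curve) blast
  show ?thesis
  proof (rule connected_intermediate_closure)
    show "connected (range \<gamma>)" using \<gamma>(1) connected_continuous_image[of UNIV \<gamma>] connected_UNIV by blast
    show "range \<gamma> \<subseteq> dl_normalized p" using \<gamma>(2) by blast
    show "dl_normalized p \<subseteq> closure (range \<gamma>)"
    proof (rule ccontr)
      assume "\<not> dl_normalized p \<subseteq> closure (range \<gamma>)"
      then have "- closure (range \<gamma>) \<inter> dl_normalized p \<noteq> {}" by blast
      from \<gamma>(3)[OF _ this] obtain t where "\<gamma> t \<in> - closure (range \<gamma>)" by auto
      then show False using closure_subset[of "range \<gamma>"] by blast
    qed
  qed
qed

text \<open>
  A member \<open>f\<close> of the set is joined to \<open>h\<close> by the functions \<open>min (f + r) (h + t)\<close>, normalized at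
  \<open>p\<close>. For \<open>\<bar>t\<bar> < e\<close> they are near \<open>h\<close> on \<open>F\<close>; for larger \<open>t\<close> they equal \<open>f + r\<close> there, and for
  smaller \<open>t\<close> they equal \<open>h + t\<close>. The end points \<open>f\<close> and \<open>h\<close> are limits for \<open>t \<rightarrow> \<plusminus>\<infinity>\<close>, and adding
  limit points keeps a set connected. Allowing the constant \<open>r\<close> in the definition of the set is
  what keeps the whole path inside it.
\<close>

lemma connected_dl_normalized_neighbourhood:
  assumes h: "h \<in> dl_normalized p" and F: "finite F" "p \<in> F" and e: "0 < e"
  shows "connected {f \<in> dl_normalized p. \<exists>r. \<forall>x\<in>F. \<bar>f x + r - h x\<bar> < e}" (is "connected ?V")
proof -
  have hV: "h \<in> ?V" using h e by (auto intro: exI[of _ 0])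
  have "\<exists>C. connected C \<and> C \<subseteq> ?V \<and> f \<in> C \<and> h \<in> C" if f: "f \<in> ?V" for f
  proof -
    obtain r where r: "\<And>x. x \<in> F \<Longrightarrow> \<bar>f x + r - h x\<bar> < e" and fD: "f \<in> dl_normalized p" using f by blast
    have r0: "\<bar>r\<bar> < e" using r[OF F(2)] dl_normalized_D(2)[OF fD] dl_normalized_D(2)[OF h] by simp
    \<comment> \<open>the subtracted term is the value at \<open>p\<close>, where \<open>f\<close> and \<open>h\<close> vanish\<close>
    define P where "P t = (\<lambda>x. min (f x + r) (h x + t) - min r t)" for t
    have PD: "P t \<in> dl_normalized p" for t
    proof -
      have "(\<lambda>x. min (f x + r) (h x + t)) \<in> dl_limits"
        by (intro dl_limits_min dl_limits_shift dl_normalized_D(1)[OF fD] dl_normalized_D(1)[OF h])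
      from dl_limits_normalize[OF this, of p] show ?thesis
        using dl_normalized_D(2)[OF fD] dl_normalized_D(2)[OF h] by (simp add: P_def)
    qed
    have PV: "P t \<in> ?V" for t
    proof -
      have "\<exists>s. \<forall>x\<in>F. \<bar>P t x + s - h x\<bar> < e"
      proof (cases "\<bar>t\<bar> < e")
        case True
        then have "\<bar>P t x + min r t - h x\<bar> < e" if "x \<in> F" for x
          using r[OF that] unfolding P_def by linarith
        then show ?thesis by blast
      next
        case False
        then consider "e \<le> t" | "t \<le> - e" by linarith
        then show ?thesis
        proof cases
          case 1
          have "\<bar>P t x + r - h x\<bar> < e" if "x \<in> F" for x
            using r[OF that] 1 r0 unfolding P_def by linarith
          then show ?thesis by blast
        next
          case 2
          have "\<bar>P t x + 0 - h x\<bar> < e" if "x \<in> F" for x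
            using r[OF that] 2 r0 e unfolding P_def by linarith
          then show ?thesis by blast
        qed
      qed
      then show ?thesis using PD by blast
    qed
    have "continuous_on UNIV P"
      unfolding P_def by (intro continuous_on_coordinatewise_then_product continuous_intros)
    then have conn: "connected (range P)" using connected_continuous_image[of UNIV P] connected_UNIV by blast
    have "f \<in> closure (range P)"
      unfolding in_closure_fun
    proof (intro allI impI)
      fix F' :: "'a set" and e' :: real assume F': "finite F'" "0 < e'"
      define t where "t = Max (insert r ((\<lambda>x. f x + r - h x) ` F'))"
      have "r \<le> t" "\<And>x. x \<in> F' \<Longrightarrow> f x + r - h x \<le> t" unfolding t_def using F'(1) by (auto intro: Max_ge)
      then have "P t x = f x" if "x \<in> F'" for x using that unfolding P_def by fastforce
      then show "\<exists>g\<in>range P. \<forall>x\<in>F'. \<bar>g x - f x\<bar> < e'" using F'(2) by (intro bexI[of _ "P t"]) auto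
    qed
    moreover have "h \<in> closure (range P)"
      unfolding in_closure_fun
    proof (intro allI impI)
      fix F' :: "'a set" and e' :: real assume F': "finite F'" "0 < e'"
      define t where "t = Min (insert r ((\<lambda>x. f x + r - h x) ` F'))"
      have "t \<le> r" "\<And>x. x \<in> F' \<Longrightarrow> t \<le> f x + r - h x" unfolding t_def using F'(1) by (auto intro: Min_le)
      then have "P t x = h x" if "x \<in> F'" for x using that unfolding P_def by fastforce
      then show "\<exists>g\<in>range P. \<forall>x\<in>F'. \<bar>g x - h x\<bar> < e'" using F'(2) by (intro bexI[of _ "P t"]) auto
    qed
    ultimately have "connected (insert f (insert h (range P)))"
      using closure_subset[of "range P"] by (intro connected_intermediate_closure[OF conn]) auto
    then show ?thesis
      using PV f hV by (intro exI[of _ "insert f (insert h (range P))"]) auto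
  qed
  then have comp: "connected_component ?V f h" if "f \<in> ?V" for f
    using that unfolding connected_component_def by blast
  show ?thesis
    unfolding connected_iff_connected_component
    using comp by (meson connected_component_sym connected_component_trans)
qed

lemma locally_connected_dl_normalized: "locally_connected_space (top_of_set (dl_normalized p))"
  unfolding locally_connected_space
proof (intro allI impI)
  fix V h assume "openin (top_of_set (dl_normalized p)) V \<and> h \<in> V"
  then obtain W where W: "open W" "V = dl_normalized p \<inter> W" "h \<in> V" unfolding openin_open by blast
  then have h: "h \<in> dl_normalized p" "h \<in> W" by auto
  obtain F e where F: "finite F" "0 < e" "\<And>g. (\<And>x. x \<in> F \<Longrightarrow> \<bar>g x - h x\<bar> < e) \<Longrightarrow> g \<in> W"
    using open_fun_contains_basic[OF W(1) h(2)] by metis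
  let ?U = "{f \<in> dl_normalized p. \<exists>r. \<forall>x\<in>insert p F. \<bar>f x + r - h x\<bar> < e / 2}"
  have e2: "0 < e / 2" using F(2) by simp
  have "open (\<Union>r. {f. \<forall>x\<in>insert p F. \<bar>f x - (h x - r)\<bar> < e / 2})"
    using F(1) by (intro open_UN ballI open_fun_basic) simp
  moreover have "?U = dl_normalized p \<inter> (\<Union>r. {f. \<forall>x\<in>insert p F. \<bar>f x - (h x - r)\<bar> < e / 2})"
    by (auto simp: algebra_simps)
  ultimately have "openin (top_of_set (dl_normalized p)) ?U" by (auto simp: openin_open)
  moreover have "connected ?U" by (rule connected_dl_normalized_neighbourhood[OF h(1) _ _ e2]) (use F(1) in auto)
  then have "connectedin (top_of_set (dl_normalized p)) ?U" by (auto simp: connectedin_subtopology)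
  moreover have "h \<in> ?U" using h(1) e2 by (auto intro: exI[of _ 0])
  moreover have "?U \<subseteq> V"
  proof
    fix f assume "f \<in> ?U"
    then obtain r where f: "f \<in> dl_normalized p" and r: "\<And>x. x \<in> insert p F \<Longrightarrow> \<bar>f x + r - h x\<bar> < e / 2" by blast
    have "\<bar>r\<bar> < e / 2" using r[of p] dl_normalized_D(2)[OF f] dl_normalized_D(2)[OF h(1)] by simp
    then have "\<bar>f x - h x\<bar> < e" if "x \<in> F" for x using r[OF insertI2[OF that]] by linarith
    then have "f \<in> W" by (rule F(3))
    then show "f \<in> V" using f W(2) by blast
  qed
  ultimately show "\<exists>U. openin (top_of_set (dl_normalized p)) U \<and> connectedin (top_of_set (dl_normalized p)) U \<and> h \<in> U \<and> U \<subseteq> V"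
    by (intro exI[of _ ?U]) blast
qed

lemma peano_dl_normalized: "peano_space (top_of_set (dl_normalized p))"
  unfolding peano_space_def
  using compact_dl_normalized connected_dl_normalized locally_connected_dl_normalized metrizable_dl_normalized
  by (simp add: compact_space_subtopology connected_space_subtopology)

end

section \<open>Functions at infinity and the quotient modulo constants\<close>

lemma topspace_compact_open: "topspace compact_open_topology = {f. continuous_on UNIV f}"
proof -
  have "f \<in> \<Union> {{f. continuous_on UNIV f \<and> f ` K \<subseteq> U} |K U. compact K \<and> open U}"
    if "continuous_on UNIV f" for f :: "'a::topological_space \<Rightarrow> 'b::topological_space"
  proof
    show "f \<in> {f. continuous_on UNIV f \<and> f ` {} \<subseteq> UNIV}" using that by simp
    show "{f :: 'a \<Rightarrow> 'b. continuous_on UNIV f \<and> f ` {} \<subseteq> UNIV} \<in>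
        {{f. continuous_on UNIV f \<and> f ` K \<subseteq> U} |K U. compact K \<and> open U}" by blast
  qed
  then show ?thesis unfolding compact_open_topology_def topology_generated_by_topspace by blast
qed

lemma continuous_map_compact_open_eval:
  "continuous_map (compact_open_topology :: ('a::topological_space \<Rightarrow> 'b::topological_space) topology) euclidean (\<lambda>f. f x)"
  unfolding continuous_map_def
proof (intro conjI allI impI)
  fix U :: "'b set" assume "openin euclidean U"
  then have "openin compact_open_topology {f :: 'a \<Rightarrow> 'b. continuous_on UNIV f \<and> f ` {x} \<subseteq> U}"
    unfolding compact_open_topology_def
    by (intro topology_generated_by_Basis CollectI exI[of _ "{x}"] exI[of _ U]) auto
  then show "openin compact_open_topology {f \<in> topspace compact_open_topology. f x \<in> U}"
    by (simp add: topspace_compact_open)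
qed simp

context proper_length_space
begin

definition nonexpanding :: "('a \<Rightarrow> real) set" where
  "nonexpanding = {f. \<forall>x y. \<bar>f x - f y\<bar> \<le> d x y}"

lemma nonexpanding_continuous:
  assumes "f \<in> nonexpanding"
  shows "continuous_on UNIV f"
  unfolding continuous_on_eq_continuous_at[OF open_UNIV] isCont_def
proof (intro ballI tendstoI)
  fix x and e :: real assume "0 < e"
  have "dist (f y) (f x) < e" if "y \<in> mball x e" for y
  proof -
    have "\<bar>f y - f x\<bar> \<le> d y x" using assms unfolding nonexpanding_def by blast
    then show ?thesis using that by (simp add: dist_real_def commute)
  qed
  moreover have "x \<in> mball x e" using \<open>0 < e\<close> by simp
  ultimately show "\<forall>\<^sub>F y in at x. dist (f y) (f x) < e"
    unfolding eventually_at_topological using open_mball by blast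
qed

lemma dl_limits_subset_nonexpanding: "dl_limits \<subseteq> nonexpanding"
  using dl_limits_lipschitz by (auto simp: nonexpanding_def)

text \<open>
  By equicontinuity, closeness at finitely many points of a compact set is closeness on all of it.
\<close>

lemma compact_open_nonexpanding: "subtopology compact_open_topology nonexpanding = top_of_set nonexpanding"
proof -
  have ts: "topspace (subtopology compact_open_topology nonexpanding) = topspace (top_of_set nonexpanding)"
    using nonexpanding_continuous by (auto simp: topspace_compact_open)
  have "continuous_map (subtopology compact_open_topology nonexpanding) (top_of_set nonexpanding) id"
  proof -
    have "continuous_map (subtopology compact_open_topology nonexpanding) (product_topology (\<lambda>_. euclidean) UNIV) id"
      unfolding continuous_map_componentwise_UNIV id_apply
      by (intro allI continuous_map_from_subtopology continuous_map_compact_open_eval)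
    then show ?thesis
      by (simp add: continuous_map_in_subtopology euclidean_product_topology)
  qed
  moreover have "continuous_map (top_of_set nonexpanding) (subtopology compact_open_topology nonexpanding) id"
  proof -
    have "continuous_map (top_of_set nonexpanding) compact_open_topology id"
      unfolding compact_open_topology_def
    proof (rule continuous_on_generated_topo)
      show "id ` topspace (top_of_set nonexpanding) \<subseteq> \<Union> {{f. continuous_on UNIV f \<and> f ` K \<subseteq> U} |K U. compact K \<and> open U}"
        using ts topspace_compact_open unfolding compact_open_topology_def by auto
      fix B :: "('a \<Rightarrow> real) set" assume "B \<in> {{f. continuous_on UNIV f \<and> f ` K \<subseteq> U} |K U. compact K \<and> open U}"
      then obtain K U where B: "B = {f. continuous_on UNIV f \<and> f ` K \<subseteq> U}" "compact K" "open U" by blast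
      show "openin (top_of_set nonexpanding) (id -` B \<inter> topspace (top_of_set nonexpanding))"
      proof (subst openin_subopen, intro ballI)
        fix f assume "f \<in> id -` B \<inter> topspace (top_of_set nonexpanding)"
        then have f: "f \<in> B" "f \<in> nonexpanding" by auto
        have "compact (f ` K)"
          using continuous_on_subset[OF nonexpanding_continuous[OF f(2)] subset_UNIV] B(2)
          by (rule compact_continuous_image)
        moreover have "f ` K \<subseteq> U" using f(1) unfolding B(1) by simp
        ultimately obtain e where e: "0 < e" "(\<Union>y\<in>f ` K. ball y e) \<subseteq> U"
          by (rule compact_subset_open_imp_ball_epsilon_subset[OF _ B(3)])
        have "K \<subseteq> (\<Union>x\<in>K. mball x (e / 3))" using e(1) by auto
        then obtain F where F: "F \<subseteq> K" "finite F" "K \<subseteq> (\<Union>x\<in>F. mball x (e / 3))"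
          by (rule compactE_image[OF B(2) open_mball])
        let ?T = "nonexpanding \<inter> {h. \<forall>x\<in>F. \<bar>h x - f x\<bar> < e / 3}"
        have "openin (top_of_set nonexpanding) ?T" by (rule openin_open_Int[OF open_fun_basic[OF F(2)]])
        moreover have "f \<in> ?T" using f(2) e(1) by simp
        moreover have "?T \<subseteq> id -` B \<inter> topspace (top_of_set nonexpanding)"
        proof
          fix h assume h: "h \<in> ?T"
          have "h y \<in> U" if y: "y \<in> K" for y
          proof -
            obtain x where x: "x \<in> F" "d x y < e / 3" using F(3) y by auto
            have "\<bar>h x - h y\<bar> \<le> d x y" "\<bar>f x - f y\<bar> \<le> d x y" using h f(2) unfolding nonexpanding_def by auto
            moreover have "\<bar>h x - f x\<bar> < e / 3" using h x(1) by blast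
            ultimately have "\<bar>f y - h y\<bar> < e" using x(2) by linarith
            then have "h y \<in> ball (f y) e" by (simp add: dist_real_def)
            then show ?thesis using e(2) y by blast
          qed
          then show "h \<in> id -` B \<inter> topspace (top_of_set nonexpanding)"
            using h nonexpanding_continuous unfolding B(1) by auto
        qed
        ultimately show "\<exists>T. openin (top_of_set nonexpanding) T \<and> f \<in> T \<and> T \<subseteq> id -` B \<inter> topspace (top_of_set nonexpanding)"
          by blast
      qed
    qed
    then show ?thesis by (simp add: continuous_map_in_subtopology)
  qed
  ultimately show ?thesis
    using topology_finer_continuous_id[OF ts] topology_finer_continuous_id[OF ts[symmetric]]
    by (metis topology_eq)
qed

lemma compact_open_subset_nonexpanding:
  "S \<subseteq> nonexpanding \<Longrightarrow> subtopology compact_open_topology S = top_of_set S"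
  by (metis compact_open_nonexpanding inf.absorb_iff2 subtopology_subtopology)

lemma shifted_dist_in_nonexpanding:
  assumes "K \<noteq> {}"
  shows "(\<lambda>x. dist_to_set d x K - c) \<in> nonexpanding"
  unfolding nonexpanding_def
proof (intro CollectI allI)
  fix x y
  show "\<bar>dist_to_set d x K - c - (dist_to_set d y K - c)\<bar> \<le> d x y"
    using dist_to_set_lipschitz[OF assms, of x y] dist_to_set_lipschitz[OF assms, of y x] commute[of x y]
    by linarith
qed

lemma limitin_nonexpanding:
  assumes "\<And>n. f n \<in> nonexpanding"
  shows "limitin compact_open_topology f h sequentially \<longleftrightarrow> (\<forall>x. (\<lambda>n. f n x) \<longlonglongrightarrow> h x)"
proof -
  have pointwise: "limitin euclidean f h sequentially \<longleftrightarrow> (\<forall>x. (\<lambda>n. f n x) \<longlonglongrightarrow> h x)"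
    using limitin_componentwise[of "\<lambda>_. euclidean" UNIV f h sequentially]
    unfolding euclidean_product_topology by simp
  have lim: "(\<forall>x. (\<lambda>n. f n x) \<longlonglongrightarrow> h x) \<Longrightarrow> h \<in> nonexpanding"
    unfolding nonexpanding_def
  proof (intro CollectI allI)
    fix x y assume "\<forall>x. (\<lambda>n. f n x) \<longlonglongrightarrow> h x"
    then have "(\<lambda>n. \<bar>f n x - f n y\<bar>) \<longlonglongrightarrow> \<bar>h x - h y\<bar>" by (intro tendsto_intros) auto
    then show "\<bar>h x - h y\<bar> \<le> d x y"
      by (rule LIMSEQ_le_const2) (use assms in \<open>auto simp: nonexpanding_def\<close>)
  qed
  have "limitin compact_open_topology f h sequentially \<Longrightarrow> \<forall>x. (\<lambda>n. f n x) \<longlonglongrightarrow> h x"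
    using continuous_map_limit[OF continuous_map_compact_open_eval] by (fastforce simp: o_def)
  moreover have "limitin compact_open_topology f h sequentially" if "\<forall>x. (\<lambda>n. f n x) \<longlonglongrightarrow> h x"
  proof -
    have "limitin (top_of_set nonexpanding) f h sequentially"
      unfolding limitin_subtopology using that pointwise lim assms by auto
    then show ?thesis unfolding compact_open_nonexpanding[symmetric] limitin_subtopology by blast
  qed
  ultimately show ?thesis by blast
qed

lemma dl_function_imp_dl_limits:
  assumes "dl_function d h"
  shows "h \<in> dl_limits" and "\<exists>y. h y = 0"
proof -
  obtain y K where K: "\<And>n. closed (K n)" "\<And>n. K n \<noteq> {}"
    "filterlim (\<lambda>n. dist_to_set d y (K n)) at_top sequentially"
    "limitin compact_open_topology (\<lambda>n x. dist_to_set d x (K n) - dist_to_set d y (K n)) h sequentially"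
    using assms unfolding dl_function_def by blast
  then have lim: "(\<lambda>n. dist_to_set d x (K n) - dist_to_set d y (K n)) \<longlonglongrightarrow> h x" for x
    using limitin_nonexpanding[OF shifted_dist_in_nonexpanding[OF K(2)]] by auto
  have "h y = 0" using LIMSEQ_unique[OF lim[of y]] by simp
  then show "\<exists>y. h y = 0" ..
  show "h \<in> dl_limits"
  proof (rule dl_limits_I)
    fix F :: "'a set" and e N :: real assume F: "finite F" "0 < e"
    have "\<forall>\<^sub>F n in sequentially. \<bar>dist_to_set d x (K n) - dist_to_set d y (K n) - h x\<bar> < e" for x
      using tendstoD[OF lim[of x] F(2)] by (simp add: dist_real_def)
    then have "\<forall>\<^sub>F n in sequentially. \<forall>x\<in>F. \<bar>dist_to_set d x (K n) - dist_to_set d y (K n) - h x\<bar> < e"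
      using F(1) by (simp add: eventually_ball_finite)
    moreover have "\<forall>\<^sub>F n in sequentially. N \<le> dist_to_set d y (K n)"
      using K(3) unfolding filterlim_at_top by blast
    ultimately have "\<forall>\<^sub>F n in sequentially. N \<le> dist_to_set d y (K n) \<and>
        (\<forall>x\<in>F. \<bar>dist_to_set d x (K n) - dist_to_set d y (K n) - h x\<bar> < e)"
      by eventually_elim blast
    then obtain n where "N \<le> dist_to_set d y (K n) \<and>
        (\<forall>x\<in>F. \<bar>dist_to_set d x (K n) - dist_to_set d y (K n) - h x\<bar> < e)"
      using eventually_happens'[OF sequentially_bot] by blast
    then show "\<exists>K s. closed K \<and> K \<noteq> {} \<and> N \<le> s \<and> (\<forall>x\<in>F. \<bar>dist_to_set d x K - s - h x\<bar> < e)"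
      using K(1,2) by (intro exI[of _ "K n"] exI[of _ "dist_to_set d y (K n)"]) blast
  qed
qed

text \<open>
  A sequence is extracted with the help of a countable dense set: the \<open>n\<close>-th closed set is good at
  the points with index up to \<open>n\<close>, and the Lipschitz property extends convergence to all points.
\<close>

lemma dl_limits_imp_dl_function:
  assumes h: "h \<in> dl_limits" and y: "h y = 0"
  shows "dl_function d h"
proof -
  obtain D :: "'a set" where D: "countable D" "\<And>X. open X \<Longrightarrow> X \<noteq> {} \<Longrightarrow> \<exists>x\<in>D. x \<in> X"
    using countable_dense_setE by blast
  define F where "F n = insert y (from_nat_into D ` {..n})" for n
  define e where "e n = inverse (real (Suc n))" for n
  have "\<forall>n. \<exists>K s. closed K \<and> K \<noteq> {} \<and> real n \<le> s \<and> (\<forall>x\<in>F n. \<bar>dist_to_set d x K - s - h x\<bar> < e n)"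
  proof
    fix n
    obtain K s where "closed K" "K \<noteq> {}" "real n \<le> s" "\<And>x. x \<in> F n \<Longrightarrow> \<bar>dist_to_set d x K - s - h x\<bar> < e n"
    proof (rule dl_limits_E[OF h, of "F n" "e n" "real n"])
      show "finite (F n)" "0 < e n" by (simp_all add: F_def e_def)
    qed blast
    then show "\<exists>K s. closed K \<and> K \<noteq> {} \<and> real n \<le> s \<and> (\<forall>x\<in>F n. \<bar>dist_to_set d x K - s - h x\<bar> < e n)"
      by blast
  qed
  from choice[OF this] obtain K where
    "\<forall>n. \<exists>s. closed (K n) \<and> K n \<noteq> {} \<and> real n \<le> s \<and> (\<forall>x\<in>F n. \<bar>dist_to_set d x (K n) - s - h x\<bar> < e n)" ..
  from choice[OF this] obtain s where
    "\<forall>n. closed (K n) \<and> K n \<noteq> {} \<and> real n \<le> s n \<and> (\<forall>x\<in>F n. \<bar>dist_to_set d x (K n) - s n - h x\<bar> < e n)" ..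
  then have K: "\<And>n. closed (K n)" "\<And>n. K n \<noteq> {}" "\<And>n. real n \<le> s n"
    "\<And>n x. x \<in> F n \<Longrightarrow> \<bar>dist_to_set d x (K n) - s n - h x\<bar> < e n"
    by simp_all
  define f where "f n x = dist_to_set d x (K n) - dist_to_set d y (K n)" for n x
  have fLip: "f n \<in> nonexpanding" for n unfolding f_def by (rule shifted_dist_in_nonexpanding[OF K(2)])
  have base: "\<bar>dist_to_set d y (K n) - s n\<bar> < e n" for n
    using K(4)[of y n] y by (simp add: F_def)
  have e1: "e n \<le> 1" for n unfolding e_def by (simp add: inverse_le_1_iff)
  have e0: "e \<longlonglongrightarrow> 0" unfolding e_def by (rule LIMSEQ_inverse_real_of_nat)
  have "filterlim (\<lambda>n. dist_to_set d y (K n)) at_top sequentially"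
  proof (rule filterlim_at_top_mono)
    show "filterlim (\<lambda>n. real n - 1) at_top sequentially"
      by (rule filterlim_tendsto_add_at_top[of "\<lambda>_. -1" "-1", simplified])
         (auto intro: filterlim_real_sequentially)
    have "real n - 1 \<le> dist_to_set d y (K n)" for n using base[of n] e1[of n] K(3)[of n] by linarith
    then show "\<forall>\<^sub>F n in sequentially. real n - 1 \<le> dist_to_set d y (K n)" by simp
  qed
  moreover have "(\<lambda>n. f n x) \<longlonglongrightarrow> h x" for x
  proof (rule LIMSEQ_I)
    fix r :: real assume "0 < r"
    then have "mball x (r / 4) \<noteq> {}" by (metis centre_in_mball_iff UNIV_I empty_iff zero_less_divide_iff zero_less_numeral)
    from D(2)[OF open_mball this] obtain z where "z \<in> D" "z \<in> mball x (r / 4)" by blast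
    then have z: "z \<in> D" "d x z < r / 4" by auto
    define k where "k = to_nat_on D z"
    have zk: "from_nat_into D k = z" using z(1) D(1) by (simp add: k_def)
    have "0 < r / 4" using \<open>0 < r\<close> by simp
    from order_tendstoD(2)[OF e0 this] obtain N where N: "\<And>n. n \<ge> N \<Longrightarrow> e n < r / 4"
      unfolding eventually_sequentially by blast
    have "norm (f n x - h x) < r" if n: "n \<ge> max N k" for n
    proof -
      have "z \<in> F n" unfolding F_def using n zk by (auto intro!: image_eqI[of _ _ k])
      from K(4)[OF this] have "\<bar>f n z - h z\<bar> < 2 * e n" using base[of n] unfolding f_def by linarith
      moreover have "\<bar>f n x - f n z\<bar> \<le> d x z" using fLip unfolding nonexpanding_def by blast
      moreover have "\<bar>h x - h z\<bar> \<le> d x z" by (rule dl_limits_lipschitz[OF h])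
      moreover have "e n < r / 4" using N n by simp
      ultimately show ?thesis using z(2) unfolding real_norm_def by linarith
    qed
    then show "\<exists>no. \<forall>n\<ge>no. norm (f n x - h x) < r" by blast
  qed
  then have "limitin compact_open_topology f h sequentially" using limitin_nonexpanding[of f h, OF fLip] by blast
  ultimately show ?thesis
    unfolding dl_function_def using K(1,2) by (intro exI[of _ y] exI[of _ K]) (simp add: f_def[abs_def])
qed

lemma dl_function_iff: "dl_function d h \<longleftrightarrow> h \<in> dl_limits \<and> (\<exists>y. h y = 0)"
  using dl_function_imp_dl_limits dl_limits_imp_dl_function by blast

text \<open>
  Normalization at \<open>p\<close> is a retraction of the dl-functions onto \<open>dl_normalized p\<close> whose fibres are
  the classes modulo constants.
\<close>

lemma M_natural_homeomorphic: "M_natural d homeomorphic_space top_of_set (dl_normalized p)"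
proof -
  let ?Z = "{h. dl_function d h}"
  let ?X = "subtopology compact_open_topology ?Z" and ?q = "\<lambda>h. mod_constants d `` {h}"
  let ?r = "\<lambda>h x. h x - h p :: real"
  have ZL: "?Z \<subseteq> nonexpanding" using dl_function_imp_dl_limits dl_limits_subset_nonexpanding by blast
  have X: "?X = top_of_set ?Z" by (rule compact_open_subset_nonexpanding[OF ZL])
  have sub: "dl_normalized p \<subseteq> ?Z" unfolding dl_function_iff dl_normalized_def by blast
  have rD: "?r h \<in> dl_normalized p" if "h \<in> ?Z" for h
    using that dl_limits_normalize dl_function_imp_dl_limits by blast
  have q: "quotient_map ?X (M_natural d) ?q"
    unfolding M_natural_def by (rule quotient_map_quotient_topology)
  have qr: "?q h = ?q h' \<longleftrightarrow> ?r h = ?r h'" if h: "h \<in> ?Z" "h' \<in> ?Z" for h h'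
  proof
    assume "?q h = ?q h'"
    moreover have "h' \<in> ?q h'" using h by (auto simp: mod_constants_def intro!: exI[of _ 0])
    ultimately have "h' \<in> ?q h" by simp
    then obtain c where "\<And>x. h' x = h x + c" unfolding mod_constants_def by auto
    then show "?r h = ?r h'" by simp
  next
    assume eq: "?r h = ?r h'"
    have "h' x = h x + (h' p - h p)" for x using fun_cong[OF eq, of x] by simp
    then have *: "\<exists>c. \<forall>x. h' x = h x + c" by blast
    have "(\<exists>c. \<forall>x. f x = h x + c) \<longleftrightarrow> (\<exists>c. \<forall>x. f x = h' x + c)" for f
    proof -
      obtain c where c: "\<And>x. h' x = h x + c" using * by blast
      show ?thesis
      proof
        assume "\<exists>a. \<forall>x. f x = h x + a"
        then obtain a where "\<And>x. f x = h x + a" by blast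
        then show "\<exists>a. \<forall>x. f x = h' x + a" using c by (intro exI[of _ "a - c"]) simp
      next
        assume "\<exists>a. \<forall>x. f x = h' x + a"
        then obtain a where "\<And>x. f x = h' x + a" by blast
        then show "\<exists>a. \<forall>x. f x = h x + a" using c by (intro exI[of _ "a + c"]) simp
      qed
    qed
    then show "?q h = ?q h'" using h by (auto simp: mod_constants_def)
  qed
  have cr: "continuous_map ?X (top_of_set (dl_normalized p)) ?r"
  proof -
    have "continuous_on ?Z ?r"
      by (intro continuous_on_coordinatewise_then_product continuous_intros)
         (auto intro: continuous_on_subset[OF continuous_on_product_coordinates])
    then show ?thesis unfolding X using rD by auto
  qed
  obtain \<phi> where \<phi>: "continuous_map (M_natural d) (top_of_set (dl_normalized p)) \<phi>"
    "\<And>h. h \<in> topspace ?X \<Longrightarrow> \<phi> (?q h) = ?r h"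
  proof (rule quotient_map_lift_exists[OF q cr])
    fix h h' assume "h \<in> topspace ?X" "h' \<in> topspace ?X" "?q h = ?q h'"
    then show "?r h = ?r h'" using qr[of h h'] by (simp add: X)
  qed blast
  have ci: "continuous_map (top_of_set (dl_normalized p)) (M_natural d) ?q"
  proof -
    have "continuous_map (top_of_set (dl_normalized p)) ?X id" unfolding X using sub by auto
    from continuous_map_compose[OF this quotient_imp_continuous_map[OF q]] show ?thesis by simp
  qed
  have "homeomorphic_maps (M_natural d) (top_of_set (dl_normalized p)) \<phi> ?q"
    unfolding homeomorphic_maps_def
  proof (intro conjI ballI \<phi>(1) ci)
    fix h assume h: "h \<in> topspace (top_of_set (dl_normalized p))"
    then have "\<phi> (?q h) = ?r h" using sub by (intro \<phi>(2)) (auto simp: X)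
    then show "\<phi> (?q h) = h" using h by (simp add: dl_normalized_def)
  next
    fix c assume "c \<in> topspace (M_natural d)"
    then obtain h where h: "h \<in> ?Z" "c = ?q h"
      using quotient_imp_surjective_map[OF q] by (auto simp: X)
    have "?q (?r h) = ?q h"
      using qr[of "?r h" h] rD[OF h(1)] sub h(1) by auto
    moreover have "\<phi> (?q h) = ?r h" using h(1) by (intro \<phi>(2)) (simp add: X)
    ultimately show "?q (\<phi> c) = c" using h(2) by simp
  qed
  then show ?thesis unfolding homeomorphic_space_def by blast
qed

end

section \<open>Compactifications: remainders and the Stone-Cech compactification\<close>

text \<open>
  The compactification is the closure of the graph of \<open>f\<close> in the product of the one-point
  compactification of \<open>X\<close> with \<open>Y\<close>. Over \<open>X\<close> it is the graph itself, which is a copy of \<open>X\<close>; over the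
  point at infinity it is all of \<open>Y\<close> by density.
\<close>

lemma is_remainder_of_dense_map:
  fixes X :: "'a topology" and Y :: "'b topology"
  assumes X: "locally_compact_space X" "Hausdorff_space X" and Y: "compact_space Y" "Hausdorff_space Y"
    and f: "continuous_map X Y f"
    and dense: "\<And>C U. compactin X C \<Longrightarrow> openin Y U \<Longrightarrow> U \<noteq> {} \<Longrightarrow> \<exists>x\<in>topspace X - C. f x \<in> U"
  shows "is_remainder X Y"
proof -
  define P where "P = prod_topology (Alexandroff_compactification X) Y"
  define e where "e x = (Some x, f x)" for x
  define G where "G = e ` topspace X"
  define W where "W = G \<union> {None} \<times> topspace Y"
  have fY: "f x \<in> topspace Y" if "x \<in> topspace X" for x
    using f that by (simp add: continuous_map_def Pi_iff)
  have GP: "G \<subseteq> topspace P" and WP: "W \<subseteq> topspace P"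
    using fY by (auto simp: G_def W_def P_def e_def)
  have "closedin P W"
    unfolding closedin_def
  proof (intro conjI WP)
    show "openin P (topspace P - W)"
    proof (subst openin_subopen, intro ballI)
      fix z assume z: "z \<in> topspace P - W"
      then obtain x y where xy: "z = (Some x, y)" "x \<in> topspace X" "y \<in> topspace Y" "y \<noteq> f x"
        by (cases z) (auto simp: P_def W_def G_def e_def)
      then obtain U V where UV: "openin Y U" "openin Y V" "f x \<in> U" "y \<in> V" "disjnt U V"
        using Y(2) fY[OF xy(2)] unfolding Hausdorff_space_def by metis
      let ?T = "(Some ` {x \<in> topspace X. f x \<in> U}) \<times> V"
      have "openin P ?T"
        unfolding P_def using UV openin_continuous_map_preimage[OF f UV(1)]
        by (simp add: openin_prod_Times_iff)
      moreover have "z \<in> ?T" using xy UV by auto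
      moreover have "?T \<subseteq> topspace P - W"
        using openin_subset[OF UV(2)] UV(5) by (auto simp: P_def W_def G_def e_def disjnt_iff)
      ultimately show "\<exists>T. openin P T \<and> z \<in> T \<and> T \<subseteq> topspace P - W" by blast
    qed
  qed
  moreover have "compact_space P" using Y(1) by (simp add: P_def compact_space_prod_topology)
  ultimately have comp: "compact_space (subtopology P W)"
    by (simp add: closedin_compact_space compact_space_subtopology)
  have haus: "Hausdorff_space (subtopology P W)"
    using X Y by (simp add: P_def Hausdorff_space_subtopology Hausdorff_space_prod_topology
        Hausdorff_space_Alexandroff_compactification)
  have "embedding_map X P e"
  proof -
    obtain s where s: "homeomorphic_maps X
        (subtopology (Alexandroff_compactification X) (Some ` topspace X)) Some s"
      using embedding_map_Some[of X] unfolding embedding_map_def homeomorphic_map_maps by blast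
    have "homeomorphic_maps X (subtopology P G) e (s \<circ> fst)"
      unfolding homeomorphic_maps_def
    proof (intro conjI ballI)
      have "continuous_map X P e"
        unfolding P_def e_def by (intro continuous_map_pairedI continuous_map_Some f)
      then show "continuous_map X (subtopology P G) e"
        by (auto simp: continuous_map_in_subtopology G_def)
      have "continuous_map (subtopology P G)
          (subtopology (Alexandroff_compactification X) (Some ` topspace X)) fst"
        unfolding P_def
        by (auto simp: continuous_map_in_subtopology G_def e_def
            intro!: continuous_map_from_subtopology continuous_map_fst)
      then show "continuous_map (subtopology P G) X (s \<circ> fst)"
        by (rule continuous_map_compose) (use s in \<open>auto simp: homeomorphic_maps_def\<close>)
      show "(s \<circ> fst) (e x) = x" if "x \<in> topspace X" for x
        using s that by (simp add: e_def homeomorphic_maps_def)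
      show "e ((s \<circ> fst) z) = z" if "z \<in> topspace (subtopology P G)" for z
        using s that by (auto simp: e_def G_def homeomorphic_maps_def)
    qed
    then show ?thesis unfolding embedding_map_def G_def homeomorphic_map_maps by blast
  qed
  then have emb: "embedding_map X (subtopology P W) e"
    by (auto simp: embedding_map_in_subtopology W_def G_def)
  have "W \<subseteq> P closure_of G"
  proof
    fix z assume z: "z \<in> W"
    show "z \<in> P closure_of G"
    proof (cases "z \<in> G")
      case True
      then show ?thesis using closure_of_subset[OF GP] by blast
    next
      case False
      then obtain y where y: "z = (None, y)" "y \<in> topspace Y" using z by (auto simp: W_def)
      have "\<exists>g\<in>G. g \<in> T" if T: "z \<in> T" "openin P T" for T
      proof -
        obtain A U where AU: "openin (Alexandroff_compactification X) A" "openin Y U"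
          "None \<in> A" "y \<in> U" "A \<times> U \<subseteq> T"
          using T unfolding P_def openin_prod_topology_alt y(1) by metis
        then obtain C where C: "compactin X C" "A = insert None (Some ` (topspace X - C))"
          unfolding openin_Alexandroff_compactification by blast
        obtain x where x: "x \<in> topspace X - C" "f x \<in> U" using dense[OF C(1) AU(2)] AU(4) by blast
        then have "e x \<in> T" using AU(5) C(2) by (auto simp: e_def)
        then show ?thesis using x(1) by (auto simp: G_def)
      qed
      then show ?thesis using z WP unfolding in_closure_of by blast
    qed
  qed
  then have clos: "subtopology P W closure_of (e ` topspace X) = topspace (subtopology P W)"
    using WP by (auto simp: closure_of_subtopology W_def G_def[symmetric] Int_absorb1)
  have "subtopology (subtopology P W) (topspace (subtopology P W) - e ` topspace X) =
      subtopology P ({None} \<times> topspace Y)"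
    unfolding subtopology_subtopology
    by (rule arg_cong[where f="subtopology P"]) (use WP in \<open>auto simp: W_def G_def e_def P_def\<close>)
  moreover have "homeomorphic_maps (subtopology P ({None} \<times> topspace Y)) Y snd (\<lambda>y. (None, y))"
    unfolding homeomorphic_maps_def P_def
    by (auto simp: continuous_map_in_subtopology continuous_map_from_subtopology continuous_map_snd
        intro!: continuous_map_pairedI)
  ultimately have "remainder X (subtopology P W) e homeomorphic_space Y"
    unfolding remainder_def homeomorphic_space_def by auto
  then have "compactification_with_remainder X (subtopology P W) e Y"
    unfolding compactification_with_remainder_def compactification_def
    using comp haus emb clos by blast
  then show ?thesis by (rule is_remainderI)
qed

text \<open>
  \<open>C\<close> embeds into a cube by functions \<open>e(\<cdot>)(k)\<close>, and each composition of such a function with \<open>i\<close> is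
  one of the coordinates of the Stone-Cech cube. Forgetting the other coordinates maps the
  Stone-Cech compactification into the closed image of \<open>C\<close>.
\<close>

lemma stone_cech_universal:
  assumes C: "compact_space C" "Hausdorff_space C" and i: "continuous_map X C i"
  obtains \<pi> where "continuous_map (stone_cech X) C \<pi>" "\<And>x. x \<in> topspace X \<Longrightarrow> \<pi> (stone_cech_map X x) = i x"
proof -
  have "completely_regular_space C"
    using C by (simp add: compact_Hausdorff_or_regular_imp_normal_space normal_imp_completely_regular_space)
  then obtain K :: "('a \<Rightarrow> real) set" and e where
    e: "embedding_map C (product_topology (\<lambda>_. top_of_set {0..1::real}) K) e"
    using completely_regular_space_cube_embedding[OF _ C(2)] by metis
  let ?Q = "product_topology (\<lambda>_. top_of_set {0..1::real}) K"
  let ?P = "product_topology (\<lambda>_. top_of_set {0..1::real}) (unit_functions X)"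
  obtain e' where e': "homeomorphic_maps C (subtopology ?Q (e ` topspace C)) e e'"
    using e unfolding embedding_map_def homeomorphic_map_maps by blast
  have ce: "continuous_map C ?Q e"
    using e' by (simp add: homeomorphic_maps_def continuous_map_in_subtopology)
  define u where "u k = (\<lambda>x\<in>topspace X. e (i x) k)" for k
  have u: "u k \<in> unit_functions X" if "k \<in> K" for k
  proof -
    have "continuous_map C (top_of_set {0..1}) (\<lambda>c. e c k)"
      using ce that by (simp add: continuous_map_componentwise)
    from continuous_map_compose[OF i this] have "continuous_map X (top_of_set {0..1}) (u k)"
      by (rule continuous_map_eq) (simp add: u_def)
    then show ?thesis unfolding unit_functions_def by (simp add: u_def)
  qed
  define \<Psi> where "\<Psi> \<xi> = (\<lambda>k\<in>K. \<xi> (u k))" for \<xi> :: "('b \<Rightarrow> real) \<Rightarrow> real"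
  have c\<Psi>: "continuous_map ?P ?Q \<Psi>"
    unfolding continuous_map_componentwise \<Psi>_def
    using u by (auto intro: continuous_map_product_projection)
  have \<Psi>e: "\<Psi> (stone_cech_map X x) = e (i x)" if x: "x \<in> topspace X" for x
  proof -
    have "i x \<in> topspace C" using i x by (simp add: continuous_map_def Pi_iff)
    then have "e (i x) \<in> extensional K" using ce by (auto simp: continuous_map_def Pi_iff PiE_def)
    then show ?thesis
      using x u by (auto simp: \<Psi>_def stone_cech_map_def u_def fun_eq_iff extensional_def)
  qed
  have "compactin ?Q (e ` topspace C)"
    using C(1) ce by (simp add: compact_space_def image_compactin)
  moreover have "Hausdorff_space ?Q"
    by (simp add: Hausdorff_space_product_topology Hausdorff_space_subtopology)
  ultimately have cl: "closedin ?Q (e ` topspace C)" by (simp add: compactin_imp_closedin)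
  have ts: "topspace (stone_cech X) = ?P closure_of (stone_cech_map X ` topspace X)"
    unfolding stone_cech_def Let_def topspace_subtopology
    by (rule Int_absorb1[OF closure_of_subset_topspace])
  have "\<Psi> ` (?P closure_of (stone_cech_map X ` topspace X)) \<subseteq> ?Q closure_of (\<Psi> ` stone_cech_map X ` topspace X)"
    using c\<Psi> by (rule continuous_map_image_closure_subset)
  also have "\<dots> \<subseteq> e ` topspace C"
  proof (rule closure_of_minimal[OF _ cl])
    show "\<Psi> ` stone_cech_map X ` topspace X \<subseteq> e ` topspace C"
      using \<Psi>e i by (auto simp: continuous_map_def Pi_iff)
  qed
  finally have "continuous_map (stone_cech X) (subtopology ?Q (e ` topspace C)) \<Psi>"
    using c\<Psi> unfolding continuous_map_in_subtopology ts[symmetric]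
    by (auto simp: stone_cech_def Let_def intro: continuous_map_from_subtopology)
  then have "continuous_map (stone_cech X) C (e' \<circ> \<Psi>)"
    by (rule continuous_map_compose) (use e' in \<open>simp add: homeomorphic_maps_def\<close>)
  moreover have "(e' \<circ> \<Psi>) (stone_cech_map X x) = i x" if x: "x \<in> topspace X" for x
    using \<Psi>e[OF x] e' i x by (auto simp: homeomorphic_maps_def continuous_map_def Pi_iff)
  ultimately show ?thesis by (rule that)
qed

text \<open>
  The extension is the coordinate of \<open>f\<close> in the Stone-Cech cube, pulled back to \<open>C\<close>.
\<close>

lemma stone_cech_le_imp_extension:
  assumes le: "compactification_le X (stone_cech X) (stone_cech_map X) C i"
    and f: "continuous_map X (top_of_set {0..1}) f"
  obtains F where "continuous_map C (top_of_set {0..1::real}) F" "\<And>x. x \<in> topspace X \<Longrightarrow> F (i x) = f x"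
proof -
  obtain \<pi> where \<pi>: "continuous_map C (stone_cech X) \<pi>" "\<And>x. x \<in> topspace X \<Longrightarrow> \<pi> (i x) = stone_cech_map X x"
    using le unfolding compactification_le_def by blast
  let ?f = "restrict f (topspace X)"
  have uf: "?f \<in> unit_functions X"
    unfolding unit_functions_def using continuous_map_eq[OF f, of ?f] by simp
  have "continuous_map (stone_cech X) (top_of_set {0..1}) (\<lambda>\<xi>. \<xi> ?f)"
    unfolding stone_cech_def Let_def
    by (intro continuous_map_from_subtopology continuous_map_product_projection uf)
  from continuous_map_compose[OF \<pi>(1) this]
  have "continuous_map C (top_of_set {0..1}) (\<lambda>c. \<pi> c ?f)" by (simp add: o_def)
  moreover have "\<pi> (i x) ?f = f x" if "x \<in> topspace X" for x
    using \<pi>(2)[OF that] uf that by (simp add: stone_cech_map_def)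
  ultimately show ?thesis by (rule that)
qed

lemma (in Metric_space) continuous_map_dist_from:
  "continuous_map mtopology euclideanreal (d p)" if p: "p \<in> M"
  unfolding continuous_map_def
proof (intro conjI allI impI)
  fix U :: "real set" assume "openin euclideanreal U"
  then have U: "open U" by simp
  show "openin mtopology {z \<in> topspace mtopology. d p z \<in> U}"
    unfolding openin_mtopology
  proof (intro conjI allI impI)
    fix z assume "z \<in> {z \<in> topspace mtopology. d p z \<in> U}"
    then have z: "z \<in> M" "d p z \<in> U" by auto
    then obtain e where e: "e > 0" "\<And>y. dist y (d p z) < e \<Longrightarrow> y \<in> U"
      using U unfolding open_dist by blast
    have "mball z e \<subseteq> {z \<in> topspace mtopology. d p z \<in> U}"
    proof
      fix y assume y: "y \<in> mball z e"
      then have "\<bar>d p y - d p z\<bar> \<le> d y z"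
        using mdist_reverse_triangle[of y p z] p by (simp add: commute)
      then have "dist (d p y) (d p z) < e" using y by (simp add: dist_real_def commute)
      then show "y \<in> {z \<in> topspace mtopology. d p z \<in> U}" using e(2) y by auto
    qed
    then show "\<exists>r>0. mball z r \<subseteq> {z \<in> topspace mtopology. d p z \<in> U}" using e(1) by blast
  qed auto
qed simp

text \<open>
  If the relation held, every \<open>f : X \<rightarrow> [0,1]\<close> would extend to \<open>C\<close>. The extension of \<open>w\<close> vanishes exactly
  on the remainder, which is therefore closed; adding a Tietze extension of the distance to a
  point \<open>p\<close> of the remainder gives a function \<open>\<psi>\<close> on \<open>C\<close> whose only zero is \<open>p\<close>. As \<open>X\<close> is connected,
  \<open>\<psi>\<close> takes every small positive value on \<open>X\<close>, and by compactness small values occur only near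
  \<open>p\<close>. Hence \<open>cos (pi / \<psi>)\<close> oscillates between \<open>1\<close> and \<open>-1\<close> near \<open>p\<close> and cannot extend.
\<close>

lemma not_stone_cech_le:
  fixes X :: "'a topology" and C :: "'c topology" and w :: "'a \<Rightarrow> real"
  assumes CR: "compactification_with_remainder X C i R" and R: "metrizable_space R"
    and X: "connected_space X" "\<not> compact_space X"
    and w: "continuous_map X (top_of_set {0..1}) w" "\<And>x. x \<in> topspace X \<Longrightarrow> 0 < w x"
      "\<And>e. 0 < e \<Longrightarrow> compactin X {x \<in> topspace X. e \<le> w x}"
  shows "\<not> compactification_le X (stone_cech X) (stone_cech_map X) C i"
proof
  assume le: "compactification_le X (stone_cech X) (stone_cech_map X) C i"
  have C: "compact_space C" "Hausdorff_space C" "embedding_map X C i"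
      "C closure_of (i ` topspace X) = topspace C" "remainder X C i homeomorphic_space R"
    using CR by (auto simp: compactification_with_remainder_def compactification_def)
  have hom: "homeomorphic_map X (subtopology C (i ` topspace X)) i"
    using C(3) by (simp add: embedding_map_def)
  have ci: "continuous_map X C i"
    using homeomorphic_imp_continuous_map[OF hom] by (simp add: continuous_map_in_subtopology)
  have iC: "i x \<in> topspace C" if "x \<in> topspace X" for x
    using ci that by (simp add: continuous_map_def Pi_iff)
  have dense: "\<exists>x\<in>topspace X. i x \<in> T" if T: "openin C T" "z \<in> T" for T z
  proof -
    have "z \<in> C closure_of (i ` topspace X)" using T openin_subset[OF T(1)] C(4) by auto
    then show ?thesis using T unfolding in_closure_of by blast
  qed
  define R0 where "R0 = topspace C - i ` topspace X"
  obtain W where W: "continuous_map C (top_of_set {0..1::real}) W" "\<And>x. x \<in> topspace X \<Longrightarrow> W (i x) = w x"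
    by (rule stone_cech_le_imp_extension[OF le w(1)]) blast
  have cW: "continuous_map C euclideanreal W" and W01: "\<And>z. z \<in> topspace C \<Longrightarrow> 0 \<le> W z"
    using W(1) by (auto simp: continuous_map_in_subtopology Pi_iff image_subset_iff)
  \<comment> \<open>otherwise \<open>z\<close> has a neighbourhood whose trace on \<open>X\<close> lies in a compact set; removing that set contradicts density\<close>
  have WR0: "W z = 0" if z: "z \<in> R0" for z
  proof (rule ccontr)
    have zC: "z \<in> topspace C" using z by (simp add: R0_def)
    assume "W z \<noteq> 0"
    then have pos: "0 < W z / 2" using W01[OF zC] by simp
    let ?K = "{x \<in> topspace X. W z / 2 \<le> w x}"
    have "compactin C (i ` ?K)" using w(3)[OF pos] ci by (rule image_compactin)
    then have "closedin C (i ` ?K)" using C(2) by (simp add: compactin_imp_closedin)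
    moreover have "openin C {y \<in> topspace C. W y \<in> {W z / 2<..}}"
      by (rule openin_continuous_map_preimage[OF cW]) simp
    ultimately have "openin C ({y \<in> topspace C. W y \<in> {W z / 2<..}} - i ` ?K)" by (rule openin_diff[rotated])
    moreover have "z \<in> {y \<in> topspace C. W y \<in> {W z / 2<..}} - i ` ?K"
      using zC pos z by (auto simp: R0_def)
    ultimately obtain x where x: "x \<in> topspace X" "i x \<in> {y \<in> topspace C. W y \<in> {W z / 2<..}} - i ` ?K"
      using dense by blast
    then have "x \<in> ?K" using W(2) by auto
    then show False using x(2) by blast
  qed
  have "R0 = {z \<in> topspace C. W z \<in> {0}}"
    using WR0 W(2) w(2) by (fastforce simp: R0_def)
  moreover have "closedin C {z \<in> topspace C. W z \<in> {0}}"
    by (rule closedin_continuous_map_preimage[OF cW]) simp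
  ultimately have clR0: "closedin C R0" by simp
  \<comment> \<open>an empty remainder would make \<open>X\<close> compact\<close>
  have "R0 \<noteq> {}"
  proof
    assume "R0 = {}"
    then have "i ` topspace X = topspace C" using iC by (auto simp: R0_def)
    then have "X homeomorphic_space C"
      using hom homeomorphic_map_imp_homeomorphic_space by (metis subtopology_topspace)
    then show False using homeomorphic_compact_space C(1) X(2) by blast
  qed
  then obtain p where p: "p \<in> R0" by blast
  have "metrizable_space (subtopology C R0)"
    using homeomorphic_metrizable_space[OF C(5)] R by (simp add: remainder_def R0_def)
  then obtain M m where m: "Metric_space M m" "subtopology C R0 = Metric_space.mtopology M m"
    unfolding metrizable_space_def by blast
  interpret m: Metric_space M m by (rule m(1))
  have M: "M = R0"
    using arg_cong[OF m(2), of topspace] closedin_subset[OF clR0] by (simp add: Int_absorb1)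
  have "normal_space C"
    using C by (simp add: compact_Hausdorff_or_regular_imp_normal_space)
  moreover have "continuous_map (subtopology C R0) euclideanreal (m p)"
    unfolding m(2) by (rule m.continuous_map_dist_from) (use p M in simp)
  moreover have "is_interval {0::real..}" "{0::real..} \<noteq> {}" "m p ` R0 \<subseteq> {0..}" by auto
  ultimately obtain F where F: "continuous_map C euclideanreal F" "F ` topspace C \<subseteq> {0..}"
    "\<And>z. z \<in> R0 \<Longrightarrow> F z = m p z"
    using Tietze_extension_realinterval[OF _ clR0] by metis
  define \<psi> where "\<psi> z = F z + W z" for z
  have c\<psi>: "continuous_map C euclideanreal \<psi>"
    unfolding \<psi>_def by (intro continuous_map_add F(1) cW)
  have F0: "0 \<le> F z" if "z \<in> topspace C" for z using F(2) that by auto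
  have pC: "p \<in> topspace C" using p by (simp add: R0_def)
  have \<psi>p: "\<psi> p = 0" using F(3)[OF p] WR0[OF p] p M by (simp add: \<psi>_def)
  have \<psi>pos: "0 < \<psi> z" if z: "z \<in> topspace C" "z \<noteq> p" for z
  proof (cases "z \<in> R0")
    case True
    then have "0 < m p z" using p z(2) M by simp
    then show ?thesis using F(3)[OF True] WR0[OF True] by (simp add: \<psi>_def)
  next
    case False
    then obtain x where "x \<in> topspace X" "z = i x" using z(1) by (auto simp: R0_def)
    then have "0 < W z" using W(2) w(2) by simp
    then show ?thesis using F0[OF z(1)] by (simp add: \<psi>_def)
  qed
  have \<psi>i: "0 < \<psi> (i x)" if "x \<in> topspace X" for x
    using \<psi>pos[OF iC[OF that]] p that by (auto simp: R0_def)
  have c\<psi>i: "continuous_map X euclideanreal (\<lambda>x. \<psi> (i x))"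
    using continuous_map_compose[OF ci c\<psi>] by (simp add: o_def)
  have small: "\<exists>x\<in>topspace X. \<psi> (i x) < e" if "0 < e" for e
  proof -
    have "openin C {z \<in> topspace C. \<psi> z \<in> {..<e}}"
      by (rule openin_continuous_map_preimage[OF c\<psi>]) simp
    moreover have "p \<in> {z \<in> topspace C. \<psi> z \<in> {..<e}}" using pC \<psi>p that by simp
    ultimately show ?thesis using dense by blast
  qed
  obtain x0 where x0: "x0 \<in> topspace X" using small[of 1] by auto
  define S where "S = (\<lambda>x. \<psi> (i x)) ` topspace X"
  have "connectedin euclideanreal S"
    unfolding S_def using X(1) connectedin_continuous_map_image[OF c\<psi>i]
    by (simp add: connected_space_def connectedin_topspace)
  then have S: "connected S" by simp
  have attained: "\<exists>x\<in>topspace X. \<psi> (i x) = s" if s: "0 < s" "s \<le> \<psi> (i x0)" for s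
  proof -
    obtain x where "x \<in> topspace X" "\<psi> (i x) < s" using small[OF s(1)] by blast
    then have "\<psi> (i x) \<in> S" "\<psi> (i x0) \<in> S" "s \<in> {\<psi> (i x)..\<psi> (i x0)}"
      using x0 s by (auto simp: S_def)
    then have "s \<in> S" using connected_contains_Icc[OF S] by blast
    then show ?thesis by (auto simp: S_def)
  qed
  define f where "f x = (1 + cos (pi / \<psi> (i x))) / 2" for x
  have "continuous_map X (top_of_set {0<..}) (\<lambda>x. \<psi> (i x))"
    using c\<psi>i \<psi>i by (simp add: continuous_map_in_subtopology image_subset_iff Pi_iff)
  moreover have "continuous_map (top_of_set {0<..}) euclideanreal (\<lambda>s::real. (1 + cos (pi / s)) / 2)"
    unfolding continuous_map_iff_continuous by (intro continuous_intros) auto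
  ultimately have "continuous_map X euclideanreal ((\<lambda>s. (1 + cos (pi / s)) / 2) \<circ> (\<lambda>x. \<psi> (i x)))"
    by (rule continuous_map_compose)
  then have "continuous_map X euclideanreal f" by (simp add: o_def f_def[abs_def])
  moreover have "f x \<in> {0..1}" for x
  proof -
    have "(1 + c) / 2 \<in> {0..1}" if "- 1 \<le> c" "c \<le> 1" for c :: real using that by simp
    from this[OF cos_ge_minus_one cos_le_one] show ?thesis unfolding f_def .
  qed
  ultimately have "continuous_map X (top_of_set {0..1}) f"
    by (auto simp: continuous_map_in_subtopology)
  then obtain G where G: "continuous_map C (top_of_set {0..1::real}) G" "\<And>x. x \<in> topspace X \<Longrightarrow> G (i x) = f x"
    by (rule stone_cech_le_imp_extension[OF le]) blast
  have cG: "continuous_map C euclideanreal G" using G(1) by (simp add: continuous_map_in_subtopology)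
  define T where "T = {z \<in> topspace C. G z \<in> ball (G p) (1 / 2)}"
  have T: "openin C T" unfolding T_def by (rule openin_continuous_map_preimage[OF cG]) simp
  have "p \<in> T" using pC by (simp add: T_def)
  have "compactin C (topspace C - T)" 
    using closedin_compact_space[OF C(1)] T unfolding openin_closedin_eq by blast
  then have "compactin euclideanreal (\<psi> ` (topspace C - T))" using c\<psi> by (rule image_compactin)
  then have "closed (\<psi> ` (topspace C - T))" by (simp add: compact_imp_closed)
  moreover have "0 \<notin> \<psi> ` (topspace C - T)" using \<psi>pos \<open>p \<in> T\<close> by fastforce
  ultimately obtain \<delta> where \<delta>: "\<delta> > 0" "ball 0 \<delta> \<subseteq> - \<psi> ` (topspace C - T)"
    by (meson ComplI openE open_Compl)
  have nearp: "i x \<in> T" if x: "x \<in> topspace X" "\<psi> (i x) < \<delta>" for x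
  proof (rule ccontr)
    assume "i x \<notin> T"
    then have "\<psi> (i x) \<in> \<psi> ` (topspace C - T)" using iC[OF x(1)] by blast
    moreover have "\<psi> (i x) \<in> ball 0 \<delta>" using x(2) \<psi>i[OF x(1)] by (simp add: dist_real_def)
    ultimately show False using \<delta>(2) by blast
  qed
  obtain n :: nat where n: "max (1 / \<delta>) (1 / \<psi> (i x0)) < real n" using reals_Archimedean2 by blast
  have oscillation: "\<exists>x\<in>topspace X. i x \<in> T \<and> f x = (1 + cos (pi * real k)) / 2" if k: "k \<ge> n" for k
  proof -
    have npos: "0 < real n" using n \<delta>(1) by (smt (verit) zero_less_divide_1_iff)
    have kn: "1 / real k \<le> 1 / real n" using k npos by (simp add: frac_le)
    have "1 / real n < \<delta>" "1 / real n < \<psi> (i x0)"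
      using n npos \<delta>(1) \<psi>i[OF x0] by (simp_all add: field_simps)
    then obtain x where x: "x \<in> topspace X" "\<psi> (i x) = 1 / real k"
      using attained[of "1 / real k"] kn k npos by force
    then have "i x \<in> T" using nearp kn \<open>1 / real n < \<delta>\<close> by simp
    then show ?thesis using x by (intro bexI[of _ x]) (simp_all add: f_def)
  qed
  obtain x1 where x1: "x1 \<in> topspace X" "i x1 \<in> T" "f x1 = (1 + cos (pi * real (2 * n))) / 2"
    using oscillation[of "2 * n"] by auto
  obtain x2 where x2: "x2 \<in> topspace X" "i x2 \<in> T" "f x2 = (1 + cos (pi * real (2 * n + 1))) / 2"
    using oscillation[of "2 * n + 1"] by auto
  have "cos (pi * real k) = (- 1) ^ k" for k using cos_npi[of k] by (simp add: mult.commute)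
  then have "f x1 = 1" "f x2 = 0" using x1(3) x2(3) by (simp_all only:) simp_all
  moreover have "\<bar>f x1 - G p\<bar> < 1 / 2" "\<bar>f x2 - G p\<bar> < 1 / 2"
    using x1(1,2) x2(1,2) G(2) by (auto simp: T_def dist_real_def abs_minus_commute)
  ultimately show False by linarith
qed

section \<open>The conclusions for proper length spaces\<close>

context length_space
begin

lemma proper_length_space_if_complete:
  assumes "mcomplete" "\<And>q :: 'a. \<exists>W K. open W \<and> compact K \<and> q \<in> W \<and> W \<subseteq> K"
    and "\<not> compact (UNIV :: 'a set)"
  shows "proper_length_space d"
  by unfold_locales (fact compact_mcball[OF assms(1,2)], fact assms(3))

end

context proper_length_space
begin

lemma peano_M_natural: "peano_space (M_natural d)"
proof -
  fix p
  have h: "M_natural d homeomorphic_space top_of_set (dl_normalized p)" by (rule M_natural_homeomorphic)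
  show ?thesis
    using peano_dl_normalized[of p] homeomorphic_compact_space[OF h] homeomorphic_connected_space[OF h]
      homeomorphic_locally_connected_space[OF h] homeomorphic_metrizable_space[OF h]
    unfolding peano_space_def by blast
qed

lemma continuous_on_dist: "continuous_on UNIV (d p)"
  using continuous_map_dist_from[of p] by (simp add: mtopology_eq)

lemma locally_compact_euclidean: "locally_compact_space (euclidean :: 'a topology)"
  unfolding locally_compact_space_def
proof
  fix x :: 'a
  show "\<exists>U K. openin euclidean U \<and> compactin euclidean K \<and> x \<in> U \<and> U \<subseteq> K"
    using open_mball[of x 1] proper[of x 1] mball_subset_mcball[of x 1]
    by (intro exI[of _ "mball x 1"] exI[of _ "mcball x 1"]) simp
qed

text \<open>
  The map \<open>x \<mapsto> \<gamma> (d p x)\<close> has dense image outside each compact set, because a compact set is bounded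
  and the distance from \<open>p\<close> takes all values beyond the bound.
\<close>

lemma is_remainder_M_natural: "is_remainder (euclidean :: 'a topology) (M_natural d)"
proof -
  fix p
  obtain \<gamma> :: "real \<Rightarrow> 'a \<Rightarrow> real" where \<gamma>: "continuous_on UNIV \<gamma>" "\<And>t. \<gamma> t \<in> dl_normalized p"
    "\<And>U T. open U \<Longrightarrow> U \<inter> dl_normalized p \<noteq> {} \<Longrightarrow> \<exists>t\<ge>T. \<gamma> t \<in> U"
    by (rule dl_normalized_dense_curve) blast
  have "is_remainder (euclidean :: 'a topology) (top_of_set (dl_normalized p))"
  proof (rule is_remainder_of_dense_map[where f="\<lambda>x. \<gamma> (d p x)"])
    show "locally_compact_space (euclidean :: 'a topology)" by (rule locally_compact_euclidean)
    show "Hausdorff_space (euclidean :: 'a topology)"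
      using Hausdorff_space_mtopology by (simp add: mtopology_eq)
    show "compact_space (top_of_set (dl_normalized p))" using compact_dl_normalized by (simp add: compact_space_subtopology)
    show "Hausdorff_space (top_of_set (dl_normalized p))" by (rule metrizable_imp_Hausdorff_space[OF metrizable_dl_normalized])
    have "continuous_on UNIV (\<lambda>x. \<gamma> (d p x))"
      by (rule continuous_on_compose2[OF \<gamma>(1) continuous_on_dist]) simp
    then show "continuous_map euclidean (top_of_set (dl_normalized p)) (\<lambda>x. \<gamma> (d p x))"
      using \<gamma>(2) by (auto simp: continuous_map_in_subtopology)
    fix C :: "'a set" and U
    assume C: "compactin euclidean C" and U: "openin (top_of_set (dl_normalized p)) U" "U \<noteq> {}"
    then obtain V where V: "open V" "U = dl_normalized p \<inter> V" unfolding openin_open by blast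
    have "compact (d p ` C)"
      using C continuous_on_subset[OF continuous_on_dist subset_UNIV] by (intro compact_continuous_image) auto
    then obtain B where B: "\<And>x. x \<in> C \<Longrightarrow> d p x \<le> B"
      using bounded_has_Sup(1)[OF compact_imp_bounded] by (metis imageI empty_iff image_is_empty)
    obtain t where t: "t \<ge> max 0 (B + 1)" "\<gamma> t \<in> V" using \<gamma>(3)[OF V(1), of "max 0 (B + 1)"] U(2) V(2) by blast
    obtain x where x: "d p x = t" using ex_dist_eq[of t p] t(1) by auto
    have "x \<notin> C" using B[of x] x t(1) by auto
    then show "\<exists>x\<in>topspace euclidean - C. \<gamma> (d p x) \<in> U" using x t(2) \<gamma>(2) V(2) by auto
  qed
  then obtain C :: "('a + ('a \<Rightarrow> real)) topology" and i
    where C: "compactification_with_remainder (euclidean :: 'a topology) C i (top_of_set (dl_normalized p))"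
    unfolding is_remainder_def by blast
  have "compactification_with_remainder euclidean C i (M_natural d)"
    using C homeomorphic_space_trans homeomorphic_space_sym M_natural_homeomorphic[of p]
    unfolding compactification_with_remainder_def by blast
  then show ?thesis by (rule is_remainderI)
qed

lemma compactification_less_stone_cech:
  assumes conn: "connected (UNIV :: 'a set)"
    and C: "compactification_with_remainder (euclidean :: 'a topology) C i (M_natural d)"
  shows "compactification_less euclidean C i (stone_cech euclidean) (stone_cech_map euclidean)"
  unfolding compactification_less_def
proof
  have cC: "compact_space C" "Hausdorff_space C" "embedding_map euclidean C i"
    using C by (auto simp: compactification_with_remainder_def compactification_def)
  have "continuous_map euclidean C i"
    using cC(3) homeomorphic_imp_continuous_map unfolding embedding_map_def
    by (metis continuous_map_in_subtopology)
  then obtain \<pi> where "continuous_map (stone_cech euclidean) C \<pi>"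
    "\<And>x. x \<in> topspace euclidean \<Longrightarrow> \<pi> (stone_cech_map euclidean x) = i x"
    by (rule stone_cech_universal[OF cC(1,2)]) blast
  then show "compactification_le euclidean C i (stone_cech euclidean) (stone_cech_map euclidean)"
    unfolding compactification_le_def by blast
  fix p :: 'a
  define w where "w x = 1 / (1 + d p x)" for x
  show "\<not> compactification_le euclidean (stone_cech euclidean) (stone_cech_map euclidean) C i"
  proof (rule not_stone_cech_le[OF C, where w=w])
    show "metrizable_space (M_natural d)" using peano_M_natural by (simp add: peano_space_def)
    show "connected_space (euclidean :: 'a topology)" using conn connectedin_topspace[of "euclidean :: 'a topology"] by simp
    show "\<not> compact_space (euclidean :: 'a topology)" using noncompact by (simp add: compact_space_def)
    have pos: "0 < 1 + d p x" for x by (simp add: add_pos_nonneg)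
    have "continuous_on UNIV w"
      unfolding w_def using pos by (intro continuous_intros continuous_on_dist) (metis less_irrefl)
    then show "continuous_map euclidean (top_of_set {0..1}) w"
      using pos by (auto simp: continuous_map_in_subtopology w_def less_imp_le)
    show "0 < w x" for x using pos by (simp add: w_def)
    show "compactin euclidean {x \<in> topspace euclidean. e \<le> w x}" if e: "0 < e" for e
    proof -
      have "closed (w -` {e..})" using \<open>continuous_on UNIV w\<close> by (intro closed_vimage) auto
      moreover have "w -` {e..} \<subseteq> mcball p (1 / e)"
      proof
        fix x assume "x \<in> w -` {e..}"
        then have "e * (1 + d p x) \<le> 1" using pos[of x] by (simp add: w_def field_simps)
        then have "e * d p x \<le> 1" using e by (simp add: distrib_left)
        then show "x \<in> mcball p (1 / e)" using e by (simp add: field_simps)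
      qed
      ultimately have "compact (w -` {e..})"
        using compact_Int_closed[OF proper[of p "1 / e"], of "w -` {e..}"] by (simp add: Int_absorb1)
      then show ?thesis by (simp add: vimage_def)
    qed
  qed
qed

end

section \<open>Piecewise differentiable curves and their lengths\<close>

lemma smooth_on_imp_continuous_on: "smooth_on S f \<Longrightarrow> continuous_on S f"
  unfolding smooth_on_def by (drule spec[of _ 0]) simp

lemma smooth_on_imp_differentiable: "smooth_on S f \<Longrightarrow> x \<in> S \<Longrightarrow> f differentiable (at x)"
  unfolding smooth_on_def by (drule spec[of _ "Suc 0"]) simp

lemma smooth_on_imp_continuous_on_frechet_derivative:
  "smooth_on S f \<Longrightarrow> continuous_on S (\<lambda>x. frechet_derivative f (at x) v)"
  unfolding smooth_on_def by (drule spec[of _ "Suc 0"]) simp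

text \<open>
  The analogue of \<open>piecewise_C1_path\<close> on an arbitrary interval, so that subpaths and
  concatenations need no reparametrization until the end.
\<close>

definition piecewise_C1_on ::
  "('a::topological_space, 'e::euclidean_space) chart set \<Rightarrow> real \<Rightarrow> real \<Rightarrow> (real \<Rightarrow> 'a) \<Rightarrow> bool" where
  "piecewise_C1_on charts a b c \<longleftrightarrow>
     continuous_on {a..b} c \<and>
     (\<exists>T. finite T \<and>
        (\<forall>a' b'. a \<le> a' \<and> a' < b' \<and> b' \<le> b \<and> {a'<..<b'} \<inter> T = {} \<longrightarrow> C1_curve_on charts a' b' c))"

lemma piecewise_C1_onI:
  assumes "finite T" "continuous_on {a..b} c"
    and "\<And>a' b'. a \<le> a' \<Longrightarrow> a' < b' \<Longrightarrow> b' \<le> b \<Longrightarrow> {a'<..<b'} \<inter> T = {} \<Longrightarrow>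
      C1_curve_on charts a' b' c"
  shows "piecewise_C1_on charts a b c"
  unfolding piecewise_C1_on_def using assms by (intro conjI exI[of _ T]) simp_all

lemma piecewise_C1_path_iff: "piecewise_C1_path charts c \<longleftrightarrow> piecewise_C1_on charts 0 1 c"
  by (simp add: piecewise_C1_path_def piecewise_C1_on_def path_def)

lemma C1_curve_onE:
  assumes "C1_curve_on charts a b c" "(U, \<phi>) \<in> charts"
  obtains v where "continuous_on {t \<in> {a..b}. c t \<in> U} v"
    "\<And>t. t \<in> {a..b} \<Longrightarrow> c t \<in> U \<Longrightarrow>
      ((\<phi> \<circ> c) has_vector_derivative v t) (at t within {t \<in> {a..b}. c t \<in> U})"
proof -
  have "\<exists>v. continuous_on {t \<in> {a..b}. c t \<in> U} v \<and> (\<forall>t\<in>{t \<in> {a..b}. c t \<in> U}.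
      ((\<phi> \<circ> c) has_vector_derivative v t) (at t within {t \<in> {a..b}. c t \<in> U}))"
    using bspec[OF conjunct2[OF assms(1)[unfolded C1_curve_on_def]] assms(2)]
    by (simp only: Let_def prod.case)
  with that show ?thesis by blast
qed

lemma C1_curve_onI:
  assumes "continuous_on {a..b} c"
    and "\<And>U \<phi>. (U, \<phi>) \<in> charts \<Longrightarrow> \<exists>v. continuous_on {t \<in> {a..b}. c t \<in> U} v \<and>
      (\<forall>t. t \<in> {a..b} \<longrightarrow> c t \<in> U \<longrightarrow>
        ((\<phi> \<circ> c) has_vector_derivative v t) (at t within {t \<in> {a..b}. c t \<in> U}))"
  shows "C1_curve_on charts a b c"
proof -
  have "case k of (U, \<phi>) \<Rightarrow> let J = {t \<in> {a..b}. c t \<in> U} in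
      \<exists>v. continuous_on J v \<and> (\<forall>t\<in>J. ((\<phi> \<circ> c) has_vector_derivative v t) (at t within J))"
    if "k \<in> charts" for k
  proof (cases k)
    case (Pair U \<phi>)
    have "\<exists>v. continuous_on {t \<in> {a..b}. c t \<in> U} v \<and> (\<forall>t\<in>{t \<in> {a..b}. c t \<in> U}.
      ((\<phi> \<circ> c) has_vector_derivative v t) (at t within {t \<in> {a..b}. c t \<in> U}))"
      using assms(2)[of U \<phi>] that Pair by blast
    then show ?thesis unfolding Pair by (simp only: Let_def prod.case)
  qed
  then show ?thesis using assms(1) unfolding C1_curve_on_def by blast
qed

lemma C1_curve_on_cong:
  assumes "C1_curve_on charts a b c" and eq: "\<And>t. t \<in> {a..b} \<Longrightarrow> c' t = c t"
  shows "C1_curve_on charts a b c'"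
proof (rule C1_curve_onI)
  show "continuous_on {a..b} c'"
    using assms(1) eq unfolding C1_curve_on_def by (metis (no_types, lifting) continuous_on_cong)
  fix U \<phi> assume U: "(U, \<phi>) \<in> charts"
  have J: "{t \<in> {a..b}. c' t \<in> U} = {t \<in> {a..b}. c t \<in> U}" using eq by auto
  obtain v where v: "continuous_on {t \<in> {a..b}. c t \<in> U} v"
    "\<And>t. t \<in> {a..b} \<Longrightarrow> c t \<in> U \<Longrightarrow>
      ((\<phi> \<circ> c) has_vector_derivative v t) (at t within {t \<in> {a..b}. c t \<in> U})"
    by (rule C1_curve_onE[OF assms(1) U]) blast
  show "\<exists>v. continuous_on {t \<in> {a..b}. c' t \<in> U} v \<and>
      (\<forall>t. t \<in> {a..b} \<longrightarrow> c' t \<in> U \<longrightarrow>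
        ((\<phi> \<circ> c') has_vector_derivative v t) (at t within {t \<in> {a..b}. c' t \<in> U}))"
    unfolding J
  proof (intro exI conjI allI impI)
    show "continuous_on {t \<in> {a..b}. c t \<in> U} v" by (rule v(1))
    fix t assume t: "t \<in> {a..b}" "c' t \<in> U"
    show "((\<phi> \<circ> c') has_vector_derivative v t) (at t within {t \<in> {a..b}. c t \<in> U})"
      by (rule has_vector_derivative_transform[OF _ _ v(2)]) (use t eq in auto)
  qed
qed

lemma C1_curve_on_affine:
  assumes c: "C1_curve_on charts A B c"
    and aff: "\<And>t. t \<in> {a..b} \<Longrightarrow> \<alpha> * t + \<beta> \<in> {A..B}"
  shows "C1_curve_on charts a b (\<lambda>t. c (\<alpha> * t + \<beta>))"
proof (rule C1_curve_onI)
  show "continuous_on {a..b} (\<lambda>t. c (\<alpha> * t + \<beta>))"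
    by (rule continuous_on_compose2[where g=c and t="{A..B}"])
       (use c aff in \<open>auto simp: C1_curve_on_def intro!: continuous_intros\<close>)
  fix U \<phi> assume U: "(U, \<phi>) \<in> charts"
  obtain v where v: "continuous_on {t \<in> {A..B}. c t \<in> U} v"
    "\<And>t. t \<in> {A..B} \<Longrightarrow> c t \<in> U \<Longrightarrow>
      ((\<phi> \<circ> c) has_vector_derivative v t) (at t within {t \<in> {A..B}. c t \<in> U})"
    by (rule C1_curve_onE[OF c U]) blast
  let ?J = "{t \<in> {a..b}. c (\<alpha> * t + \<beta>) \<in> U}" and ?h = "\<lambda>t. \<alpha> * t + \<beta>"
  have im: "?h ` ?J \<subseteq> {t \<in> {A..B}. c t \<in> U}" using aff by auto
  show "\<exists>w. continuous_on ?J w \<and> (\<forall>t. t \<in> {a..b} \<longrightarrow> c (\<alpha> * t + \<beta>) \<in> U \<longrightarrow>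
      ((\<phi> \<circ> (\<lambda>t. c (\<alpha> * t + \<beta>))) has_vector_derivative w t) (at t within ?J))"
  proof (intro exI conjI allI impI)
    show "continuous_on ?J (\<lambda>t. \<alpha> *\<^sub>R v (?h t))"
      by (intro continuous_intros continuous_on_compose2[OF v(1) _ im])
    fix t assume t: "t \<in> {a..b}" "c (\<alpha> * t + \<beta>) \<in> U"
    have 1: "(?h has_vector_derivative \<alpha>) (at t within ?J)"
      by (auto intro!: derivative_eq_intros)
    have 2: "((\<phi> \<circ> c) has_vector_derivative v (?h t)) (at (?h t) within ?h ` ?J)"
      by (rule has_vector_derivative_within_subset[OF v(2) im]) (use t aff in auto)
    show "((\<phi> \<circ> (\<lambda>t. c (\<alpha> * t + \<beta>))) has_vector_derivative \<alpha> *\<^sub>R v (?h t)) (at t within ?J)"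
      using vector_diff_chain_within[OF 1 2] by (simp add: o_def)
  qed
qed

lemma piecewise_C1_on_subinterval:
  assumes "piecewise_C1_on charts a b c" "a \<le> a'" "b' \<le> b"
  shows "piecewise_C1_on charts a' b' c"
  using assms unfolding piecewise_C1_on_def
  by (meson atLeastatMost_subset_iff continuous_on_subset order_trans)

lemma piecewise_C1_on_cong:
  assumes "piecewise_C1_on charts a b c" and eq: "\<And>t. t \<in> {a..b} \<Longrightarrow> c' t = c t"
  shows "piecewise_C1_on charts a b c'"
proof -
  obtain T where T: "finite T" "\<And>a' b'. a \<le> a' \<Longrightarrow> a' < b' \<Longrightarrow> b' \<le> b \<Longrightarrow>
      {a'<..<b'} \<inter> T = {} \<Longrightarrow> C1_curve_on charts a' b' c"
    using assms(1) unfolding piecewise_C1_on_def by blast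
  have "continuous_on {a..b} c'"
    using assms(1) eq unfolding piecewise_C1_on_def by (metis (no_types, lifting) continuous_on_cong)
  moreover have "C1_curve_on charts a' b' c'"
    if "a \<le> a'" "a' < b'" "b' \<le> b" "{a'<..<b'} \<inter> T = {}" for a' b'
    by (rule C1_curve_on_cong[OF T(2)[OF that]]) (use that eq in auto)
  ultimately show ?thesis by (intro piecewise_C1_onI[OF T(1)])
qed

lemma piecewise_C1_on_affine:
  assumes c: "piecewise_C1_on charts A B c" and "\<alpha> \<noteq> 0"
    and aff: "\<And>t. t \<in> {a..b} \<Longrightarrow> \<alpha> * t + \<beta> \<in> {A..B}"
  shows "piecewise_C1_on charts a b (\<lambda>t. c (\<alpha> * t + \<beta>))"
proof -
  obtain T where T: "finite T" "\<And>a' b'. A \<le> a' \<Longrightarrow> a' < b' \<Longrightarrow> b' \<le> B \<Longrightarrow>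
      {a'<..<b'} \<inter> T = {} \<Longrightarrow> C1_curve_on charts a' b' c"
    using assms(1) unfolding piecewise_C1_on_def by blast
  have "continuous_on {a..b} (\<lambda>t. c (\<alpha> * t + \<beta>))"
    by (rule continuous_on_compose2[where g=c and t="{A..B}"])
       (use c aff in \<open>auto simp: piecewise_C1_on_def intro!: continuous_intros\<close>)
  moreover have "C1_curve_on charts a' b' (\<lambda>t. c (\<alpha> * t + \<beta>))"
    if "a \<le> a'" "a' < b'" "b' \<le> b" "{a'<..<b'} \<inter> (\<lambda>s. (s - \<beta>) / \<alpha>) ` T = {}" for a' b'
  proof -
    define l where "l = min (\<alpha> * a' + \<beta>) (\<alpha> * b' + \<beta>)"
    define u where "u = max (\<alpha> * a' + \<beta>) (\<alpha> * b' + \<beta>)"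
    have in1: "\<alpha> * a' + \<beta> \<in> {A..B}" "\<alpha> * b' + \<beta> \<in> {A..B}" using aff that by auto
    have "\<alpha> * a' \<noteq> \<alpha> * b'" using \<open>\<alpha> \<noteq> 0\<close> that by simp
    moreover have "min x y < max x y" if "x \<noteq> y" for x y :: real using that by linarith
    ultimately have "l < u" unfolding l_def u_def by simp
    moreover have "A \<le> l" "u \<le> B" using in1 unfolding l_def u_def by simp_all
    ultimately have lu: "A \<le> l" "l < u" "u \<le> B" by simp_all
    have "{l<..<u} \<inter> T = {}"
    proof (rule ccontr)
      assume "{l<..<u} \<inter> T \<noteq> {}"
      then obtain s where s: "s \<in> T" "l < s" "s < u" by auto
      have "a' < (s - \<beta>) / \<alpha> \<and> (s - \<beta>) / \<alpha> < b'"
      proof (cases "\<alpha> > 0")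
        case True
        then have "\<alpha> * a' < \<alpha> * b'" using that by simp
        then show ?thesis using s True unfolding l_def u_def
          by (auto simp: field_simps min_def max_def split: if_splits)
      next
        case False
        then have "\<alpha> < 0" using \<open>\<alpha> \<noteq> 0\<close> by simp
        then have "\<alpha> * b' < \<alpha> * a'" using that by simp
        then show ?thesis using s \<open>\<alpha> < 0\<close> unfolding l_def u_def
          by (auto simp: field_simps min_def max_def split: if_splits)
      qed
      then show False using s(1) that(4) by auto
    qed
    then have C: "C1_curve_on charts l u c" using T(2) lu by blast
    have aff': "\<alpha> * t + \<beta> \<in> {l..u}" if t: "t \<in> {a'..b'}" for t
    proof (cases "\<alpha> > 0")
      case True
      then have "\<alpha> * a' \<le> \<alpha> * t" "\<alpha> * t \<le> \<alpha> * b'" using t by auto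
      then show ?thesis unfolding l_def u_def by auto
    next
      case False
      then have "\<alpha> * b' \<le> \<alpha> * t" "\<alpha> * t \<le> \<alpha> * a'" using t by (auto intro!: mult_left_mono_neg)
      then show ?thesis unfolding l_def u_def by auto
    qed
    show ?thesis by (rule C1_curve_on_affine[OF C aff'])
  qed
  ultimately show ?thesis
    by (intro piecewise_C1_onI[OF finite_imageI[OF T(1), of "\<lambda>s. (s - \<beta>) / \<alpha>"]])
qed

lemma piecewise_C1_on_combine:
  assumes 1: "piecewise_C1_on charts a m c" and 2: "piecewise_C1_on charts m b c"
    and m: "a \<le> m" "m \<le> b"
  shows "piecewise_C1_on charts a b c"
proof -
  obtain T1 where T1: "finite T1" "\<And>a' b'. a \<le> a' \<Longrightarrow> a' < b' \<Longrightarrow> b' \<le> m \<Longrightarrow>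
      {a'<..<b'} \<inter> T1 = {} \<Longrightarrow> C1_curve_on charts a' b' c"
    using 1 unfolding piecewise_C1_on_def by blast
  obtain T2 where T2: "finite T2" "\<And>a' b'. m \<le> a' \<Longrightarrow> a' < b' \<Longrightarrow> b' \<le> b \<Longrightarrow>
      {a'<..<b'} \<inter> T2 = {} \<Longrightarrow> C1_curve_on charts a' b' c"
    using 2 unfolding piecewise_C1_on_def by blast
  have ab: "{a..b} = {a..m} \<union> {m..b}" using m by auto
  have "continuous_on {a..b} c"
    unfolding ab using 1 2 unfolding piecewise_C1_on_def by (intro continuous_on_closed_Un) auto
  moreover have "C1_curve_on charts a' b' c"
    if "a \<le> a'" "a' < b'" "b' \<le> b" "{a'<..<b'} \<inter> (T1 \<union> T2 \<union> {m}) = {}" for a' b'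
  proof -
    have "b' \<le> m \<or> m \<le> a'" using that by force
    then show ?thesis using T1(2)[of a' b'] T2(2)[of a' b'] that by auto
  qed
  moreover have "finite (T1 \<union> T2 \<union> {m})" using T1(1) T2(1) by simp
  ultimately show ?thesis
    by (intro piecewise_C1_onI[of "T1 \<union> T2 \<union> {m}"])
qed

text \<open>
  A parameter that is not a break point has an interval around it without break points.
\<close>

lemma piecewise_C1_on_regular:
  assumes "piecewise_C1_on charts a b c"
  obtains T where "finite T" "\<And>t. t \<in> {a<..<b} \<Longrightarrow> t \<notin> T \<Longrightarrow>
    \<exists>a' b'. a \<le> a' \<and> a' < t \<and> t < b' \<and> b' \<le> b \<and> C1_curve_on charts a' b' c"
proof -
  obtain T where T: "finite T" "\<And>a' b'. a \<le> a' \<Longrightarrow> a' < b' \<Longrightarrow> b' \<le> b \<Longrightarrow>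
      {a'<..<b'} \<inter> T = {} \<Longrightarrow> C1_curve_on charts a' b' c"
    using assms unfolding piecewise_C1_on_def by blast
  have "\<exists>a' b'. a \<le> a' \<and> a' < t \<and> t < b' \<and> b' \<le> b \<and> C1_curve_on charts a' b' c"
    if t: "t \<in> {a<..<b}" "t \<notin> T" for t
  proof -
    have "open ({a<..<b} - T)" using T(1) by (intro open_Diff finite_imp_closed) auto
    then obtain e where e: "e > 0" "ball t e \<subseteq> {a<..<b} - T"
      using t by (meson Diff_iff open_contains_ball)
    have sub: "{t - e<..<t + e} \<subseteq> {a<..<b} - T" using e by (simp add: ball_eq_greaterThanLessThan)
    define e' where "e' = e / 2"
    have "{t - e'..t + e'} \<subseteq> {t - e<..<t + e}" "e' > 0" unfolding e'_def using e(1) by auto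
    with sub have "{t - e'..t + e'} \<subseteq> {a<..<b} - T" by blast
    moreover have "t - e' \<in> {t - e'..t + e'}" "t + e' \<in> {t - e'..t + e'}" using \<open>e' > 0\<close> by auto
    ultimately have "t - e' \<in> {a<..<b}" "t + e' \<in> {a<..<b}" by blast+
    moreover note \<open>{t - e'..t + e'} \<subseteq> {a<..<b} - T\<close>
    moreover from this have "{t - e'<..<t + e'} \<inter> T = {}"
      using greaterThanLessThan_subseteq_atLeastAtMost_iff[of "t - e'" "t + e'" "t - e'" "t + e'"] by blast
    ultimately have "C1_curve_on charts (t - e') (t + e') c"
      using \<open>e' > 0\<close> by (intro T(2)) auto
    then show ?thesis
      using \<open>e' > 0\<close> \<open>t - e' \<in> {a<..<b}\<close> \<open>t + e' \<in> {a<..<b}\<close>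
      by (intro exI[of _ "t - e'"] exI[of _ "t + e'"]) auto
  qed
  with T(1) that show ?thesis by blast
qed

lemma C1_curve_on_interior_derivative:
  assumes c: "C1_curve_on charts a b c" and U: "(U, \<phi>) \<in> charts" "open U"
    and t: "t \<in> {a<..<b}" "c t \<in> U"
  shows "((\<phi> \<circ> c) has_vector_derivative vector_derivative (\<phi> \<circ> c) (at t)) (at t)"
proof -
  have "continuous_on {a<..<b} c"
    using c unfolding C1_curve_on_def by (meson continuous_on_subset greaterThanLessThan_subseteq_atLeastAtMost_iff order_refl)
  then have "open ({a<..<b} \<inter> c -` U)" by (rule continuous_open_preimage) (use U in auto)
  moreover have "t \<in> {a<..<b} \<inter> c -` U" using t by auto
  moreover have "{a<..<b} \<inter> c -` U \<subseteq> {t \<in> {a..b}. c t \<in> U}" by auto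
  ultimately have "t \<in> interior {t \<in> {a..b}. c t \<in> U}" by (meson interiorI)
  then have at: "at t within {t \<in> {a..b}. c t \<in> U} = at t" by (rule at_within_interior)
  obtain v where v: "continuous_on {t \<in> {a..b}. c t \<in> U} v"
    "\<And>t. t \<in> {a..b} \<Longrightarrow> c t \<in> U \<Longrightarrow>
      ((\<phi> \<circ> c) has_vector_derivative v t) (at t within {t \<in> {a..b}. c t \<in> U})"
    by (rule C1_curve_onE[OF c U(1)]) blast
  have "((\<phi> \<circ> c) has_vector_derivative v t) (at t within {t \<in> {a..b}. c t \<in> U})"
    using t by (intro v(2)) auto
  then show ?thesis unfolding at by (metis vector_derivative_works differentiableI_vector)
qed

lemma bilinear_expand:
  fixes B :: "'e::euclidean_space \<Rightarrow> 'e \<Rightarrow> real"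
  assumes "bilinear B"
  shows "B u v = (\<Sum>i\<in>Basis. \<Sum>j\<in>Basis. (u \<bullet> i) * (v \<bullet> j) * B i j)"
proof -
  have "B u v = B (\<Sum>i\<in>Basis. (u \<bullet> i) *\<^sub>R i) (\<Sum>j\<in>Basis. (v \<bullet> j) *\<^sub>R j)"
    by (simp add: euclidean_representation)
  also have "\<dots> = (\<Sum>(i, j)\<in>Basis \<times> Basis. B ((u \<bullet> i) *\<^sub>R i) ((v \<bullet> j) *\<^sub>R j))"
    by (rule bilinear_sum[OF assms])
  also have "\<dots> = (\<Sum>i\<in>Basis. \<Sum>j\<in>Basis. (u \<bullet> i) * (v \<bullet> j) * B i j)"
    by (simp add: sum.cartesian_product[symmetric] bilinear_lmul[OF assms] bilinear_rmul[OF assms] mult_ac)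
  finally show ?thesis .
qed

context riemannian_manifold
begin

abbreviation "spd \<equiv> speed charts g"

lemma inv_chart: "(U, \<phi>) \<in> charts \<Longrightarrow> p \<in> U \<Longrightarrow> inv_into U \<phi> (\<phi> p) = p"
  using homeo unfolding homeomorphism_def by blast

lemma continuous_on_chart: "(U, \<phi>) \<in> charts \<Longrightarrow> continuous_on U \<phi>"
  using homeo unfolding homeomorphism_def by blast

lemma continuous_on_inv_chart: "(U, \<phi>) \<in> charts \<Longrightarrow> continuous_on (\<phi> ` U) (inv_into U \<phi>)"
  using homeo unfolding homeomorphism_def by blast

lemma continuous_on_metric:
  fixes c :: "'x::topological_space \<Rightarrow> 'a"
  assumes U: "(U, \<phi>) \<in> charts" and c: "continuous_on X c" "c ` X \<subseteq> U"
    and u: "continuous_on X u" and v: "continuous_on X v"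
  shows "continuous_on X (\<lambda>t. g (U, \<phi>) (c t) (u t) (v t))"
proof -
  have coeff: "continuous_on X (\<lambda>t. g (U, \<phi>) (c t) i j)" for i j
  proof -
    have 1: "continuous_on X (\<lambda>t. \<phi> (c t))"
      by (rule continuous_on_compose2[OF continuous_on_chart[OF U] c])
    have 2: "continuous_on (\<phi> ` U) (\<lambda>x. g (U, \<phi>) (inv_into U \<phi> x) i j)"
      by (rule smooth_on_imp_continuous_on[OF smooth[OF U]])
    have "continuous_on X (\<lambda>t. g (U, \<phi>) (inv_into U \<phi> (\<phi> (c t))) i j)"
      by (rule continuous_on_compose2[OF 2 1]) (use c(2) in auto)
    then show ?thesis
      by (rule continuous_on_eq) (use c(2) inv_chart[OF U] in auto)
  qed
  have "continuous_on X (\<lambda>t. \<Sum>i\<in>Basis. \<Sum>j\<in>Basis. (u t \<bullet> i) * (v t \<bullet> j) * g (U, \<phi>) (c t) i j)"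
    by (intro continuous_intros u v coeff)
  then show ?thesis
    by (rule continuous_on_eq) (use c(2) in \<open>auto intro!: bilinear_expand[symmetric] bilinear[OF U]\<close>)
qed

lemma metric_nonneg: "(U, \<phi>) \<in> charts \<Longrightarrow> p \<in> U \<Longrightarrow> 0 \<le> g (U, \<phi>) p u u"
  using positive[of U \<phi> p u] bilinear_lzero[OF bilinear[of U \<phi> p], of 0]
  by (cases "u = 0") simp_all

lemma chart_at:
  obtains U \<phi> where "(U, \<phi>) \<in> charts" "p \<in> U" "(SOME k. k \<in> charts \<and> p \<in> fst k) = (U, \<phi>)"
proof -
  have "\<exists>k. k \<in> charts \<and> p \<in> fst k" using covers[of p] by force
  then have "(SOME k. k \<in> charts \<and> p \<in> fst k) \<in> charts \<and> p \<in> fst (SOME k. k \<in> charts \<and> p \<in> fst k)"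
    by (rule someI_ex)
  then show ?thesis
    by (cases "SOME k. k \<in> charts \<and> p \<in> fst k") (use that in auto)
qed

lemma speed_nonneg: "0 \<le> spd c t"
proof -
  obtain U \<phi> where "(U, \<phi>) \<in> charts" "c t \<in> U" "(SOME k. k \<in> charts \<and> c t \<in> fst k) = (U, \<phi>)"
    by (rule chart_at)
  then show ?thesis by (simp add: speed_def Let_def metric_nonneg)
qed

text \<open>
  The chart in the definition of the speed is an arbitrary choice; by the chain rule and the
  transformation law of the metric tensor any other chart gives the same value at parameters where
  the curve is differentiable.
\<close>

lemma speed_eq:
  assumes c: "C1_curve_on charts a b c" and t: "t \<in> {a<..<b}"
    and U: "(U, \<phi>) \<in> charts" "c t \<in> U"
  shows "spd c t = sqrt (g (U, \<phi>) (c t) (vector_derivative (\<phi> \<circ> c) (at t)) (vector_derivative (\<phi> \<circ> c) (at t)))"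
proof -
  obtain V \<psi> where V: "(V, \<psi>) \<in> charts" "c t \<in> V" "(SOME k. k \<in> charts \<and> c t \<in> fst k) = (V, \<psi>)"
    by (rule chart_at)
  let ?w = "vector_derivative (\<phi> \<circ> c) (at t)" and ?F = "\<psi> \<circ> inv_into U \<phi>"
  define D where "D = frechet_derivative ?F (at (\<phi> (c t)))"
  have w: "((\<phi> \<circ> c) has_vector_derivative ?w) (at t)"
    by (rule C1_curve_on_interior_derivative[OF c U(1) open_domain[OF U(1)] t U(2)])
  have "?F differentiable (at (\<phi> (c t)))"
    by (rule smooth_on_imp_differentiable[OF compatible[OF U(1) V(1)]]) (use U V in auto)
  then have "(?F has_derivative D) (at (\<phi> (c t)))"
    unfolding D_def by (simp add: frechet_derivative_works)
  then have "(?F \<circ> (\<phi> \<circ> c) has_derivative D \<circ> (\<lambda>s. s *\<^sub>R ?w)) (at t)"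
    using w unfolding has_vector_derivative_def by (intro diff_chain_at) auto
  moreover have "linear D"
    using \<open>(?F has_derivative D) (at (\<phi> (c t)))\<close> by (rule has_derivative_linear)
  then have "D \<circ> (\<lambda>s. s *\<^sub>R ?w) = (\<lambda>s. s *\<^sub>R D ?w)" by (auto simp: linear_scale)
  ultimately have der: "(?F \<circ> (\<phi> \<circ> c) has_vector_derivative D ?w) (at t)"
    unfolding has_vector_derivative_def by simp
  have "continuous_on {a<..<b} c"
    using c unfolding C1_curve_on_def by (meson continuous_on_subset greaterThanLessThan_subseteq_atLeastAtMost_iff order_refl)
  then have "open ({a<..<b} \<inter> c -` U)"
    by (rule continuous_open_preimage) (use open_domain[OF U(1)] in auto)
  then have "(\<psi> \<circ> c has_vector_derivative D ?w) (at t)"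
    by (rule has_vector_derivative_transform_within_open[OF der])
       (use t U inv_chart[OF U(1)] in auto)
  then have "vector_derivative (\<psi> \<circ> c) (at t) = D ?w" by (rule vector_derivative_at)
  then have "spd c t = sqrt (g (V, \<psi>) (c t) (D ?w) (D ?w))"
    unfolding speed_def V(3) by (simp add: Let_def)
  also have "g (V, \<psi>) (c t) (D ?w) (D ?w) = g (U, \<phi>) (c t) ?w ?w"
    using transform[OF U(1) V(1) _ D_def] U V by simp
  finally show ?thesis .
qed

text \<open>
  Locally the curve stays in one chart, where the speed agrees, except at \<open>a\<close> and \<open>b\<close>, with a
  continuous function built from the one-sided derivatives.
\<close>

lemma speed_integrable_C1:
  assumes c: "C1_curve_on charts a b c"
  shows "spd c integrable_on {a..b}"
proof -
  have cc: "continuous_on {a..b} c" using c unfolding C1_curve_on_def by blast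
  have "spd c integrable_on cbox a b"
  proof (rule integrable_on_little_subintervals, intro ballI)
    fix x assume "x \<in> cbox a b"
    then have x: "x \<in> {a..b}" by simp
    obtain U \<phi> where U: "(U, \<phi>) \<in> charts" "c x \<in> U" by (rule chart_at)
    obtain A where A: "open A" "A \<inter> {a..b} = c -` U \<inter> {a..b}"
      using cc open_domain[OF U(1)] continuous_on_open_invariant[of "{a..b}" c] by blast
    then have "x \<in> A" using x U by blast
    then obtain d where d: "d > 0" "ball x d \<subseteq> A" using A(1) openE by blast
    obtain v where v: "continuous_on {t \<in> {a..b}. c t \<in> U} v"
      "\<And>t. t \<in> {a..b} \<Longrightarrow> c t \<in> U \<Longrightarrow>
        ((\<phi> \<circ> c) has_vector_derivative v t) (at t within {t \<in> {a..b}. c t \<in> U})"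
      by (rule C1_curve_onE[OF c U(1)]) blast
    show "\<exists>d>0. \<forall>u w. x \<in> cbox u w \<and> cbox u w \<subseteq> ball x d \<and> cbox u w \<subseteq> cbox a b \<longrightarrow>
        spd c integrable_on cbox u w"
    proof (intro exI conjI allI impI, rule d(1))
      fix u w assume uw: "x \<in> cbox u w \<and> cbox u w \<subseteq> ball x d \<and> cbox u w \<subseteq> cbox a b"
      then have "{u..w} \<subseteq> A \<inter> {a..b}" using d(2) by auto
      then have sub: "{u..w} \<subseteq> {t \<in> {a..b}. c t \<in> U}" unfolding A(2) by auto
      then have "continuous_on {u..w} (\<lambda>t. sqrt (g (U, \<phi>) (c t) (v t) (v t)))"
        by (intro continuous_intros continuous_on_metric[OF U(1)] continuous_on_subset[OF v(1)]
            continuous_on_subset[OF cc]) auto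
      then have int: "(\<lambda>t. sqrt (g (U, \<phi>) (c t) (v t) (v t))) integrable_on {u..w}"
        by (rule integrable_continuous_real)
      have "spd c integrable_on {u..w}"
      proof (rule integrable_spike_finite[OF _ _ int])
        show "finite {a, b}" by simp
        fix t assume "t \<in> {u..w} - {a, b}"
        then have t: "t \<in> {a<..<b}" "c t \<in> U" "t \<in> {a..b}" using sub by force+
        have "((\<phi> \<circ> c) has_vector_derivative v t) (at t within {t \<in> {a..b}. c t \<in> U})"
          using v(2) t by blast
        moreover have "((\<phi> \<circ> c) has_vector_derivative vector_derivative (\<phi> \<circ> c) (at t))
            (at t within {t \<in> {a..b}. c t \<in> U})"
          by (rule has_vector_derivative_at_within)
             (rule C1_curve_on_interior_derivative[OF c U(1) open_domain[OF U(1)] t(1,2)])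
        moreover have "at t within {t \<in> {a..b}. c t \<in> U} \<noteq> bot"
        proof -
          have "open ({a<..<b} \<inter> c -` U)"
            by (rule continuous_open_preimage)
               (use open_domain[OF U(1)] cc in \<open>auto intro: continuous_on_subset\<close>)
          then have int: "t \<in> interior {t \<in> {a..b}. c t \<in> U}"
            using t by (intro interiorI[of "{a<..<b} \<inter> c -` U"]) auto
          show ?thesis unfolding at_within_interior[OF int] by (rule at_neq_bot)
        qed
        ultimately have "vector_derivative (\<phi> \<circ> c) (at t) = v t"
          using vector_derivative_unique_within by blast
        then show "spd c t = sqrt (g (U, \<phi>) (c t) (v t) (v t))"
          using speed_eq[OF c t(1) U(1) t(2)] by simp
      qed
      then show "spd c integrable_on cbox u w" by simp
    qed
  qed
  then show ?thesis by simp
qed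

text \<open>
  A short interval contains at most one break point, at which it may be divided.
\<close>

lemma speed_integrable:
  assumes c: "piecewise_C1_on charts a b c"
  shows "spd c integrable_on {a..b}"
proof -
  obtain T where T: "finite T" "\<And>a' b'. a \<le> a' \<Longrightarrow> a' < b' \<Longrightarrow> b' \<le> b \<Longrightarrow>
      {a'<..<b'} \<inter> T = {} \<Longrightarrow> C1_curve_on charts a' b' c"
    using c unfolding piecewise_C1_on_def by blast
  have piece: "spd c integrable_on {u..w}"
    if "a \<le> u" "w \<le> b" "{u<..<w} \<inter> T = {}" for u w
  proof (cases "u < w")
    case True
    show ?thesis by (rule speed_integrable_C1[OF T(2)[OF that(1) True that(2,3)]])
  next
    case False
    then show ?thesis using integrable_on_refl[of "spd c" w] by (cases "u = w") (simp_all add: integrable_on_empty)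
  qed
  have "spd c integrable_on cbox a b"
  proof (rule integrable_on_little_subintervals, intro ballI)
    fix x assume x: "x \<in> cbox a b"
    have "open (- (T - {x}))" using T(1) by (intro open_Compl finite_imp_closed) auto
    then obtain d where d: "d > 0" "ball x d \<subseteq> - (T - {x})" by (meson ComplI Diff_iff insertI1 openE)
    show "\<exists>d>0. \<forall>u w. x \<in> cbox u w \<and> cbox u w \<subseteq> ball x d \<and> cbox u w \<subseteq> cbox a b \<longrightarrow>
        spd c integrable_on cbox u w"
    proof (intro exI conjI allI impI, rule d(1))
      fix u w assume "x \<in> cbox u w \<and> cbox u w \<subseteq> ball x d \<and> cbox u w \<subseteq> cbox a b"
      then have uw: "u \<le> x" "x \<le> w" "{u..w} \<subseteq> ball x d" "a \<le> u" "w \<le> b" by auto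
      have "t \<notin> T" if "t \<in> {u..w}" "t \<noteq> x" for t
        using subsetD[OF d(2), of t] subsetD[OF uw(3) that(1)] that(2) by blast
      then have "{u<..<x} \<inter> T = {}" "{x<..<w} \<inter> T = {}" using uw by force+
      then have "spd c integrable_on {u..x}" "spd c integrable_on {x..w}"
        using uw by (auto intro!: piece)
      then show "spd c integrable_on cbox u w"
        using Henstock_Kurzweil_Integration.integrable_combine[OF uw(1,2)] by simp
    qed
  qed
  then show ?thesis by simp
qed

end

context riemannian_manifold
begin

lemma speed_cong:
  assumes eq: "\<And>s. s \<in> {a<..<b} \<Longrightarrow> c' s = c s" and t: "t \<in> {a<..<b}"
  shows "spd c' t = spd c t"
proof -
  have "vector_derivative (\<phi> \<circ> c') (at t) = vector_derivative (\<phi> \<circ> c) (at t)" for \<phi> :: "'a \<Rightarrow> 'e"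
  proof (rule vector_derivative_cong_eq)
    have "eventually (\<lambda>x. x \<in> {a<..<b}) (nhds t)" using t by (intro eventually_nhds_in_open) auto
    then show "eventually (\<lambda>x. x \<in> UNIV \<longrightarrow> (\<phi> \<circ> c') x = (\<phi> \<circ> c) x) (nhds t)"
      by (rule eventually_mono) (use eq in auto)
  qed auto
  moreover have "c' t = c t" using eq t by blast
  ultimately show ?thesis unfolding speed_def by simp
qed

lemma integral_speed_cong:
  assumes "\<And>s. s \<in> {a<..<b} \<Longrightarrow> c' s = c s"
  shows "integral {a..b} (spd c') = integral {a..b} (spd c)"
proof (rule integral_spike[of "{a, b}"])
  show "negligible {a, b}" by (simp add: negligible_finite)
  fix t assume "t \<in> {a..b} - {a, b}"
  then show "spd c t = spd c' t" using speed_cong[of a b c' c t] assms by auto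
qed

lemma speed_affine:
  assumes c: "C1_curve_on charts l u c" and t: "\<alpha> * t + \<beta> \<in> {l<..<u}"
  shows "spd (\<lambda>t. c (\<alpha> * t + \<beta>)) t = \<bar>\<alpha>\<bar> * spd c (\<alpha> * t + \<beta>)"
proof -
  obtain U \<phi> where U: "(U, \<phi>) \<in> charts" "c (\<alpha> * t + \<beta>) \<in> U"
    "(SOME k. k \<in> charts \<and> c (\<alpha> * t + \<beta>) \<in> fst k) = (U, \<phi>)" by (rule chart_at)
  let ?w = "vector_derivative (\<phi> \<circ> c) (at (\<alpha> * t + \<beta>))"
  have "((\<phi> \<circ> c) has_vector_derivative ?w) (at (\<alpha> * t + \<beta>))"
    by (rule C1_curve_on_interior_derivative[OF c U(1) open_domain[OF U(1)] t U(2)])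
  moreover have "((\<lambda>t. \<alpha> * t + \<beta>) has_vector_derivative \<alpha>) (at t)"
    by (auto intro!: derivative_eq_intros)
  ultimately have "((\<phi> \<circ> c) \<circ> (\<lambda>t. \<alpha> * t + \<beta>) has_vector_derivative \<alpha> *\<^sub>R ?w) (at t)"
    by (intro vector_diff_chain_at)
  then have v: "vector_derivative (\<phi> \<circ> (\<lambda>t. c (\<alpha> * t + \<beta>))) (at t) = \<alpha> *\<^sub>R ?w"
    by (intro vector_derivative_at) (simp add: o_def)
  have "spd (\<lambda>t. c (\<alpha> * t + \<beta>)) t =
      sqrt (g (U, \<phi>) (c (\<alpha> * t + \<beta>)) (\<alpha> *\<^sub>R ?w) (\<alpha> *\<^sub>R ?w))"
    unfolding speed_def U(3) Let_def snd_conv v ..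
  also have "\<dots> = sqrt (\<alpha>\<^sup>2 * g (U, \<phi>) (c (\<alpha> * t + \<beta>)) ?w ?w)"
    using bilinear[OF U(1,2)] by (simp add: bilinear_lmul bilinear_rmul power2_eq_square mult_ac)
  also have "\<dots> = \<bar>\<alpha>\<bar> * spd c (\<alpha> * t + \<beta>)"
    unfolding speed_def U(3) Let_def snd_conv by (simp add: real_sqrt_mult)
  finally show ?thesis .
qed

lemma has_integral_speed_affine:
  assumes c: "piecewise_C1_on charts l u c" and \<alpha>: "\<alpha> \<noteq> 0"
  shows "(spd (\<lambda>t. c (\<alpha> * t + \<beta>)) has_integral integral {l..u} (spd c))
    ((\<lambda>s. (s - \<beta>) / \<alpha>) ` {l..u})"
proof -
  have "(spd c has_integral integral {l..u} (spd c)) (cbox l u)"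
    using speed_integrable[OF c] by (simp add: integrable_integral)
  from has_integral_affinity[OF this \<alpha>, of \<beta>]
  have "((\<lambda>t. spd c (\<alpha> * t + \<beta>)) has_integral (1 / \<bar>\<alpha>\<bar>) * integral {l..u} (spd c))
      ((\<lambda>s. (s - \<beta>) / \<alpha>) ` {l..u})" by (simp add: diff_divide_distrib)
  from has_integral_mult_right[OF this, of "\<bar>\<alpha>\<bar>"]
  have int: "((\<lambda>t. \<bar>\<alpha>\<bar> * spd c (\<alpha> * t + \<beta>)) has_integral integral {l..u} (spd c))
      ((\<lambda>s. (s - \<beta>) / \<alpha>) ` {l..u})" using \<alpha> by simp
  obtain T where T: "finite T" "\<And>t. t \<in> {l<..<u} \<Longrightarrow> t \<notin> T \<Longrightarrow>
    \<exists>a' b'. l \<le> a' \<and> a' < t \<and> t < b' \<and> b' \<le> u \<and> C1_curve_on charts a' b' c"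
    by (rule piecewise_C1_on_regular[OF c]) blast
  show ?thesis
  proof (rule has_integral_spike_finite[OF _ _ int])
    show "finite ((\<lambda>s. (s - \<beta>) / \<alpha>) ` (T \<union> {l, u}))" using T(1) by simp
    fix t assume "t \<in> (\<lambda>s. (s - \<beta>) / \<alpha>) ` {l..u} - (\<lambda>s. (s - \<beta>) / \<alpha>) ` (T \<union> {l, u})"
    then obtain s where s: "t = (s - \<beta>) / \<alpha>" "s \<in> {l..u}" "s \<notin> T \<union> {l, u}" by blast
    then have st: "\<alpha> * t + \<beta> = s" "s \<in> {l<..<u}" using \<alpha> by auto
    then obtain a' b' where "a' < s" "s < b'" "C1_curve_on charts a' b' c" using T(2) s by blast
    then show "spd (\<lambda>t. c (\<alpha> * t + \<beta>)) t = \<bar>\<alpha>\<bar> * spd c (\<alpha> * t + \<beta>)"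
      using st by (intro speed_affine[of a' b']) auto
  qed
qed

abbreviation "rd \<equiv> riemannian_dist charts g"

lemma integral_speed_nonneg: "piecewise_C1_on charts a b c \<Longrightarrow> 0 \<le> integral {a..b} (spd c)"
  by (rule integral_nonneg[OF speed_integrable]) (auto simp: speed_nonneg)

text \<open>
  Holds for the lengths over which the Riemannian distance from \<open>x\<close> to \<open>y\<close> is the infimum.
\<close>

definition curve_between :: "'a \<Rightarrow> 'a \<Rightarrow> real \<Rightarrow> bool" where
  "curve_between x y L \<longleftrightarrow>
     (\<exists>c. piecewise_C1_on charts 0 1 c \<and> c 0 = x \<and> c 1 = y \<and> integral {0..1} (spd c) = L)"

lemma rd_eq: "rd x y = Inf {L. curve_between x y L}"
proof -
  have "curve_length charts g ` {c. piecewise_C1_path charts c \<and> pathstart c = x \<and> pathfinish c = y} =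
      {L. curve_between x y L}"
    unfolding curve_between_def curve_length_def piecewise_C1_path_iff pathstart_def pathfinish_def
    by auto
  then show ?thesis unfolding riemannian_dist_def by simp
qed

lemma curve_between_nonneg: "curve_between x y L \<Longrightarrow> 0 \<le> L"
  unfolding curve_between_def using integral_speed_nonneg by blast

lemma rd_le_curve: "curve_between x y L \<Longrightarrow> rd x y \<le> L"
  unfolding rd_eq by (rule cInf_lower) (auto intro!: bdd_belowI[of _ 0] curve_between_nonneg)

lemma curve_betweenI:
  assumes c: "piecewise_C1_on charts a b c" and ab: "a < b"
  shows "curve_between (c a) (c b) (integral {a..b} (spd c))"
proof -
  have aff: "(b - a) * t + a \<in> {a..b}" if "t \<in> {0..1}" for t
  proof -
    have "0 \<le> (b - a) * t" "(b - a) * t \<le> b - a" using that ab by (simp_all add: mult_left_le)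
    then show ?thesis unfolding atLeastAtMost_iff by linarith
  qed
  have im: "(\<lambda>s. (s - a) / (b - a)) ` {a..b} = {0..1}"
  proof (intro equalityI subsetI)
    fix t :: real assume t: "t \<in> {0..1}"
    have "t = (((b - a) * t + a) - a) / (b - a)" using ab by simp
    moreover have "(b - a) * t + a \<in> {a..b}" using aff t by blast
    ultimately show "t \<in> (\<lambda>s. (s - a) / (b - a)) ` {a..b}" by (rule image_eqI)
  qed (use ab in auto)
  have "piecewise_C1_on charts 0 1 (\<lambda>t. c ((b - a) * t + a))"
    by (rule piecewise_C1_on_affine[OF c _ aff]) (use ab in auto)
  moreover have "integral {0..1} (spd (\<lambda>t. c ((b - a) * t + a))) = integral {a..b} (spd c)"
    using has_integral_speed_affine[OF c, of "b - a" a] ab unfolding im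
    by (intro integral_unique) simp
  ultimately show ?thesis
    unfolding curve_between_def by (intro exI[of _ "\<lambda>t. c ((b - a) * t + a)"]) simp
qed

lemma curve_between_self: "curve_between x x 0"
proof -
  have C: "C1_curve_on charts a b (\<lambda>_. x)" for a b
    by (rule C1_curve_onI) (auto intro!: exI[of _ "\<lambda>_. 0"] simp: o_def)
  have "piecewise_C1_on charts 0 1 (\<lambda>_. x)"
    by (rule piecewise_C1_onI[of "{}"]) (auto intro: C)
  moreover have "spd (\<lambda>_. x) = (\<lambda>_. 0)"
  proof
    fix t
    obtain U \<phi> where U: "(U, \<phi>) \<in> charts" "x \<in> U"
      "(SOME k. k \<in> charts \<and> x \<in> fst k) = (U, \<phi>)" by (rule chart_at)
    show "spd (\<lambda>_. x) t = 0"
      unfolding speed_def U(3) by (simp add: Let_def o_def bilinear_lzero[OF bilinear[OF U(1,2)]])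
  qed
  ultimately show ?thesis unfolding curve_between_def by (intro exI[of _ "\<lambda>_. x"]) simp
qed

lemma curve_between_rev:
  assumes "curve_between x y L"
  shows "curve_between y x L"
proof -
  obtain c where c: "piecewise_C1_on charts 0 1 c" "c 0 = x" "c 1 = y" "integral {0..1} (spd c) = L"
    using assms unfolding curve_between_def by blast
  have "piecewise_C1_on charts 0 1 (\<lambda>t. c (-1 * t + 1))"
    by (rule piecewise_C1_on_affine[OF c(1)]) auto
  moreover have "(\<lambda>s. (s - 1) / (-1)) ` {0..1::real} = {0..1}"
    by (auto simp: image_iff intro!: bexI[of _ "1 - _"])
  then have "integral {0..1} (spd (\<lambda>t. c (-1 * t + 1))) = L"
    using has_integral_speed_affine[OF c(1), of "-1" 1] c(4) by (intro integral_unique) simp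
  ultimately show ?thesis
    unfolding curve_between_def using c by (intro exI[of _ "\<lambda>t. c (-1 * t + 1)"]) simp
qed

text \<open>
  The second curve is translated to \<open>{1..2}\<close>, so that both keep their speed.
\<close>

lemma curve_between_join:
  assumes "curve_between x y L1" "curve_between y z L2"
  shows "curve_between x z (L1 + L2)"
proof -
  obtain c1 where c1: "piecewise_C1_on charts 0 1 c1" "c1 0 = x" "c1 1 = y" "integral {0..1} (spd c1) = L1"
    using assms unfolding curve_between_def by blast
  obtain c2 where c2: "piecewise_C1_on charts 0 1 c2" "c2 0 = y" "c2 1 = z" "integral {0..1} (spd c2) = L2"
    using assms unfolding curve_between_def by blast
  define c where "c t = (if t \<le> 1 then c1 t else c2 (1 * t + (-1)))" for t
  have A: "piecewise_C1_on charts 0 1 c"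
    by (rule piecewise_C1_on_cong[OF c1(1)]) (simp add: c_def)
  have s: "piecewise_C1_on charts 1 2 (\<lambda>t. c2 (1 * t + (-1)))"
    by (rule piecewise_C1_on_affine[OF c2(1)]) auto
  have B: "piecewise_C1_on charts 1 2 c"
    by (rule piecewise_C1_on_cong[OF s]) (use c1 c2 in \<open>auto simp: c_def\<close>)
  have C: "piecewise_C1_on charts 0 2 c"
    by (rule piecewise_C1_on_combine[OF A B]) auto
  have im: "(\<lambda>s. (s - (-1)) / 1) ` {0..1::real} = {1..2}"
    by (auto simp: image_iff intro!: bexI[of _ "_ - 1"])
  have "integral {0..1} (spd c) = L1"
    using c1(4) integral_speed_cong[of 0 1 c c1] by (simp add: c_def)
  moreover have "integral {1..2} (spd c) = integral {1..2} (spd (\<lambda>t. c2 (1 * t + (-1))))"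
    by (rule integral_speed_cong) (simp add: c_def)
  moreover have "integral {1..2} (spd (\<lambda>t. c2 (1 * t + (-1)))) = L2"
    using has_integral_speed_affine[OF c2(1), of 1 "-1"] unfolding im c2(4)
    by (intro integral_unique) simp
  moreover have "integral {0..1} (spd c) + integral {1..2} (spd c) = integral {0..2} (spd c)"
    by (rule Henstock_Kurzweil_Integration.integral_combine[OF _ _ speed_integrable[OF C]]) auto
  ultimately have "integral {0..2} (spd c) = L1 + L2" by simp
  then show ?thesis using curve_betweenI[OF C] c1 c2 by (simp add: c_def)
qed

text \<open>
  Segments in a chart have smooth coordinate representations in every other chart, since chart
  changes are smooth.
\<close>

lemma coordinate_segment_C1:
  assumes U: "(U, \<phi>) \<in> charts" and seg: "closed_segment x y \<subseteq> \<phi> ` U"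
  shows "C1_curve_on charts 0 1 (\<lambda>t. inv_into U \<phi> (x + t *\<^sub>R (y - x)))"
proof (rule C1_curve_onI)
  let ?l = "\<lambda>t. x + t *\<^sub>R (y - x)"
  have l: "?l t \<in> \<phi> ` U" if "t \<in> {0..1}" for t
    using seg that unfolding closed_segment_def by (force simp: algebra_simps)
  show "continuous_on {0..1} (\<lambda>t. inv_into U \<phi> (?l t))"
    by (rule continuous_on_compose2[OF continuous_on_inv_chart[OF U]])
       (use l in \<open>auto intro!: continuous_intros\<close>)
  fix V \<psi> assume V: "(V, \<psi>) \<in> charts"
  let ?F = "\<psi> \<circ> inv_into U \<phi>"
  let ?J = "{t \<in> {0..1}. inv_into U \<phi> (?l t) \<in> V}"
  have F: "smooth_on (\<phi> ` (U \<inter> V)) ?F" by (rule compatible[OF U V])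
  have lJ: "?l t \<in> \<phi> ` (U \<inter> V)" if "t \<in> ?J" for t
  proof -
    from l that obtain q where "q \<in> U" "?l t = \<phi> q" by blast
    with that inv_chart[OF U] show ?thesis by auto
  qed
  let ?v = "\<lambda>t. frechet_derivative ?F (at (?l t)) (y - x)"
  show "\<exists>v. continuous_on ?J v \<and> (\<forall>t. t \<in> {0..1} \<longrightarrow> inv_into U \<phi> (?l t) \<in> V \<longrightarrow>
      ((\<psi> \<circ> (\<lambda>t. inv_into U \<phi> (?l t))) has_vector_derivative v t) (at t within ?J))"
  proof (intro exI[of _ ?v] conjI allI impI)
    show "continuous_on ?J ?v"
      by (rule continuous_on_compose2[OF smooth_on_imp_continuous_on_frechet_derivative[OF F]])
         (use lJ in \<open>auto intro!: continuous_intros\<close>)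
    fix t :: real assume "t \<in> {0..1}" "inv_into U \<phi> (?l t) \<in> V"
    then have "?l t \<in> \<phi> ` (U \<inter> V)" using lJ by blast
    then have der: "(?F has_derivative frechet_derivative ?F (at (?l t))) (at (?l t))"
      using smooth_on_imp_differentiable[OF F] by (simp add: frechet_derivative_works)
    have dl: "(?l has_derivative (\<lambda>s. s *\<^sub>R (y - x))) (at t)"
      by (auto intro!: derivative_eq_intros)
    have "linear (frechet_derivative ?F (at (?l t)))" using der by (rule has_derivative_linear)
    then have eq: "frechet_derivative ?F (at (?l t)) \<circ> (\<lambda>s. s *\<^sub>R (y - x)) = (\<lambda>s. s *\<^sub>R ?v t)"
      by (auto simp: linear_scale)
    have "(?F \<circ> ?l has_derivative (\<lambda>s. s *\<^sub>R ?v t)) (at t)"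
      unfolding eq[symmetric] by (rule diff_chain_at[OF dl der])
    then have "((\<psi> \<circ> (\<lambda>t. inv_into U \<phi> (?l t))) has_vector_derivative ?v t) (at t)"
      unfolding has_vector_derivative_def by (simp add: o_def)
    then show "((\<psi> \<circ> (\<lambda>t. inv_into U \<phi> (?l t))) has_vector_derivative ?v t) (at t within ?J)"
      by (rule has_vector_derivative_at_within)
  qed
qed

lemma C1_curve_on_imp_piecewise: "C1_curve_on charts a b c \<Longrightarrow> piecewise_C1_on charts a b c"
proof (rule piecewise_C1_onI[of "{}"])
  assume c: "C1_curve_on charts a b c"
  then show "continuous_on {a..b} c" unfolding C1_curve_on_def by blast
  fix a' b' assume "a \<le> a'" "a' < b'" "b' \<le> b"
  then show "C1_curve_on charts a' b' c"
    using C1_curve_on_affine[OF c, of a' b' 1 0] by simp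
qed simp

text \<open>
  The quadratic form of the metric attains its positive minimum and its maximum on the compact
  product of \<open>K\<close> with the unit sphere.
\<close>

lemma chart_bounds:
  assumes U: "(U, \<phi>) \<in> charts" and K: "compact K" "K \<subseteq> \<phi> ` U"
  obtains m M where "0 < m" "0 < M"
    "\<And>q v. q \<in> U \<Longrightarrow> \<phi> q \<in> K \<Longrightarrow> m * norm v \<le> sqrt (g (U, \<phi>) q v v)"
    "\<And>q v. q \<in> U \<Longrightarrow> \<phi> q \<in> K \<Longrightarrow> sqrt (g (U, \<phi>) q v v) \<le> M * norm v"
proof (cases "K = {}")
  case True
  then show ?thesis using that[of 1 1] by simp
next
  case False
  define f where "f = (\<lambda>(x, v :: 'e). sqrt (g (U, \<phi>) (inv_into U \<phi> x) v v))"
  let ?X = "K \<times> sphere (0 :: 'e) 1"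
  have "continuous_on ?X (\<lambda>z. sqrt (g (U, \<phi>) (inv_into U \<phi> (fst z)) (snd z) (snd z)))"
  proof (intro continuous_intros continuous_on_metric[OF U])
    show "continuous_on ?X (\<lambda>z. inv_into U \<phi> (fst z))"
      by (rule continuous_on_compose2[OF continuous_on_inv_chart[OF U]])
         (use K in \<open>auto intro!: continuous_intros\<close>)
    show "(\<lambda>z. inv_into U \<phi> (fst z)) ` ?X \<subseteq> U"
      using inv_into_into[of _ \<phi> U] K(2) by fastforce
  qed
  then have cf: "continuous_on ?X f" by (simp add: f_def case_prod_unfold)
  have cX: "compact ?X" by (intro compact_Times K compact_sphere)
  obtain b :: 'e where "b \<in> Basis" using nonempty_Basis by blast
  then have neX: "?X \<noteq> {}" using False by force
  obtain z0 where z0: "z0 \<in> ?X" "\<And>z. z \<in> ?X \<Longrightarrow> f z0 \<le> f z"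
    using continuous_attains_inf[OF cX neX cf] by blast
  obtain z1 where z1: "z1 \<in> ?X" "\<And>z. z \<in> ?X \<Longrightarrow> f z \<le> f z1"
    using continuous_attains_sup[OF cX neX cf] by blast
  have pos: "0 < f z" if z: "z \<in> ?X" for z
  proof -
    obtain x v where xv: "z = (x, v)" "x \<in> K" "norm v = 1" using z by (cases z) auto
    then have "inv_into U \<phi> x \<in> U" "v \<noteq> 0" using K(2) by (auto intro: inv_into_into)
    then show ?thesis using positive[OF U] xv(1) by (simp add: f_def)
  qed
  have scale: "sqrt (g (U, \<phi>) q v v) = f (\<phi> q, v /\<^sub>R norm v) * norm v"
    and inX: "(\<phi> q, v /\<^sub>R norm v) \<in> ?X"
    if q: "q \<in> U" "\<phi> q \<in> K" "v \<noteq> 0" for q v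
  proof -
    have "g (U, \<phi>) q v v = g (U, \<phi>) q (norm v *\<^sub>R (v /\<^sub>R norm v)) (norm v *\<^sub>R (v /\<^sub>R norm v))"
      using q(3) by simp
    also have "\<dots> = (norm v)\<^sup>2 * g (U, \<phi>) q (v /\<^sub>R norm v) (v /\<^sub>R norm v)"
      unfolding bilinear_lmul[OF bilinear[OF U q(1)]] bilinear_rmul[OF bilinear[OF U q(1)]]
      by (simp add: power2_eq_square)
    finally show "sqrt (g (U, \<phi>) q v v) = f (\<phi> q, v /\<^sub>R norm v) * norm v"
      using inv_chart[OF U q(1)] by (simp add: f_def real_sqrt_mult mult.commute)
    show "(\<phi> q, v /\<^sub>R norm v) \<in> ?X" using q by simp
  qed
  show ?thesis
  proof (rule that[of "f z0" "f z1"])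
    show "0 < f z0" "0 < f z1" using pos z0 z1 by blast+
    fix q v assume q: "q \<in> U" "\<phi> q \<in> K"
    show "f z0 * norm v \<le> sqrt (g (U, \<phi>) q v v)"
    proof (cases "v = 0")
      case False
      then show ?thesis unfolding scale[OF q False] by (intro mult_right_mono z0(2) inX q) auto
    qed (simp add: metric_nonneg[OF U q(1)])
    show "sqrt (g (U, \<phi>) q v v) \<le> f z1 * norm v"
    proof (cases "v = 0")
      case False
      then show ?thesis unfolding scale[OF q False] by (intro mult_right_mono z1(2) inX q) auto
    qed (simp add: bilinear_lzero[OF bilinear[OF U q(1)]])
  qed
qed

lemma curve_between_in_chart:
  assumes U: "(U, \<phi>) \<in> charts" and K: "convex K" "K \<subseteq> \<phi> ` U"
    and M: "\<And>q v. q \<in> U \<Longrightarrow> \<phi> q \<in> K \<Longrightarrow> sqrt (g (U, \<phi>) q v v) \<le> M * norm v"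
    and pq: "p \<in> U" "q \<in> U" "\<phi> p \<in> K" "\<phi> q \<in> K"
  obtains L where "curve_between p q L" "L \<le> M * norm (\<phi> q - \<phi> p)"
proof -
  define c where "c t = inv_into U \<phi> (\<phi> p + t *\<^sub>R (\<phi> q - \<phi> p))" for t
  have segK: "closed_segment (\<phi> p) (\<phi> q) \<subseteq> K" using K(1) pq by (simp add: closed_segment_subset)
  have C1: "C1_curve_on charts 0 1 c"
    using coordinate_segment_C1[OF U, of "\<phi> p" "\<phi> q"] segK K(2) unfolding c_def by blast
  have pc: "piecewise_C1_on charts 0 1 c" by (rule C1_curve_on_imp_piecewise[OF C1])
  have line: "\<phi> p + t *\<^sub>R (\<phi> q - \<phi> p) \<in> K" if "t \<in> {0..1}" for t
    using segK that unfolding closed_segment_def by (force simp: algebra_simps)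
  have cU: "c t \<in> U" "\<phi> (c t) = \<phi> p + t *\<^sub>R (\<phi> q - \<phi> p)" if "t \<in> {0..1}" for t
    using line[OF that] K(2) unfolding c_def by (auto intro: inv_into_into f_inv_into_f)
  have le: "spd c t \<le> M * norm (\<phi> q - \<phi> p)" if t: "t \<in> {0..1} - {0, 1}" for t
  proof -
    have t': "t \<in> {0<..<1}" "t \<in> {0..1}" using t by auto
    have "((\<lambda>t. \<phi> p + t *\<^sub>R (\<phi> q - \<phi> p)) has_vector_derivative \<phi> q - \<phi> p) (at t)"
      by (auto intro!: derivative_eq_intros)
    then have "((\<phi> \<circ> c) has_vector_derivative \<phi> q - \<phi> p) (at t)"
      by (rule has_vector_derivative_transform_within_open[OF _ open_greaterThanLessThan t'(1)])
         (use cU in auto)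
    then have "vector_derivative (\<phi> \<circ> c) (at t) = \<phi> q - \<phi> p" by (rule vector_derivative_at)
    then have "spd c t = sqrt (g (U, \<phi>) (c t) (\<phi> q - \<phi> p) (\<phi> q - \<phi> p))"
      using speed_eq[OF C1 t'(1) U cU(1)[OF t'(2)]] by simp
    also have "\<dots> \<le> M * norm (\<phi> q - \<phi> p)" using M cU[OF t'(2)] line[OF t'(2)] by simp
    finally show ?thesis .
  qed
  have "(spd c has_integral integral {0..1} (spd c)) {0..1}"
    by (rule integrable_integral[OF speed_integrable[OF pc]])
  then have "((\<lambda>t. if t \<in> {0, 1} then 0 else spd c t) has_integral integral {0..1} (spd c)) {0..1}"
    by (rule has_integral_spike_finite[of "{0, 1}", rotated 2]) auto
  moreover have "((\<lambda>t::real. M * norm (\<phi> q - \<phi> p)) has_integral M * norm (\<phi> q - \<phi> p)) {0..1}"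
    using has_integral_const_real[of "M * norm (\<phi> q - \<phi> p)" 0 1] by simp
  ultimately have "integral {0..1} (spd c) \<le> M * norm (\<phi> q - \<phi> p)"
  proof (rule has_integral_le)
    fix t :: real assume "t \<in> {0..1}"
    moreover have "0 \<le> M * norm (\<phi> q - \<phi> p)"
      by (rule order_trans[OF _ M[OF pq(1,3)]]) (simp add: metric_nonneg[OF U pq(1)])
    ultimately show "(if t \<in> {0, 1} then 0 else spd c t) \<le> M * norm (\<phi> q - \<phi> p)"
      using le[of t] by auto
  qed
  moreover have "c 0 = p" "c 1 = q" using inv_chart[OF U] pq by (simp_all add: c_def)
  ultimately show ?thesis
    using curve_betweenI[OF pc] that by simp
qed

text \<open>
  Inside the patch the coordinate displacement is the integral of the coordinate velocity, whose norm
  is at most the speed divided by \<open>m\<close>.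
\<close>

lemma coordinate_displacement_le:
  assumes U: "(U, \<phi>) \<in> charts" and c: "piecewise_C1_on charts 0 s c" and s: "0 \<le> s"
    and m: "0 < m" "\<And>q v. q \<in> U \<Longrightarrow> \<phi> q \<in> K \<Longrightarrow> m * norm v \<le> sqrt (g (U, \<phi>) q v v)"
    and cK: "\<And>t. t \<in> {0..s} \<Longrightarrow> c t \<in> U" "\<And>t. t \<in> {0..s} \<Longrightarrow> \<phi> (c t) \<in> K"
  shows "m * norm (\<phi> (c s) - \<phi> (c 0)) \<le> integral {0..s} (spd c)"
proof -
  obtain T where T: "finite T" "\<And>t. t \<in> {0<..<s} \<Longrightarrow> t \<notin> T \<Longrightarrow>
    \<exists>a' b'. 0 \<le> a' \<and> a' < t \<and> t < b' \<and> b' \<le> s \<and> C1_curve_on charts a' b' c"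
    by (rule piecewise_C1_on_regular[OF c]) blast
  \<comment> \<open>the velocity is set to zero where it need not exist, for the pointwise bound by the speed\<close>
  define w where "w t = (if t \<in> T \<union> {0, s} then 0 else vector_derivative (\<phi> \<circ> c) (at t))" for t
  have reg: "((\<phi> \<circ> c) has_vector_derivative w t) (at t) \<and> m * norm (w t) \<le> spd c t"
    if t: "t \<in> {0<..<s}" "t \<notin> T" for t
  proof -
    obtain a' b' where ab: "t \<in> {a'<..<b'}" "C1_curve_on charts a' b' c" using T(2)[OF t] by auto
    have ct: "c t \<in> U" "\<phi> (c t) \<in> K" using cK t(1) by auto
    have w: "w t = vector_derivative (\<phi> \<circ> c) (at t)" using t unfolding w_def by auto
    show ?thesis
      unfolding w speed_eq[OF ab(2,1) U ct(1)]
      using C1_curve_on_interior_derivative[OF ab(2) U open_domain[OF U] ab(1) ct(1)] m(2)[OF ct]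
      by blast
  qed
  have "continuous_on {0..s} (\<phi> \<circ> c)"
    by (rule continuous_on_compose)
       (use c cK continuous_on_chart[OF U] in
         \<open>auto simp: piecewise_C1_on_def intro: continuous_on_subset\<close>)
  then have int: "(w has_integral ((\<phi> \<circ> c) s - (\<phi> \<circ> c) 0)) {0..s}"
    by (rule fundamental_theorem_of_calculus_interior_strong[OF T(1) s, rotated]) (use reg in auto)
  have "norm (integral {0..s} w) \<le> integral {0..s} (\<lambda>t. spd c t / m)"
  proof (rule Henstock_Kurzweil_Integration.integral_norm_bound_integral)
    show "w integrable_on {0..s}" using int by blast
    show "(\<lambda>t. spd c t / m) integrable_on {0..s}"
      by (rule integrable_on_divide[OF speed_integrable[OF c]])
    fix t assume "t \<in> {0..s}"
    then show "norm (w t) \<le> spd c t / m"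
      using reg[of t] m(1) speed_nonneg[of c t]
      by (cases "t \<in> T \<union> {0, s}") (auto simp: w_def field_simps)
  qed
  then have "norm (\<phi> (c s) - \<phi> (c 0)) \<le> integral {0..s} (spd c) / m"
    using integral_unique[OF int] by simp
  then show ?thesis using m(1) by (simp add: field_simps)
qed

text \<open>
  A curve leaving the coordinate ball of radius \<open>r\<close> has, up to the first exit, a coordinate
  displacement of at least \<open>r\<close>. The exit point itself still lies in the chart, because the
  coordinate closed ball is compact and hence closed in the manifold.
\<close>

lemma exit_length:
  assumes U: "(U, \<phi>) \<in> charts" "p \<in> U" and r: "0 < r" "cball (\<phi> p) r \<subseteq> \<phi> ` U"
    and m: "0 < m" "\<And>q v. q \<in> U \<Longrightarrow> \<phi> q \<in> cball (\<phi> p) r \<Longrightarrow> m * norm v \<le> sqrt (g (U, \<phi>) q v v)"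
    and c: "curve_between p q L" "L < m * r"
  shows "q \<in> U \<and> \<phi> q \<in> ball (\<phi> p) r"
proof (rule ccontr)
  assume not: "\<not> (q \<in> U \<and> \<phi> q \<in> ball (\<phi> p) r)"
  obtain c where c': "piecewise_C1_on charts 0 1 c" "c 0 = p" "c 1 = q" "integral {0..1} (spd c) = L"
    using c(1) unfolding curve_between_def by blast
  have contc: "continuous_on {0..1} c" using c'(1) unfolding piecewise_C1_on_def by blast
  define V where "V = U \<inter> \<phi> -` ball (\<phi> p) r"
  have openV: "open V"
    unfolding V_def by (rule continuous_open_preimage[OF continuous_on_chart[OF U(1)] open_domain[OF U(1)]]) simp
  define S where "S = {0..1} \<inter> c -` (- V)"
  have S1: "closed S"
    unfolding S_def by (rule continuous_closed_preimage[OF contc]) (use openV in auto)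
  have "1 \<in> S" using not c'(3) unfolding S_def V_def by auto
  have bS: "bdd_below S" unfolding S_def by auto
  define s where "s = Inf S"
  have sS: "s \<in> S" unfolding s_def using closed_contains_Inf[OF _ bS S1] \<open>1 \<in> S\<close> by blast
  have before: "c t \<in> V" if "0 \<le> t" "t < s" for t
  proof (rule ccontr)
    assume "c t \<notin> V"
    then have "t \<in> S" using that sS unfolding S_def by auto
    then show False using cInf_lower[OF _ bS] that unfolding s_def by force
  qed
  have "c 0 \<in> V" using c'(2) U r unfolding V_def by simp
  then have s01: "0 < s" "s \<le> 1" using sS unfolding S_def by (auto simp: less_le)
  define C where "C = inv_into U \<phi> ` cball (\<phi> p) r"
  have "compact C"
    unfolding C_def by (rule compact_continuous_image[OF continuous_on_subset[OF continuous_on_inv_chart[OF U(1)] r(2)]]) simp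
  then have "closed C" by (rule compact_imp_closed)
  have VC: "V \<subseteq> C"
  proof
    fix x assume "x \<in> V"
    then have "x = inv_into U \<phi> (\<phi> x)" "\<phi> x \<in> cball (\<phi> p) r"
      using inv_chart[OF U(1)] unfolding V_def by auto
    then show "x \<in> C" unfolding C_def by blast
  qed
  have "c ` closure {0..<s} \<subseteq> C"
  proof (rule image_closure_subset)
    show "continuous_on (closure {0..<s}) c"
      using s01 by (auto intro: continuous_on_subset[OF contc])
    show "c ` {0..<s} \<subseteq> C" using before VC by auto
  qed fact
  then have inC: "c t \<in> C" if "t \<in> {0..s}" for t using that s01 by auto
  have C: "x \<in> U" "\<phi> x \<in> cball (\<phi> p) r" if "x \<in> C" for x
    using that r(2) unfolding C_def by (auto intro: inv_into_into simp: subsetD f_inv_into_f)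
  have pc: "piecewise_C1_on charts 0 s c" by (rule piecewise_C1_on_subinterval[OF c'(1)]) (use s01 in auto)
  have "m * norm (\<phi> (c s) - \<phi> (c 0)) \<le> integral {0..s} (spd c)"
    by (rule coordinate_displacement_le[OF U(1) pc less_imp_le[OF s01(1)] m C[OF inC]])
  moreover have "c s \<notin> V" "c s \<in> U" using sS inC[of s] C(1) s01 unfolding S_def by auto
  then have "r \<le> norm (\<phi> (c s) - \<phi> (c 0))"
    unfolding V_def c'(2) by (auto simp: dist_norm norm_minus_commute)
  then have "m * r \<le> m * norm (\<phi> (c s) - \<phi> (c 0))" using m(1) by simp
  moreover have "integral {0..s} (spd c) \<le> integral {0..1} (spd c)"
    by (rule integral_subset_le) (use s01 speed_integrable[OF pc] speed_integrable[OF c'(1)] speed_nonneg in auto)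
  ultimately show False using c(2) c'(4) by simp
qed

lemma chart_cball:
  obtains U \<phi> r where "(U, \<phi>) \<in> charts" "p \<in> U" "0 < r" "cball (\<phi> p) r \<subseteq> \<phi> ` U"
proof -
  obtain U \<phi> where U: "(U, \<phi>) \<in> charts" "p \<in> U" by (rule chart_at)
  then obtain r where "0 < r" "cball (\<phi> p) r \<subseteq> \<phi> ` U"
    using open_image[OF U(1)] open_contains_cball by (metis imageI)
  with U that show ?thesis by blast
qed

text \<open>
  By coordinate segments the classes of mutually joinable points are open, so there is only one.
\<close>

lemma curve_between_exists:
  assumes "connected (UNIV :: 'a set)"
  shows "\<exists>L. curve_between x y L"
proof -
  \<comment> \<open>the class of points joinable to \<open>x\<close>\<close>
  define R where "R = (\<lambda>x. {y. \<exists>L. curve_between x y L})"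
  have openR: "open (R x)" for x
  proof (rule topological_space_class.openI)
    fix p assume p: "p \<in> R x"
    obtain U \<phi> r where U: "(U, \<phi>) \<in> charts" "p \<in> U" "0 < r" "cball (\<phi> p) r \<subseteq> \<phi> ` U"
      by (rule chart_cball)
    obtain m M where "0 < m" "0 < M"
      and "\<And>q v. q \<in> U \<Longrightarrow> \<phi> q \<in> cball (\<phi> p) r \<Longrightarrow> m * norm v \<le> sqrt (g (U, \<phi>) q v v)"
      and mM: "\<And>q v. q \<in> U \<Longrightarrow> \<phi> q \<in> cball (\<phi> p) r \<Longrightarrow> sqrt (g (U, \<phi>) q v v) \<le> M * norm v"
      by (rule chart_bounds[OF U(1) compact_cball U(4)]) blast
    have "open (U \<inter> \<phi> -` ball (\<phi> p) r)"
      by (rule continuous_open_preimage[OF continuous_on_chart[OF U(1)] open_domain[OF U(1)]]) simp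
    moreover have "p \<in> U \<inter> \<phi> -` ball (\<phi> p) r" using U by simp
    moreover have "U \<inter> \<phi> -` ball (\<phi> p) r \<subseteq> R x"
    proof
      fix q assume q: "q \<in> U \<inter> \<phi> -` ball (\<phi> p) r"
      obtain L where "curve_between p q L"
        by (rule curve_between_in_chart[OF U(1) convex_cball U(4) mM U(2), of q]) (use q U in auto)
      then show "q \<in> R x" using p curve_between_join unfolding R_def by blast
    qed
    ultimately show "\<exists>T. open T \<and> p \<in> T \<and> T \<subseteq> R x" by blast
  qed
  have "- R x = (\<Union>z\<in>- R x. R z)"
  proof (intro equalityI subsetI)
    fix z assume "z \<in> - R x"
    then show "z \<in> (\<Union>z\<in>- R x. R z)" using curve_between_self unfolding R_def by blast
  next
    fix w assume "w \<in> (\<Union>z\<in>- R x. R z)"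
    then show "w \<in> - R x"
      using curve_between_join curve_between_rev unfolding R_def by blast
  qed
  then have "open (- R x)" using openR by (metis open_UN)
  then have "R x = {} \<or> R x = UNIV"
    using assms openR[of x] unfolding connected_clopen by (simp add: closed_def)
  then show ?thesis using curve_between_self unfolding R_def by blast
qed

end

section \<open>The Riemannian distance\<close>

context riemannian_manifold
begin

lemma rd_lessD:
  assumes "connected (UNIV :: 'a set)" "rd x y < e"
  obtains L where "curve_between x y L" "L < e"
proof -
  have "{L. curve_between x y L} \<noteq> {}" using curve_between_exists[OF assms(1)] by blast
  from cInf_lessD[OF this] assms(2) that show ?thesis unfolding rd_eq by blast
qed

text \<open>
  Short curves do not leave a coordinate ball contained in \<open>W\<close>. This makes the distance positive
  and its topology at least as fine as the given one.
\<close>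

lemma rd_small_imp_in_open:
  assumes conn: "connected (UNIV :: 'a set)" and W: "open W" "p \<in> W"
  shows "\<exists>\<delta>>0. \<forall>q. rd p q < \<delta> \<longrightarrow> q \<in> W"
proof -
  obtain U \<phi> where U: "(U, \<phi>) \<in> charts" "p \<in> U" by (rule chart_at)
  have "open (\<phi> ` U \<inter> inv_into U \<phi> -` W)"
    by (rule continuous_open_preimage[OF continuous_on_inv_chart[OF U(1)] open_image[OF U(1)] W(1)])
  moreover have "\<phi> p \<in> \<phi> ` U \<inter> inv_into U \<phi> -` W" using U W inv_chart[OF U] by simp
  ultimately obtain r where r: "0 < r" "cball (\<phi> p) r \<subseteq> \<phi> ` U \<inter> inv_into U \<phi> -` W"
    using open_contains_cball by blast
  then have sub: "cball (\<phi> p) r \<subseteq> \<phi> ` U" by blast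
  obtain m M where m: "0 < m" "0 < M"
    "\<And>q v. q \<in> U \<Longrightarrow> \<phi> q \<in> cball (\<phi> p) r \<Longrightarrow> m * norm v \<le> sqrt (g (U, \<phi>) q v v)"
    "\<And>q v. q \<in> U \<Longrightarrow> \<phi> q \<in> cball (\<phi> p) r \<Longrightarrow> sqrt (g (U, \<phi>) q v v) \<le> M * norm v"
    by (rule chart_bounds[OF U(1) compact_cball sub]) blast
  have "q \<in> W" if q: "rd p q < m * r" for q
  proof -
    obtain L where L: "curve_between p q L" "L < m * r" by (rule rd_lessD[OF conn q])
    have "q \<in> U \<and> \<phi> q \<in> ball (\<phi> p) r" by (rule exit_length[OF U r(1) sub m(1,3) L])
    then have "q \<in> U" "\<phi> q \<in> cball (\<phi> p) r" by auto
    then have "q \<in> U" "inv_into U \<phi> (\<phi> q) \<in> W" using r(2) by blast+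
    then show ?thesis using inv_chart[OF U(1)] by simp
  qed
  then show ?thesis using m(1) r(1) by (intro exI[of _ "m * r"]) simp
qed

lemma rd_small_nearby:
  assumes "0 < e"
  shows "\<exists>W. open W \<and> p \<in> W \<and> (\<forall>q\<in>W. rd p q < e)"
proof -
  obtain U \<phi> r where U: "(U, \<phi>) \<in> charts" "p \<in> U" "0 < r" "cball (\<phi> p) r \<subseteq> \<phi> ` U"
    by (rule chart_cball)
  obtain m M where m: "0 < m" "0 < M"
    "\<And>q v. q \<in> U \<Longrightarrow> \<phi> q \<in> cball (\<phi> p) r \<Longrightarrow> m * norm v \<le> sqrt (g (U, \<phi>) q v v)"
    "\<And>q v. q \<in> U \<Longrightarrow> \<phi> q \<in> cball (\<phi> p) r \<Longrightarrow> sqrt (g (U, \<phi>) q v v) \<le> M * norm v"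
    by (rule chart_bounds[OF U(1) compact_cball U(4)]) blast
  let ?W = "U \<inter> \<phi> -` ball (\<phi> p) (min r (e / M))"
  have "open ?W"
    by (rule continuous_open_preimage[OF continuous_on_chart[OF U(1)] open_domain[OF U(1)]]) simp
  moreover have "p \<in> ?W" using U m assms by simp
  moreover have "rd p q < e" if q: "q \<in> ?W" for q
  proof -
    obtain L where L: "curve_between p q L" "L \<le> M * norm (\<phi> q - \<phi> p)"
      by (rule curve_between_in_chart[OF U(1) convex_cball U(4) m(4) U(2), of q]) (use q U in auto)
    have "norm (\<phi> q - \<phi> p) < e / M" using q by (simp add: dist_norm norm_minus_commute)
    then have "M * norm (\<phi> q - \<phi> p) < e" using m(2) by (simp add: field_simps)
    then show ?thesis using rd_le_curve[OF L(1)] L(2) by simp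
  qed
  ultimately show ?thesis by blast
qed

lemma rd_nonneg: "connected (UNIV :: 'a set) \<Longrightarrow> 0 \<le> rd x y"
  unfolding rd_eq by (rule cInf_greatest) (use curve_between_exists curve_between_nonneg in auto)

lemma rd_commute: "rd x y = rd y x"
  unfolding rd_eq by (rule arg_cong[where f=Inf]) (auto intro: curve_between_rev)

lemma rd_triangle:
  assumes conn: "connected (UNIV :: 'a set)"
  shows "rd x z \<le> rd x y + rd y z"
proof (rule field_le_epsilon)
  fix e :: real assume "0 < e"
  then have 1: "rd x y < rd x y + e / 2" and 2: "rd y z < rd y z + e / 2" by simp_all
  obtain L1 where L1: "curve_between x y L1" "L1 < rd x y + e / 2" by (rule rd_lessD[OF conn 1])
  obtain L2 where L2: "curve_between y z L2" "L2 < rd y z + e / 2" by (rule rd_lessD[OF conn 2])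
  have "rd x z \<le> L1 + L2" by (rule rd_le_curve[OF curve_between_join[OF L1(1) L2(1)]])
  then show "rd x z \<le> rd x y + rd y z + e" using L1(2) L2(2) by simp
qed

lemma rd_eq_0_iff:
  assumes conn: "connected (UNIV :: 'a set)"
  shows "rd x y = 0 \<longleftrightarrow> x = y"
proof
  assume 0: "rd x y = 0"
  show "x = y"
  proof (rule ccontr)
    assume "x \<noteq> y"
    then obtain \<delta> where "\<delta> > 0" "\<And>q. rd x q < \<delta> \<Longrightarrow> q \<in> - {y}"
      using rd_small_imp_in_open[OF conn, of "- {y}" x] by auto
    with 0 show False by force
  qed
next
  assume "x = y"
  then show "rd x y = 0"
    using rd_le_curve[OF curve_between_self, of y] rd_nonneg[OF conn, of y y] by simp
qed

lemma Metric_space_rd: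
  "connected (UNIV :: 'a set) \<Longrightarrow> Metric_space UNIV rd"
  by (simp add: Metric_space_def rd_nonneg rd_commute rd_eq_0_iff rd_triangle)

lemma mtopology_rd:
  assumes conn: "connected (UNIV :: 'a set)"
  shows "Metric_space.mtopology UNIV rd = euclidean"
proof -
  interpret m: Metric_space UNIV rd by (rule Metric_space_rd[OF conn])
  have "openin m.mtopology W \<longleftrightarrow> open W" for W
  proof
    assume W: "openin m.mtopology W"
    show "open W"
    proof (rule topological_space_class.openI)
      fix p assume "p \<in> W"
      then obtain r where r: "r > 0" "m.mball p r \<subseteq> W" using W unfolding m.openin_mtopology by blast
      obtain V where "open V" "p \<in> V" "\<forall>q\<in>V. rd p q < r" using rd_small_nearby[OF r(1)] by blast
      with r(2) show "\<exists>T. open T \<and> p \<in> T \<and> T \<subseteq> W" by (intro exI[of _ V]) auto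
    qed
  next
    assume W: "open W"
    show "openin m.mtopology W"
      unfolding m.openin_mtopology
    proof (intro conjI allI impI)
      fix p assume "p \<in> W"
      from rd_small_imp_in_open[OF conn W this] show "\<exists>r>0. m.mball p r \<subseteq> W" by auto
    qed simp
  qed
  then show ?thesis by (simp add: topology_eq)
qed

text \<open>
  On a nearly shortest curve the distance from \<open>x\<close> takes the value \<open>s\<close>, and the rest of the curve
  bounds the distance from there to \<open>y\<close>.
\<close>

lemma rd_between:
  assumes conn: "connected (UNIV :: 'a set)" and s: "0 \<le> s" "s \<le> rd x y" and e: "0 < e"
  shows "\<exists>z. rd x z = s \<and> rd z y \<le> rd x y - s + e"
proof -
  obtain L where L: "curve_between x y L" "L < rd x y + e" by (rule rd_lessD[OF conn, of x y "rd x y + e"]) (use e in auto)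
  then obtain c where c: "piecewise_C1_on charts 0 1 c" "c 0 = x" "c 1 = y" "integral {0..1} (spd c) = L"
    unfolding curve_between_def by blast
  have sub: "rd (c a) (c b) \<le> integral {a..b} (spd c)" if "0 \<le> a" "a \<le> b" "b \<le> 1" for a b
  proof (cases "a = b")
    case True
    then show ?thesis using rd_eq_0_iff[OF conn, of "c b" "c b"] by simp
  next
    case False
    then show ?thesis
      using that
      by (intro rd_le_curve[OF curve_betweenI[OF piecewise_C1_on_subinterval[OF c(1)]]]) simp_all
  qed
  have "isCont (rd x) p" for p
    unfolding isCont_def
  proof (rule tendstoI)
    fix e' :: real assume "0 < e'"
    then obtain V where V: "open V" "p \<in> V" "\<And>q. q \<in> V \<Longrightarrow> rd p q < e'"
      using rd_small_nearby[OF \<open>0 < e'\<close>, of p] by blast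
    have "dist (rd x q) (rd x p) < e'" if "q \<in> V" for q
      using V(3)[OF that] rd_triangle[OF conn, of x q p] rd_triangle[OF conn, of x p q] rd_commute[of p q]
      by (simp add: dist_real_def abs_less_iff)
    then show "\<forall>\<^sub>F q in at p. dist (rd x q) (rd x p) < e'"
      unfolding eventually_at_topological using V(1,2) by blast
  qed
  then have "continuous_on (c ` {0..1}) (rd x)" by (simp add: continuous_at_imp_continuous_on)
  then have "continuous_on {0..1} (\<lambda>t. rd x (c t))"
    by (rule continuous_on_compose2) (use c(1) in \<open>auto simp: piecewise_C1_on_def\<close>)
  moreover have "rd x (c 0) \<le> s" "s \<le> rd x (c 1)" using s c rd_eq_0_iff[OF conn, of x x] by simp_all
  ultimately obtain t where t: "0 \<le> t" "t \<le> 1" "rd x (c t) = s"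
    using IVT'[of "\<lambda>t. rd x (c t)" 0 s 1] by auto
  have "integral {0..t} (spd c) + integral {t..1} (spd c) = L"
    unfolding c(4)[symmetric]
    by (rule Henstock_Kurzweil_Integration.integral_combine[OF t(1,2) speed_integrable[OF c(1)]])
  moreover have "s \<le> integral {0..t} (spd c)" using sub[of 0 t] t c(2) by simp
  moreover have "rd (c t) y \<le> integral {t..1} (spd c)" using sub[of t 1] t c(3) by simp
  ultimately have "rd (c t) y \<le> rd x y - s + e" using L(2) by simp
  with t(3) show ?thesis by blast
qed

lemma length_space_rd: "connected (UNIV :: 'a set) \<Longrightarrow> length_space rd"
  by (rule length_space.intro) (rule Metric_space_rd mtopology_rd rd_between; assumption)+

lemma compact_neighbourhood:
  "\<exists>W K. open W \<and> compact K \<and> p \<in> W \<and> W \<subseteq> K" for p :: 'a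
proof -
  obtain U \<phi> r where U: "(U, \<phi>) \<in> charts" "p \<in> U" "0 < r" "cball (\<phi> p) r \<subseteq> \<phi> ` U"
    by (rule chart_cball)
  let ?W = "U \<inter> \<phi> -` ball (\<phi> p) r" and ?K = "inv_into U \<phi> ` cball (\<phi> p) r"
  have "open ?W"
    by (rule continuous_open_preimage[OF continuous_on_chart[OF U(1)] open_domain[OF U(1)]]) simp
  moreover have "compact ?K"
    by (rule compact_continuous_image[OF continuous_on_subset[OF continuous_on_inv_chart[OF U(1)] U(4)]]) simp
  moreover have "?W \<subseteq> ?K"
  proof
    fix x assume "x \<in> ?W"
    then have "x = inv_into U \<phi> (\<phi> x)" "\<phi> x \<in> cball (\<phi> p) r" using inv_chart[OF U(1)] by auto
    then show "x \<in> ?K" by blast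
  qed
  moreover have "p \<in> ?W" using U by simp
  ultimately show ?thesis by blast
qed

end

section \<open>Complete Riemannian manifolds\<close>

theorem theorem2:
  fixes charts :: "('a::{t2_space, second_countable_topology}, 'e::euclidean_space) chart set"
    and g :: "('a, 'e) chart \<Rightarrow> 'a \<Rightarrow> 'e \<Rightarrow> 'e \<Rightarrow> real"
  assumes "riemannian_manifold charts g"
    and "connected (UNIV :: 'a set)"
    and "\<not> compact (UNIV :: 'a set)"
    and "Metric_space.mcomplete UNIV (riemannian_dist charts g)"
  shows "peano_space (M_natural (riemannian_dist charts g)) \<and>
    is_remainder (euclidean :: 'a topology) (M_natural (riemannian_dist charts g)) \<and>
    (\<forall>(C :: 'c topology) i.
       compactification_with_remainder (euclidean :: 'a topology) C i
         (M_natural (riemannian_dist charts g)) \<longrightarrow>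
       compactification_less (euclidean :: 'a topology) C i
         (stone_cech euclidean) (stone_cech_map euclidean))"
proof -
  interpret riemannian_manifold charts g by (rule assms(1))
  interpret length_space "riemannian_dist charts g" by (rule length_space_rd[OF assms(2)])
  interpret proper_length_space "riemannian_dist charts g"
    by (rule proper_length_space_if_complete[OF assms(4) compact_neighbourhood assms(3)])
  show ?thesis
    using peano_M_natural is_remainder_M_natural compactification_less_stone_cech[OF assms(2)] by blast
qed

end
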